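(* Let $f\in\mathbb{Z}[t_1,t_2,t_3]$ be a nondegenerate ternary quadratic form that is anisotropic (over $\mathbb{Q}$). Then $\delta(f)<1$.
   Context: $D_f\coloneqq f(\mathbb{Z}^3)\setminus\{0\}$. For $S\subset\mathbb{Z}$: $S$ is positive if it contains no negative integers, negative if it contains no positive integers, indefinite otherwise. The density of $S$ is $\lim_{N\to\infty}\#(S\cap[1,N])/N$ if $S$ is positive, $\lim_{N\to\infty}\#(S\cap[-N,-1])/N$ if $S$ is negative, and $\lim_{N\to\infty}\#(S\cap[-N,N])/(2N)$ if $S$ is indefinite (the limit being required to exist). $\delta(f)$ denotes the density of $D_f$. *)

theory Defs
  imports "HOL-Analysis.Analysis"
begin

text \<open>
  A value of the following type is a homogeneous quadratic polynomial in
  \<open>\<int>[t\<^sub>1, t\<^sub>2, t\<^sub>3]\<close>; the field \<open>cij\<close> is the coefficient of \<open>t\<^sub>i t\<^sub>j\<close>,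
  so the mixed coefficients need not be even.
\<close>

datatype ternary_form =
  Ternary_Form (c11: int) (c22: int) (c33: int) (c12: int) (c13: int) (c23: int)

definition form_eval :: "ternary_form \<Rightarrow> 'a::comm_ring_1 \<Rightarrow> 'a \<Rightarrow> 'a \<Rightarrow> 'a" where
  "form_eval f x y z =
     of_int (c11 f) * x\<^sup>2 + of_int (c22 f) * y\<^sup>2 + of_int (c33 f) * z\<^sup>2
     + of_int (c12 f) * x * y + of_int (c13 f) * x * z + of_int (c23 f) * y * z"

definition gram_matrix :: "ternary_form \<Rightarrow> rat^3^3" where
  "gram_matrix f = vector
     [vector [of_int (c11 f), of_int (c12 f) / 2, of_int (c13 f) / 2],
      vector [of_int (c12 f) / 2, of_int (c22 f), of_int (c23 f) / 2],
      vector [of_int (c13 f) / 2, of_int (c23 f) / 2, of_int (c33 f)]]"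

definition nondegenerate :: "ternary_form \<Rightarrow> bool" where
  "nondegenerate f \<longleftrightarrow> det (gram_matrix f) \<noteq> 0"

definition anisotropic :: "ternary_form \<Rightarrow> bool" where
  "anisotropic f \<longleftrightarrow>
     (\<forall>x y z :: rat. form_eval f x y z = 0 \<longrightarrow> x = 0 \<and> y = 0 \<and> z = 0)"

definition nonzero_values :: "ternary_form \<Rightarrow> int set" where
  "nonzero_values f = {form_eval f x y z | x y z :: int. True} - {0}"

definition positive_set :: "int set \<Rightarrow> bool" where
  "positive_set S \<longleftrightarrow> (\<forall>n\<in>S. \<not> n < 0)"

definition negative_set :: "int set \<Rightarrow> bool" where
  "negative_set S \<longleftrightarrow> (\<forall>n\<in>S. \<not> n > 0)"

text \<open>
  A set that is both positive and negative is contained in \<open>{0}\<close>, and then the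
  first two branches agree.
\<close>

definition density_seq :: "int set \<Rightarrow> nat \<Rightarrow> real" where
  "density_seq S N =
     (if positive_set S then real (card (S \<inter> {1..int N})) / real N
      else if negative_set S then real (card (S \<inter> {- int N..-1})) / real N
      else real (card (S \<inter> {- int N..int N})) / (2 * real N))"

definition has_density :: "int set \<Rightarrow> bool" where
  "has_density S \<longleftrightarrow> convergent (density_seq S)"

text \<open>Meaningful only if \<open>has_density S\<close> holds.\<close>

definition density :: "int set \<Rightarrow> real" where
  "density S = lim (density_seq S)"

definition form_density :: "ternary_form \<Rightarrow> real" where
  "form_density f = density (nonzero_values f)"

end

theory Submission
  imports Defs
begin

text \<open>
  Over an orthogonal basis of a sublattice, the values of \<open>f\<close> on a coset of a multiple of that
  sublattice are \<open>r + M F(u)\<close> with \<open>F(u) = \<Sum> l\<^sub>i u\<^sub>i + q \<Sum> a\<^sub>i u\<^sub>i\<^sup>2\<close>, where all primes up to a bound \<open>P\<close>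
  divide \<open>q\<close> but none of them divides all \<open>l\<^sub>i\<close>. The second moment of the number of representations
  \<open>F(u) = k\<close> is elementary: with \<open>s = u - u'\<close> and \<open>t = u + u'\<close> the equation \<open>F(u) = F(u')\<close> becomes
  \<open>\<Sum> s\<^sub>i (l\<^sub>i + q a\<^sub>i t\<^sub>i) = 0\<close>, a lattice-point count in the plane for each fixed \<open>t\<close>. As no small
  prime divides all three coefficients, the second moment exceeds the square of the first by a factor
  \<open>1 + O(1/P)\<close> only, and by Cauchy-Schwarz \<open>F\<close> represents all positive integers outside a set of
  density \<open>O(1/P)\<close>. So, up to small density, membership in the set of values is decided by the
  residue modulo a highly divisible integer, and the density exists.

  Legendre's descent on \<open>z\<^sup>2 = a x\<^sup>2 + b y\<^sup>2\<close>, run with the local conditions at all finite primes and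
  none at infinity, ends at \<open>(\<plusminus>1, \<plusminus>1)\<close>; the only insoluble case \<open>(-1, -1)\<close> is excluded at \<open>2\<close>. Hence a
  form that is anisotropic over the rationals, definite or not, is anisotropic at some prime \<open>p\<close>.
  There it does not represent minus its discriminant, so a whole residue class modulo a power of \<open>p\<close>
  is missed and the density is less than one.
\<close>

section \<open>Linear congruences in boxes\<close>

text \<open>The excess factor 1 + O(1/P) arises as follows. Let c_i = l_i + q a_i t_i, with gcd g.
  For typical t the admissible (u'_2, u'_3) form, if there are any, a coset of a plane lattice of
  index c_1/g, so t contributes up to g times the expected number of points. A common divisor e of
  the c_i is prime to q and to every a_i; hence a proportion of about e^-3 of all t has g = e, and
  the excess is the sum of e * e^-3 over e > P. The obstacle is uniformity: the lattice count is
  accurate only if the lattice has no very short vector. The t with such a vector contribute, under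
  the trivial bound, as much as the main term, and a second saving is needed for them. Definite and
  indefinite forms are treated alike by letting positivity come from a_1 > 0 alone: the box is long
  in u_1 and short in u_2, u_3, by a fixed ratio s, so the values in it are positive and close to q
  a_1 u_1^2. The losses vanish as s grows.\<close>

lemma pigeonhole_congruence:
  fixes c \<alpha> \<beta> m n :: int
  assumes "c > 0" "m > 0" "n > 0" "c < m * n"
  obtains x y where "(x, y) \<noteq> (0, 0)" "\<bar>x\<bar> < m" "\<bar>y\<bar> < n" "c dvd \<alpha> * x + \<beta> * y"
proof -
  let ?B = "{0..<m} \<times> {0..<n}"
  let ?\<psi> = "\<lambda>(x, y). (\<alpha> * x + \<beta> * y) mod c"
  have "?\<psi> ` ?B \<subseteq> {0..<c}" using assms by auto
  then have "card (?\<psi> ` ?B) \<le> card {0..<c}" by (intro card_mono) auto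
  also have "\<dots> = nat c" by simp
  also have "\<dots> < nat (m * n)" using assms by simp
  also have "\<dots> = card ?B" using assms by (simp add: card_cartesian_product nat_mult_distrib)
  finally have "\<not> inj_on ?\<psi> ?B" by (rule pigeonhole)
  then obtain x y x' y' where xy: "(x, y) \<in> ?B" "(x', y') \<in> ?B" "(x, y) \<noteq> (x', y')"
    "(\<alpha> * x + \<beta> * y) mod c = (\<alpha> * x' + \<beta> * y') mod c"
    by (auto simp: inj_on_def)
  have "c dvd (\<alpha> * x + \<beta> * y) - (\<alpha> * x' + \<beta> * y')"
    using xy(4) by (simp add: mod_eq_dvd_iff)
  then have "c dvd \<alpha> * (x - x') + \<beta> * (y - y')" by (simp add: algebra_simps)
  moreover have "\<bar>x - x'\<bar> < m" "\<bar>y - y'\<bar> < n" "(x - x', y - y') \<noteq> (0, 0)" using xy by auto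
  ultimately show ?thesis using that by blast
qed

text \<open>Reduction modulo the sublattice spanned by the two independent vectors:
  \<open>l1\<close>, \<open>l2\<close> are the coordinates of (x, y) by Cramer's rule, and removing
  their integral parts leaves a point with coordinates at most h + h.\<close>

lemma parallelogram_representative:
  fixes c \<alpha> \<beta> h x1 y1 x2 y2 x y :: int
  assumes "c dvd \<alpha> * x1 + \<beta> * y1" "c dvd \<alpha> * x2 + \<beta> * y2"
    and "\<bar>x1\<bar> \<le> h" "\<bar>y1\<bar> \<le> h" "\<bar>x2\<bar> \<le> h" "\<bar>y2\<bar> \<le> h" "x1 * y2 \<noteq> x2 * y1"
  obtains x' y' where "\<bar>x'\<bar> \<le> 2 * h" "\<bar>y'\<bar> \<le> 2 * h"
    "(\<alpha> * x + \<beta> * y) mod c = (\<alpha> * x' + \<beta> * y') mod c"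
proof -
  define D where "D = real_of_int (x1 * y2 - x2 * y1)"
  have D: "D \<noteq> 0" using assms(7) by (simp add: D_def flip: of_int_mult)
  define l1 where "l1 = real_of_int (x * y2 - y * x2) / D"
  define l2 where "l2 = real_of_int (x1 * y - y1 * x) / D"
  have X: "real_of_int x = l1 * x1 + l2 * x2"
  proof -
    have "D * (l1 * x1 + l2 * x2) = (x * y2 - y * x2) * x1 + (x1 * y - y1 * x) * x2"
      unfolding l1_def l2_def using D by (simp add: field_simps)
    also have "\<dots> = D * x" by (simp add: D_def algebra_simps)
    finally show ?thesis using D by simp
  qed
  have Y: "real_of_int y = l1 * y1 + l2 * y2"
  proof -
    have "D * (l1 * y1 + l2 * y2) = (x * y2 - y * x2) * y1 + (x1 * y - y1 * x) * y2"
      unfolding l1_def l2_def using D by (simp add: field_simps)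
    also have "\<dots> = D * y" by (simp add: D_def algebra_simps)
    finally show ?thesis using D by simp
  qed
  define i1 i2 where "i1 = \<lfloor>l1\<rfloor>" and "i2 = \<lfloor>l2\<rfloor>"
  have fr: "0 \<le> l1 - i1" "l1 - i1 \<le> 1" "0 \<le> l2 - i2" "l2 - i2 \<le> 1"
    unfolding i1_def i2_def by linarith+
  have bound: "\<bar>z\<bar> \<le> 2 * h"
    if "\<bar>z1\<bar> \<le> h" "\<bar>z2\<bar> \<le> h" "real_of_int z = (l1 - i1) * z1 + (l2 - i2) * z2" for z z1 z2
  proof -
    have "\<bar>(l1 - i1) * z1\<bar> \<le> 1 * real_of_int h"
      unfolding abs_mult using that fr by (intro mult_mono) auto
    moreover have "\<bar>(l2 - i2) * z2\<bar> \<le> 1 * real_of_int h"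
      unfolding abs_mult using that fr by (intro mult_mono) auto
    ultimately have "\<bar>real_of_int z\<bar> \<le> 2 * real_of_int h" using that(3) by linarith
    then show ?thesis by linarith
  qed
  let ?x = "x - i1 * x1 - i2 * x2" and ?y = "y - i1 * y1 - i2 * y2"
  have "\<bar>?x\<bar> \<le> 2 * h" by (rule bound[of x1 x2]) (use assms X in \<open>auto simp: algebra_simps\<close>)
  moreover have "\<bar>?y\<bar> \<le> 2 * h" by (rule bound[of y1 y2]) (use assms Y in \<open>auto simp: algebra_simps\<close>)
  moreover have "(\<alpha> * x + \<beta> * y) mod c = (\<alpha> * ?x + \<beta> * ?y) mod c"
  proof -
    have "\<alpha> * x + \<beta> * y - (\<alpha> * ?x + \<beta> * ?y) = i1 * (\<alpha> * x1 + \<beta> * y1) + i2 * (\<alpha> * x2 + \<beta> * y2)"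
      by (simp add: algebra_simps)
    then show ?thesis using assms(1,2) by (simp add: mod_eq_dvd_iff)
  qed
  ultimately show ?thesis using that by blast
qed

text \<open>Let the first vector have minimal sup norm k, so that K < k <= h. Pigeonhole in a box of
  side k in the direction where the norm is attained and of side h + 1 in the other yields the
  second vector. By minimality its other coordinate is at least k, which makes the two
  independent.\<close>

lemma short_independent_vectors:
  fixes c \<alpha> \<beta> h K :: int
  assumes c: "c > 0" and K: "0 \<le> K" "K \<le> h" "c < (K + 1) * (h + 1)"
    and no_short: "\<And>x y. (x, y) \<noteq> (0, 0) \<Longrightarrow> \<bar>x\<bar> \<le> K \<Longrightarrow> \<bar>y\<bar> \<le> K \<Longrightarrow> \<not> c dvd \<alpha> * x + \<beta> * y"
  obtains x1 y1 x2 y2 where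
    "c dvd \<alpha> * x1 + \<beta> * y1" "c dvd \<alpha> * x2 + \<beta> * y2"
    "\<bar>x1\<bar> \<le> h" "\<bar>y1\<bar> \<le> h" "\<bar>x2\<bar> \<le> h" "\<bar>y2\<bar> \<le> h" "x1 * y2 \<noteq> x2 * y1"
proof -
  have "(K + 1) * (h + 1) \<le> (h + 1) * (h + 1)" using K by (intro mult_right_mono) auto
  then have hh: "c < (h + 1) * (h + 1)" using K by linarith
  have hpos: "0 < h + 1" using K by simp
  define Q where "Q = (\<lambda>k::nat. \<exists>x y. (x, y) \<noteq> (0, 0) \<and> c dvd \<alpha> * x + \<beta> * y \<and> nat (max \<bar>x\<bar> \<bar>y\<bar>) = k)"
  obtain x0 y0 where w0: "(x0, y0) \<noteq> (0, 0)" "\<bar>x0\<bar> < h + 1" "\<bar>y0\<bar> < h + 1" "c dvd \<alpha> * x0 + \<beta> * y0"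
    by (rule pigeonhole_congruence[OF c hpos hpos hh, of \<alpha> \<beta>])
  define k where "k = (LEAST k. Q k)"
  have Q0: "Q (nat (max \<bar>x0\<bar> \<bar>y0\<bar>))" unfolding Q_def using w0 by blast
  have "Q k" unfolding k_def by (rule LeastI[of Q, OF Q0])
  then obtain x1 y1 where w1: "(x1, y1) \<noteq> (0, 0)" "c dvd \<alpha> * x1 + \<beta> * y1" "nat (max \<bar>x1\<bar> \<bar>y1\<bar>) = k"
    unfolding Q_def by blast
  have kh: "int k \<le> h"
  proof -
    have "k \<le> nat (max \<bar>x0\<bar> \<bar>y0\<bar>)" unfolding k_def by (rule Least_le[of Q, OF Q0])
    then show ?thesis using w0 by auto
  qed
  have kK: "int k > K"
  proof (rule ccontr)
    assume "\<not> int k > K"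
    then have "\<bar>x1\<bar> \<le> K" "\<bar>y1\<bar> \<le> K" using w1(3) by linarith+
    then show False using no_short w1 by blast
  qed
  have minimal: "int k \<le> max \<bar>x\<bar> \<bar>y\<bar>" if "(x, y) \<noteq> (0, 0)" "c dvd \<alpha> * x + \<beta> * y" for x y
  proof -
    have "Q (nat (max \<bar>x\<bar> \<bar>y\<bar>))" unfolding Q_def using that by blast
    then have "k \<le> nat (max \<bar>x\<bar> \<bar>y\<bar>)" unfolding k_def by (rule Least_le)
    then show ?thesis by auto
  qed
  have m1: "max \<bar>x1\<bar> \<bar>y1\<bar> = int k" using w1(3) by auto
  have "(K + 1) * (h + 1) \<le> int k * (h + 1)" using kK K by (intro mult_right_mono) auto
  then have ck: "c < int k * (h + 1)" using K(3) by linarith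
  then have ck': "c < (h + 1) * int k" by (simp only: mult.commute)
  have kpos: "0 < int k" using kK K by simp
  have indep: "u1 * v2 \<noteq> u2 * v1"
    if "\<bar>u1\<bar> = int k" "\<bar>v1\<bar> \<le> int k" "\<bar>u2\<bar> < int k" "max \<bar>u2\<bar> \<bar>v2\<bar> \<ge> int k" for u1 v1 u2 v2 :: int
  proof
    assume "u1 * v2 = u2 * v1"
    then have "int k * \<bar>v2\<bar> = \<bar>u2\<bar> * \<bar>v1\<bar>" using that by (metis abs_mult)
    also have "\<dots> \<le> \<bar>u2\<bar> * int k" using that by (intro mult_left_mono) auto
    finally have "int k * \<bar>v2\<bar> \<le> int k * \<bar>u2\<bar>" by (simp add: mult.commute)
    then have "\<bar>v2\<bar> \<le> \<bar>u2\<bar>" using kK K by simp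
    then show False using that by auto
  qed
  show ?thesis
  proof (cases "\<bar>x1\<bar> = int k")
    case True
    obtain x2 y2 where w2: "(x2, y2) \<noteq> (0, 0)" "\<bar>x2\<bar> < int k" "\<bar>y2\<bar> < h + 1" "c dvd \<alpha> * x2 + \<beta> * y2"
      by (rule pigeonhole_congruence[OF c kpos hpos ck, of \<alpha> \<beta>])
    have "x1 * y2 \<noteq> x2 * y1" using indep[of x1 y1 x2 y2] True m1 w2 minimal[of x2 y2] by auto
    then show ?thesis using that[of x1 y1 x2 y2] w1 w2 m1 kh by auto
  next
    case False
    then have y1: "\<bar>y1\<bar> = int k" using m1 by auto
    obtain x2 y2 where w2: "(x2, y2) \<noteq> (0, 0)" "\<bar>x2\<bar> < h + 1" "\<bar>y2\<bar> < int k" "c dvd \<alpha> * x2 + \<beta> * y2"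
      by (rule pigeonhole_congruence[OF c hpos kpos ck', of \<alpha> \<beta>])
    have "y1 * x2 \<noteq> y2 * x1"
      using indep[of y1 x1 y2 x2] y1 m1 w2 minimal[of x2 y2] by (auto simp: max.commute)
    then show ?thesis using that[of x1 y1 x2 y2] w1 w2 m1 kh by (auto simp: mult.commute)
  qed
qed

text \<open>By Bezout every multiple of the gcd occurs as a residue. The quotient of c by the gcd is
  the index of the lattice of solutions.\<close>

lemma card_linear_residues:
  fixes c \<alpha> \<beta> :: int
  assumes "c > 0"
  shows "c \<le> gcd c (gcd \<alpha> \<beta>) * int (card (range (\<lambda>(x, y). (\<alpha> * x + \<beta> * y) mod c)))"
proof -
  let ?g = "gcd c (gcd \<alpha> \<beta>)" and ?R = "range (\<lambda>(x, y). (\<alpha> * x + \<beta> * y) mod c)"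
  have g: "?g > 0" "?g dvd c" using assms by (auto simp: gcd_pos_int)
  then obtain k where k: "c = ?g * k" by blast
  have kpos: "k > 0" using k g assms by (metis zero_less_mult_pos)
  obtain u v where uv: "u * c + v * gcd \<alpha> \<beta> = ?g" using bezout_int by metis
  obtain u' v' where uv': "u' * \<alpha> + v' * \<beta> = gcd \<alpha> \<beta>" using bezout_int by metis
  have "(\<lambda>i. ?g * i) ` {0..<k} \<subseteq> ?R"
  proof
    fix z assume "z \<in> (\<lambda>i. ?g * i) ` {0..<k}"
    then obtain i where i: "0 \<le> i" "i < k" "z = ?g * i" by auto
    have zc: "0 \<le> z" "z < c" using i g mult_strict_left_mono[OF i(2) g(1)] k by auto
    have "z = (v * (u' * \<alpha> + v' * \<beta>) + u * c) * i" using uv uv' i by (simp add: algebra_simps)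
    also have "\<dots> = \<alpha> * (i * v * u') + \<beta> * (i * v * v') + c * (u * i)" by (simp add: algebra_simps)
    finally have "z = (\<alpha> * (i * v * u') + \<beta> * (i * v * v')) mod c"
      using zc by (metis mod_mult_self2 mod_pos_pos_trivial)
    then show "z \<in> ?R" by (auto simp: image_iff)
  qed
  moreover have "finite ?R"
    by (rule finite_subset[of _ "{0..<c}"]) (use assms in auto)
  ultimately have "card ((\<lambda>i. ?g * i) ` {0..<k}) \<le> card ?R" by (intro card_mono)
  moreover have "card ((\<lambda>i. ?g * i) ` {0..<k}) = nat k"
    using g by (subst card_image) (auto simp: inj_on_def)
  ultimately have "k \<le> int (card ?R)" by linarith
  then have "?g * k \<le> ?g * int (card ?R)" using g by (intro mult_left_mono) auto
  then show ?thesis using k by simp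
qed

text \<open>Translates of the solution set by representatives of all residues are disjoint.\<close>

lemma card_congruence_solutions_le:
  fixes c \<alpha> \<beta> \<gamma> h K A B A' B' :: int
  assumes c: "c > 0" and K: "0 \<le> K" "K \<le> h" "c < (K + 1) * (h + 1)"
    and no_short: "\<And>x y. (x, y) \<noteq> (0, 0) \<Longrightarrow> \<bar>x\<bar> \<le> K \<Longrightarrow> \<bar>y\<bar> \<le> K \<Longrightarrow> \<not> c dvd \<alpha> * x + \<beta> * y"
    and "A \<le> A' + 1" "B \<le> B' + 1"
  shows "int (card {(x, y) \<in> {A..A'} \<times> {B..B'}. c dvd \<alpha> * x + \<beta> * y - \<gamma>}) * c
    \<le> gcd c (gcd \<alpha> \<beta>) * ((A' - A + 1 + 4 * h) * (B' - B + 1 + 4 * h))"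
proof -
  let ?R = "range (\<lambda>(x, y). (\<alpha> * x + \<beta> * y) mod c)"
  let ?N = "{(x, y) \<in> {A..A'} \<times> {B..B'}. c dvd \<alpha> * x + \<beta> * y - \<gamma>}"
  let ?T = "{A - 2 * h..A' + 2 * h} \<times> {B - 2 * h..B' + 2 * h}"
  obtain x1 y1 x2 y2 where w:
    "c dvd \<alpha> * x1 + \<beta> * y1" "c dvd \<alpha> * x2 + \<beta> * y2"
    "\<bar>x1\<bar> \<le> h" "\<bar>y1\<bar> \<le> h" "\<bar>x2\<bar> \<le> h" "\<bar>y2\<bar> \<le> h" "x1 * y2 \<noteq> x2 * y1"
    using short_independent_vectors[OF c K no_short] by blast
  have "\<forall>\<rho>\<in>?R. \<exists>s. \<bar>fst s\<bar> \<le> 2 * h \<and> \<bar>snd s\<bar> \<le> 2 * h \<and> (\<alpha> * fst s + \<beta> * snd s) mod c = \<rho>"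
  proof
    fix \<rho> assume "\<rho> \<in> ?R"
    then obtain x y where "\<rho> = (\<alpha> * x + \<beta> * y) mod c" by auto
    then show "\<exists>s. \<bar>fst s\<bar> \<le> 2 * h \<and> \<bar>snd s\<bar> \<le> 2 * h \<and> (\<alpha> * fst s + \<beta> * snd s) mod c = \<rho>"
      using parallelogram_representative[OF w, of x y] by (metis fst_conv snd_conv)
  qed
  then obtain s where s: "\<And>\<rho>. \<rho> \<in> ?R \<Longrightarrow> \<bar>fst (s \<rho>)\<bar> \<le> 2 * h \<and> \<bar>snd (s \<rho>)\<bar> \<le> 2 * h
      \<and> (\<alpha> * fst (s \<rho>) + \<beta> * snd (s \<rho>)) mod c = \<rho>"
    by metis
  let ?\<tau> = "\<lambda>(p, \<rho>). (fst p + fst (s \<rho>), snd p + snd (s \<rho>))"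
  \<comment> \<open>Modulo c the linear form takes the value \<gamma> + \<rho> at the translated
    point, which recovers \<rho> and then the solution.\<close>
  have "inj_on ?\<tau> (?N \<times> ?R)"
  proof (rule inj_onI)
    fix z z' assume z: "z \<in> ?N \<times> ?R" "z' \<in> ?N \<times> ?R" and eq: "?\<tau> z = ?\<tau> z'"
    obtain x y \<rho> where zd: "z = ((x, y), \<rho>)" by (metis surj_pair)
    obtain x' y' \<rho>' where zd': "z' = ((x', y'), \<rho>')" by (metis surj_pair)
    have N: "c dvd \<alpha> * x + \<beta> * y - \<gamma>" "c dvd \<alpha> * x' + \<beta> * y' - \<gamma>" and R: "\<rho> \<in> ?R" "\<rho>' \<in> ?R"
      using z unfolding zd zd' by blast+
    have eq1: "fst (s \<rho>) - fst (s \<rho>') = x' - x" and eq2: "snd (s \<rho>) - snd (s \<rho>') = y' - y"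
      using eq unfolding zd zd' by auto
    let ?e = "\<alpha> * fst (s \<rho>) + \<beta> * snd (s \<rho>)" and ?e' = "\<alpha> * fst (s \<rho>') + \<beta> * snd (s \<rho>')"
    have "?e - ?e' = \<alpha> * (fst (s \<rho>) - fst (s \<rho>')) + \<beta> * (snd (s \<rho>) - snd (s \<rho>'))"
      by (simp add: algebra_simps)
    also have "\<dots> = (\<alpha> * x' + \<beta> * y' - \<gamma>) - (\<alpha> * x + \<beta> * y - \<gamma>)"
      unfolding eq1 eq2 by (simp add: algebra_simps)
    finally have "c dvd ?e - ?e'" using dvd_diff[OF N(2,1)] by metis
    then have "?e mod c = ?e' mod c" by (simp only: mod_eq_dvd_iff)
    moreover have "?e mod c = \<rho>" "?e' mod c = \<rho>'" using s[OF R(1)] s[OF R(2)] by blast+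
    ultimately have "\<rho> = \<rho>'" by simp
    then show "z = z'" using eq1 eq2 unfolding zd zd' by simp
  qed
  then have "card (?N \<times> ?R) = card (?\<tau> ` (?N \<times> ?R))" by (simp add: card_image)
  also have "\<dots> \<le> card ?T"
  proof (rule card_mono)
    show "?\<tau> ` (?N \<times> ?R) \<subseteq> ?T"
    proof (rule image_subsetI)
      fix z assume "z \<in> ?N \<times> ?R"
      then have z: "fst z \<in> ?N" "snd z \<in> ?R" by (simp_all only: mem_Times_iff)
      have "fst (fst z) \<in> {A..A'}" "snd (fst z) \<in> {B..B'}" using z(1) by auto
      then show "?\<tau> z \<in> ?T" using s[OF z(2)] by (auto simp: case_prod_beta)
    qed
  qed auto
  finally have "card ?N * card ?R \<le> card ?T" by (simp add: card_cartesian_product)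
  then have "int (card ?N) * int (card ?R) \<le> int (card ?T)"
    unfolding of_nat_mult[symmetric] of_nat_le_iff .
  also have "\<dots> = (A' - A + 1 + 4 * h) * (B' - B + 1 + 4 * h)"
    using assms K by (simp add: card_cartesian_product add_ac diff_add_eq)
  finally have 1: "int (card ?N) * int (card ?R) \<le> \<dots>" .
  let ?g = "gcd c (gcd \<alpha> \<beta>)"
  have "int (card ?N) * c \<le> int (card ?N) * (?g * int (card ?R))"
    using card_linear_residues[OF c, of \<alpha> \<beta>] by (intro mult_left_mono) auto
  also have "\<dots> = ?g * (int (card ?N) * int (card ?R))" by simp
  also have "\<dots> \<le> ?g * ((A' - A + 1 + 4 * h) * (B' - B + 1 + 4 * h))"
    using 1 by (intro mult_left_mono) auto
  finally show ?thesis .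
qed

section \<open>Parity classes and a second moment inequality\<close>

text \<open>Distinct points lie in distinct blocks of length e counted from A.\<close>

lemma card_separated_le:
  fixes S :: "int set" and e A B :: int
  assumes S: "S \<subseteq> {A..B}" and e: "e > 0" and AB: "A \<le> B"
    and sep: "\<And>x y. x \<in> S \<Longrightarrow> y \<in> S \<Longrightarrow> x < y \<Longrightarrow> x + e \<le> y"
  shows "int (card S) * e \<le> B - A + e"
proof -
  have "inj_on (\<lambda>x. (x - A) div e) S"
  proof (rule linorder_inj_onI)
    fix x y assume "x < y" "x \<in> S" "y \<in> S"
    then have "(x - A) + e \<le> y - A" using sep by force
    then have "((x - A) + e) div e \<le> (y - A) div e" using e by (intro zdiv_mono1) auto
    then show "(x - A) div e \<noteq> (y - A) div e" using e by simp
  qed auto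
  moreover have "(\<lambda>x. (x - A) div e) ` S \<subseteq> {0..(B - A) div e}"
    using S e by (force intro!: zdiv_mono1 simp: pos_imp_zdiv_nonneg_iff)
  ultimately have "card S \<le> card {0..(B - A) div e}" by (rule card_inj_on_le) auto
  moreover have "(B - A) div e \<ge> 0" using AB e by (simp add: pos_imp_zdiv_nonneg_iff)
  ultimately have "int (card S) \<le> (B - A) div e + 1" by simp
  then have "int (card S) * e \<le> ((B - A) div e + 1) * e" using e by (intro mult_right_mono) auto
  also have "\<dots> = e * ((B - A) div e) + e" by (simp add: algebra_simps)
  also have "e * ((B - A) div e) \<le> B - A" using e by (metis mult.commute pos_mod_sign
        add.commute div_mult_mod_eq le_add_same_cancel1)
  finally show ?thesis by simp
qed

lemma card_progression_multiples_le:
  fixes e l k A B :: int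
  assumes "coprime e k" "e > 0" "A \<le> B"
  shows "int (card {t \<in> {A..B}. e dvd l + k * t}) * e \<le> B - A + e"
proof (rule card_separated_le)
  fix x y assume x: "x \<in> {t \<in> {A..B}. e dvd l + k * t}" and y: "y \<in> {t \<in> {A..B}. e dvd l + k * t}" and "x < y"
  have "e dvd (l + k * y) - (l + k * x)" by (rule dvd_diff) (use x y in auto)
  then have "e dvd k * (y - x)" by (simp add: algebra_simps)
  then have "e dvd y - x" using assms(1) by (simp add: coprime_dvd_mult_right_iff)
  then show "x + e \<le> y" using \<open>x < y\<close> zdvd_imp_le[of e "y - x"] by simp
qed (use assms in auto)

lemma residue_interval_eq:
  fixes e :: int
  assumes "e = 0 \<or> e = 1"
  shows "{t \<in> {1..2 * X}. t mod 2 = e} = (\<lambda>j. 2 * j - e) ` {1..X}"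
proof (intro equalityI subsetI)
  fix t assume t: "t \<in> {t \<in> {1..2 * X}. t mod 2 = e}"
  then have "t = 2 * ((t + e) div 2) - e" "(t + e) div 2 \<in> {1..X}"
    using assms by (auto; presburger)+
  then show "t \<in> (\<lambda>j. 2 * j - e) ` {1..X}" by (rule image_eqI)
next
  fix t assume "t \<in> (\<lambda>j. 2 * j - e) ` {1..X}"
  then show "t \<in> {t \<in> {1..2 * X}. t mod 2 = e}" using assms by (auto; presburger)
qed

lemma card_parity_class:
  fixes e x m :: int
  assumes "e = 0 \<or> e = 1" "m \<ge> 0"
  shows "int (card {t \<in> {x + 1..x + 2 * m}. t mod 2 = e}) = m"
proof -
  define e' where "e' = (e - x) mod 2"
  have e': "e' = 0 \<or> e' = 1" unfolding e'_def by presburger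
  have "{t \<in> {x + 1..x + 2 * m}. t mod 2 = e} = (\<lambda>s. x + s) ` {s \<in> {1..2 * m}. s mod 2 = e'}"
  proof (intro equalityI subsetI)
    fix t assume t: "t \<in> {t \<in> {x + 1..x + 2 * m}. t mod 2 = e}"
    have "(t - x) mod 2 = e'" unfolding e'_def using t by (auto simp: mod_diff_left_eq)
    then show "t \<in> (\<lambda>s. x + s) ` {s \<in> {1..2 * m}. s mod 2 = e'}"
      using t by (intro image_eqI[of _ _ "t - x"]) auto
  next
    fix t assume "t \<in> (\<lambda>s. x + s) ` {s \<in> {1..2 * m}. s mod 2 = e'}"
    then obtain s where s: "t = x + s" "s \<in> {1..2 * m}" "s mod 2 = (e - x) mod 2" by (auto simp: e'_def)
    then have "t mod 2 = e" using assms(1) by presburger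
    then show "t \<in> {t \<in> {x + 1..x + 2 * m}. t mod 2 = e}" using s by auto
  qed
  then have "card {t \<in> {x + 1..x + 2 * m}. t mod 2 = e} = card {s \<in> {1..2 * m}. s mod 2 = e'}"
    by (simp add: card_image)
  also have "\<dots> = card {1..m}"
    unfolding residue_interval_eq[OF e'] by (rule card_image) (auto simp: inj_on_def)
  finally show ?thesis using assms by simp
qed

lemma sum_parity_class_le:
  fixes e X :: int
  assumes "e = 0 \<or> e = 1" "X \<ge> 0"
  shows "(\<Sum>t\<in>{t \<in> {1..2 * X}. t mod 2 = e}. t) \<le> X * (X + 1)"
proof -
  have *: "(\<Sum>j\<in>{1..X}. 2 * j) = X * (X + 1)" if "X \<ge> 0" for X :: int
    using that
  proof (induction X rule: int_ge_induct)
    case (step i)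
    have "{1..i + 1} = insert (i + 1) {1..i}" using step by auto
    then show ?case using step by (simp add: algebra_simps)
  qed auto
  have "(\<Sum>t\<in>{t \<in> {1..2 * X}. t mod 2 = e}. t) = (\<Sum>j\<in>{1..X}. 2 * j - e)"
    unfolding residue_interval_eq[OF assms(1)] by (subst sum.reindex) (auto simp: inj_on_def)
  also have "\<dots> \<le> (\<Sum>j\<in>{1..X}. 2 * j)" using assms by (intro sum_mono) auto
  finally show ?thesis using * assms by simp
qed

text \<open>For t in [2, 2Y] this is the number of x with both x and t - x in [1, Y].\<close>

definition sum_width :: "int \<Rightarrow> int \<Rightarrow> int" where
  "sum_width Y t = min Y (t - 1) - max 1 (t - Y) + 1"

lemma sum_width_bounds: "t \<in> {2..2 * Y} \<Longrightarrow> 0 \<le> sum_width Y t \<and> sum_width Y t \<le> Y"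
  by (auto simp: sum_width_def)

text \<open>Exchange of summation: for each x the t with t - x in [1, Y] fill an interval of even
  length 2m, which has exactly m members of either parity. Y is taken even for this.\<close>

lemma sum_sum_width_parity:
  fixes e Y m :: int
  assumes e: "e = 0 \<or> e = 1" and Y: "Y = 2 * m" "m \<ge> 0"
  shows "(\<Sum>t\<in>{t \<in> {2..2 * Y}. t mod 2 = e}. sum_width Y t) = 2 * m * m"
proof -
  let ?T = "{t \<in> {2..2 * Y}. t mod 2 = e}"
  have "sum_width Y t = (\<Sum>x\<in>{1..Y}. if t - x \<in> {1..Y} then 1 else 0)" if "t \<in> ?T" for t
  proof -
    have "(\<Sum>x\<in>{1..Y}. if t - x \<in> {1..Y} then 1 else 0) = int (card {x \<in> {1..Y}. t - x \<in> {1..Y}})"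
      by (simp add: sum.If_cases Int_def conj_commute)
    also have "{x \<in> {1..Y}. t - x \<in> {1..Y}} = {max 1 (t - Y)..min Y (t - 1)}" by auto
    also have "int (card \<dots>) = sum_width Y t" using that by (auto simp: sum_width_def)
    finally show ?thesis by simp
  qed
  then have "(\<Sum>t\<in>?T. sum_width Y t) = (\<Sum>t\<in>?T. \<Sum>x\<in>{1..Y}. if t - x \<in> {1..Y} then 1 else 0)"
    by (intro sum.cong) auto
  also have "\<dots> = (\<Sum>x\<in>{1..Y}. \<Sum>t\<in>?T. if t - x \<in> {1..Y} then 1 else 0)" by (rule sum.swap)
  also have "\<dots> = (\<Sum>x\<in>{1..Y}. m)"
  proof (rule sum.cong)
    fix x assume x: "x \<in> {1..Y}"
    have "(\<Sum>t\<in>?T. if t - x \<in> {1..Y} then 1 else 0) = int (card {t \<in> ?T. t - x \<in> {1..Y}})"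
      by (simp add: sum.If_cases Int_def conj_commute)
    also have "{t \<in> ?T. t - x \<in> {1..Y}} = {t \<in> {x + 1..x + 2 * m}. t mod 2 = e}"
      using x Y by auto
    also have "int (card \<dots>) = m" by (rule card_parity_class[OF e Y(2)])
    finally show "(\<Sum>t\<in>?T. if t - x \<in> {1..Y} then 1 else 0) = m" .
  qed simp
  also have "\<dots> = 2 * m * m" using Y by simp
  finally show ?thesis .
qed

lemma sum_split_parity:
  fixes f :: "int \<Rightarrow> int"
  assumes "finite A"
  shows "sum f A = sum f {t \<in> A. t mod 2 = 0} + sum f {t \<in> A. t mod 2 = 1}"
proof -
  have "A = {t \<in> A. t mod 2 = 0} \<union> {t \<in> A. t mod 2 = 1}" by auto
  then have "sum f A = sum f ({t \<in> A. t mod 2 = 0} \<union> {t \<in> A. t mod 2 = 1})" by simp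
  also have "\<dots> = sum f {t \<in> A. t mod 2 = 0} + sum f {t \<in> A. t mod 2 = 1}"
    using assms by (intro sum.union_disjoint) auto
  finally show ?thesis .
qed

text \<open>A bound for each parity class, and not just for the whole sum, preserves the factor 1/2
  that a parity condition on the summation variables brings.\<close>

definition parity_bounded :: "int set \<Rightarrow> (int \<Rightarrow> int) \<Rightarrow> int \<Rightarrow> bool" where
  "parity_bounded A W b \<longleftrightarrow> finite A \<and> (\<forall>t\<in>A. 0 \<le> W t) \<and>
     (\<forall>e\<in>{0, 1}. (\<Sum>t\<in>{t \<in> A. t mod 2 = e}. W t) \<le> b)"

lemma parity_bounded_sum:
  assumes "parity_bounded A W b"
  shows "0 \<le> sum W A" "sum W A \<le> 2 * b" "0 \<le> b"
proof -
  show "0 \<le> sum W A" using assms unfolding parity_bounded_def by (auto intro: sum_nonneg)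
  moreover show "sum W A \<le> 2 * b" using assms sum_split_parity[of A W] unfolding parity_bounded_def by auto
  ultimately show "0 \<le> b" by simp
qed

text \<open>For fixed \<open>t2\<close>, \<open>t3\<close> the condition prescribes the parity of
  \<open>t1\<close>, as \<open>l1\<close> is odd. This saves a factor 2 over the trivial bound 8 b1
  b2 b3; without it the second moment bound would be twice too large and only density 1/2 would
  follow.\<close>

lemma sum_even_combination_le_aux:
  fixes l1 l2 l3 :: int
  assumes W1: "parity_bounded A1 W1 b1" and W2: "parity_bounded A2 W2 b2" and W3: "parity_bounded A3 W3 b3"
    and odd: "odd l1"
  shows "(\<Sum>t1\<in>A1. \<Sum>t2\<in>A2. \<Sum>t3\<in>A3.
    if even (l1 * t1 + l2 * t2 + l3 * t3) then W1 t1 * (W2 t2 * W3 t3) else 0) \<le> 4 * (b1 * (b2 * b3))"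
    (is "(\<Sum>t1\<in>A1. \<Sum>t2\<in>A2. \<Sum>t3\<in>A3. ?f t1 t2 t3) \<le> _")
proof -
  have "(\<Sum>t1\<in>A1. \<Sum>t2\<in>A2. \<Sum>t3\<in>A3. ?f t1 t2 t3) = (\<Sum>t2\<in>A2. \<Sum>t1\<in>A1. \<Sum>t3\<in>A3. ?f t1 t2 t3)"
    by (rule sum.swap)
  also have "\<dots> = (\<Sum>t2\<in>A2. \<Sum>t3\<in>A3. \<Sum>t1\<in>A1. ?f t1 t2 t3)"
    by (rule sum.cong[OF refl], rule sum.swap)
  also have "\<dots> \<le> (\<Sum>t2\<in>A2. \<Sum>t3\<in>A3. b1 * (W2 t2 * W3 t3))"
  proof (intro sum_mono)
    fix t2 t3 assume t: "t2 \<in> A2" "t3 \<in> A3"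
    define e where "e = (l2 * t2 + l3 * t3) mod 2"
    have e: "e \<in> {0, 1}" unfolding e_def by auto
    have ev: "even (l1 * t1 + l2 * t2 + l3 * t3) \<longleftrightarrow> t1 mod 2 = e" for t1
    proof -
      have "even (l1 * t1 + l2 * t2 + l3 * t3) \<longleftrightarrow> (even t1 \<longleftrightarrow> even (l2 * t2 + l3 * t3))"
        using odd by (simp add: add.assoc)
      moreover have "(even a \<longleftrightarrow> even b) \<longleftrightarrow> a mod 2 = b mod 2" for a b :: int by presburger
      ultimately show ?thesis unfolding e_def by (simp only:)
    qed
    have "(\<Sum>t1\<in>A1. ?f t1 t2 t3) = (\<Sum>t1\<in>{t \<in> A1. t mod 2 = e}. W1 t1 * (W2 t2 * W3 t3))"
      unfolding ev using W1 by (simp add: sum.inter_filter parity_bounded_def)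
    also have "\<dots> = (\<Sum>t1\<in>{t \<in> A1. t mod 2 = e}. W1 t1) * (W2 t2 * W3 t3)" by (simp add: sum_distrib_right)
    also have "\<dots> \<le> b1 * (W2 t2 * W3 t3)"
      using W1 W2 W3 e t unfolding parity_bounded_def by (intro mult_right_mono mult_nonneg_nonneg) blast+
    finally show "(\<Sum>t1\<in>A1. ?f t1 t2 t3) \<le> b1 * (W2 t2 * W3 t3)" .
  qed
  also have "\<dots> = b1 * (sum W2 A2 * sum W3 A3)"
    by (simp only: sum_product sum_distrib_left[symmetric])
  also have "\<dots> \<le> b1 * ((2 * b2) * (2 * b3))"
    using parity_bounded_sum[OF W1] parity_bounded_sum[OF W2] parity_bounded_sum[OF W3]
    by (intro mult_left_mono mult_mono) auto
  finally show ?thesis by (simp add: algebra_simps)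
qed

lemma sum_even_combination_le:
  fixes l1 l2 l3 :: int
  assumes W1: "parity_bounded A1 W1 b1" and W2: "parity_bounded A2 W2 b2" and W3: "parity_bounded A3 W3 b3"
    and odd: "odd l1 \<or> odd l2 \<or> odd l3"
  shows "(\<Sum>t1\<in>A1. \<Sum>t2\<in>A2. \<Sum>t3\<in>A3.
    if even (l1 * t1 + l2 * t2 + l3 * t3) then W1 t1 * (W2 t2 * W3 t3) else 0) \<le> 4 * (b1 * (b2 * b3))"
    (is "?S \<le> _")
proof -
  consider "odd l1" | "odd l2" | "odd l3" using odd by blast
  then show ?thesis
  proof cases
    case 1
    then show ?thesis by (rule sum_even_combination_le_aux[OF W1 W2 W3])
  next
    case 2
    have "?S = (\<Sum>t2\<in>A2. \<Sum>t1\<in>A1. \<Sum>t3\<in>A3.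
      if even (l2 * t2 + l1 * t1 + l3 * t3) then W2 t2 * (W1 t1 * W3 t3) else 0)"
      by (subst sum.swap, simp only: mult_ac add_ac)
    also have "\<dots> \<le> 4 * (b2 * (b1 * b3))" by (rule sum_even_combination_le_aux[OF W2 W1 W3 2])
    finally show ?thesis by (simp add: mult_ac)
  next
    case 3
    have "?S = (\<Sum>t1\<in>A1. \<Sum>t3\<in>A3. \<Sum>t2\<in>A2.
      if even (l1 * t1 + l2 * t2 + l3 * t3) then W1 t1 * (W2 t2 * W3 t3) else 0)"
      by (rule sum.cong[OF refl], rule sum.swap)
    also have "\<dots> = (\<Sum>t3\<in>A3. \<Sum>t1\<in>A1. \<Sum>t2\<in>A2.
      if even (l3 * t3 + l1 * t1 + l2 * t2) then W3 t3 * (W1 t1 * W2 t2) else 0)"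
      by (subst sum.swap, simp only: mult_ac add_ac)
    also have "\<dots> \<le> 4 * (b3 * (b1 * b2))" by (rule sum_even_combination_le_aux[OF W3 W1 W2 3])
    finally show ?thesis by (simp add: mult_ac)
  qed
qed

text \<open>Cauchy-Schwarz for the weighted representation numbers \<open>r k\<close>: the sum of
  their squares is the sum over pairs with equal value.\<close>

lemma weighted_second_moment:
  fixes g :: "'a \<Rightarrow> 'b" and \<phi> :: "'a \<Rightarrow> real"
  assumes "finite B"
  shows "(sum \<phi> B)^2 \<le> real (card (g ` B)) * (\<Sum>(u, v)\<in>{(u, v) \<in> B \<times> B. g u = g v}. \<phi> u * \<phi> v)"
proof -
  define r where "r = (\<lambda>k. \<Sum>u\<in>{u \<in> B. g u = k}. \<phi> u)"
  have "sum \<phi> B = (\<Sum>k\<in>g ` B. r k)"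
    unfolding r_def using assms by (rule sum.image_gen)
  then have "(sum \<phi> B)^2 = (\<Sum>k\<in>g ` B. r k)^2" by simp
  also have "\<dots> \<le> real (card (g ` B)) * (\<Sum>k\<in>g ` B. (r k)^2)"
    using sum_squared_le_sum_of_squares[where f = r and I = "g ` B"] assms by (cases "B = {}") (auto simp: mult.commute)
  also have "(\<Sum>k\<in>g ` B. (r k)^2) = (\<Sum>u\<in>B. \<Sum>v\<in>{v \<in> B. g v = g u}. \<phi> u * \<phi> v)"
  proof -
    have "(r k)^2 = (\<Sum>u\<in>{u \<in> B. g u = k}. \<phi> u * r (g u))" for k
    proof -
      have "(r k)^2 = (\<Sum>u\<in>{u \<in> B. g u = k}. \<phi> u) * r k" by (simp add: power2_eq_square r_def)
      also have "\<dots> = (\<Sum>u\<in>{u \<in> B. g u = k}. \<phi> u * r k)" by (rule sum_distrib_right)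
      also have "\<dots> = (\<Sum>u\<in>{u \<in> B. g u = k}. \<phi> u * r (g u))" by (intro sum.cong) auto
      finally show ?thesis .
    qed
    then have "(\<Sum>k\<in>g ` B. (r k)^2) = (\<Sum>k\<in>g ` B. \<Sum>u\<in>{u \<in> B. g u = k}. \<phi> u * r (g u))" by simp
    also have "\<dots> = (\<Sum>u\<in>B. \<phi> u * r (g u))" using assms by (rule sum.image_gen[symmetric])
    finally show ?thesis by (simp add: r_def sum_distrib_left)
  qed
  also have "\<dots> = (\<Sum>(u, v)\<in>(SIGMA u:B. {v \<in> B. g v = g u}). \<phi> u * \<phi> v)"
    using assms by (intro sum.Sigma) auto
  also have "(SIGMA u:B. {v \<in> B. g v = g u}) = {(u, v) \<in> B \<times> B. g u = g v}" by auto
  finally show ?thesis .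
qed

section \<open>The second moment of the representation numbers\<close>

lemma coprime_by_primes:
  fixes a b :: int
  assumes "a \<noteq> 0 \<or> b \<noteq> 0" "\<And>p. prime p \<Longrightarrow> p dvd a \<Longrightarrow> p dvd b \<Longrightarrow> False"
  shows "coprime a b"
proof (rule ccontr)
  assume "\<not> coprime a b"
  then have "\<not> is_unit (gcd a b)" by (simp add: coprime_iff_gcd_eq_1)
  moreover have "gcd a b \<noteq> 0" using assms(1) by auto
  ultimately obtain p where "p dvd gcd a b" "prime p" using prime_divisor_exists by blast
  then show False using assms(2)[of p] by simp
qed

lemma sum_inverse_squares_le:
  fixes P n :: nat
  assumes "P \<ge> 1"
  shows "(\<Sum>e\<in>{P<..n}. 1 / real e ^ 2) \<le> 1 / real P"
proof -
  have *: "(\<Sum>e\<in>{P<..n}. 1 / real e ^ 2) \<le> 1 / real P - 1 / real n" if "n \<ge> P" for n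
    using that
  proof (induction n rule: dec_induct)
    case (step n)
    have n: "real n > 0" using step assms by simp
    have "{P<..Suc n} = insert (Suc n) {P<..n}" using step by auto
    then have "(\<Sum>e\<in>{P<..Suc n}. 1 / real e ^ 2) = 1 / real (Suc n) ^ 2 + (\<Sum>e\<in>{P<..n}. 1 / real e ^ 2)" by simp
    also have "\<dots> \<le> 1 / real (Suc n) ^ 2 + (1 / real P - 1 / real n)" using step by simp
    also have "1 / real (Suc n) ^ 2 \<le> 1 / (real n * real (Suc n))"
      using n by (intro divide_left_mono) (auto simp: power2_eq_square)
    also have "1 / (real n * real (Suc n)) = 1 / real n - 1 / real (Suc n)"
      using n by (simp add: field_simps)
    finally show ?case by simp
  qed simp
  show ?thesis
  proof (cases "n \<ge> P")
    case True
    then show ?thesis using *[OF True] by (smt (verit) divide_nonneg_nonneg of_nat_0_le_iff)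
  qed simp
qed

lemma card_Sigma_filter:
  "finite A \<Longrightarrow> finite B \<Longrightarrow> card (Sigma A (\<lambda>x. {y \<in> B. Q x y})) = (\<Sum>x\<in>A. card {y \<in> B. Q x y})"
  by (rule card_SigmaI) auto

text \<open>The three prime conditions serve common divisors of the coefficients \<open>c1\<close>,
  \<open>c2\<close>, \<open>c3\<close> below: \<open>no_common\<close> and
  \<open>coeff_primes\<close> make such a divisor prime to q and to all a_i, and
  \<open>small_primes\<close> then forces it above P unless it is 1.\<close>

locale quadratic_progression =
  fixes l1 l2 l3 a1 a2 a3 q :: int and P :: nat
  assumes q_pos: "q > 0" and a1_pos: "a1 > 0" and a2_nz: "a2 \<noteq> 0" and a3_nz: "a3 \<noteq> 0" and P2: "P \<ge> 2"
    and no_common: "\<And>p. prime p \<Longrightarrow> p dvd q \<Longrightarrow> p dvd l1 \<Longrightarrow> p dvd l2 \<Longrightarrow> p dvd l3 \<Longrightarrow> False"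
    and small_primes: "\<And>p :: int. prime p \<Longrightarrow> p \<le> int P \<Longrightarrow> p dvd q"
    and coeff_primes: "\<And>p :: int. prime p \<Longrightarrow> p dvd a1 * a2 * a3 \<Longrightarrow> p dvd q"
begin

definition F :: "int \<times> int \<times> int \<Rightarrow> int" where
  "F = (\<lambda>(u1, u2, u3). l1 * u1 + l2 * u2 + l3 * u3 + q * (a1 * u1^2 + a2 * u2^2 + a3 * u3^2))"

text \<open>Once u + v is fixed, F u - F v is linear in u - v, and these are its coefficients (see
  \<open>F_diff\<close>).\<close>

definition c1 :: "int \<Rightarrow> int" where "c1 t = l1 + q * a1 * t"
definition c2 :: "int \<Rightarrow> int" where "c2 t = l2 + q * a2 * t"
definition c3 :: "int \<Rightarrow> int" where "c3 t = l3 + q * a3 * t"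

lemma F_diff:
  "F (u1, u2, u3) - F (v1, v2, v3)
    = (u1 - v1) * c1 (u1 + v1) + (u2 - v2) * c2 (u2 + v2) + (u3 - v3) * c3 (u3 + v3)"
  by (simp add: F_def c1_def c2_def c3_def algebra_simps power2_eq_square)

lemma q_even: "even q" using small_primes[of 2] P2 by simp

lemma some_odd: "odd l1 \<or> odd l2 \<or> odd l3" using no_common[of 2] q_even by auto

text \<open>A prime dividing e and q would divide every l_i, and a prime dividing some a_i divides
  q. Consequently each of the conditions on t_i confines it to a single class modulo e.\<close>

lemma common_divisor_coprime:
  assumes "e > 0" "e dvd c1 t1" "e dvd c2 t2" "e dvd c3 t3"
  shows "coprime e q" "coprime e (q * a1)" "coprime e (q * a2)" "coprime e (q * a3)"
proof -
  have nq: False if p: "prime p" "p dvd e" "p dvd q" for p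
  proof -
    have "p dvd l1" using dvd_trans[OF p(2) assms(2)] p(3) unfolding c1_def
      by (simp add: dvd_add_left_iff)
    moreover have "p dvd l2" using dvd_trans[OF p(2) assms(3)] p(3) unfolding c2_def
      by (simp add: dvd_add_left_iff)
    moreover have "p dvd l3" using dvd_trans[OF p(2) assms(4)] p(3) unfolding c3_def
      by (simp add: dvd_add_left_iff)
    ultimately show False using no_common p by blast
  qed
  show "coprime e q" using nq assms(1) by (intro coprime_by_primes) auto
  have *: "coprime e (q * a)" if "a dvd a1 * a2 * a3" for a
  proof (rule coprime_by_primes)
    fix p assume p: "prime p" "p dvd e" "p dvd q * a"
    then have "p dvd q \<or> p dvd a" by (simp add: prime_dvd_mult_iff)
    then have "p dvd q" using coeff_primes[OF p(1)] dvd_trans[OF _ that] by blast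
    then show False using nq p by blast
  qed (use assms(1) in auto)
  show "coprime e (q * a1)" "coprime e (q * a2)" "coprime e (q * a3)" by (rule *; simp)+
qed

lemma common_divisor_large:
  assumes "e > 1" "e dvd c1 t1" "e dvd c2 t2" "e dvd c3 t3"
  shows "e > int P"
proof (rule ccontr)
  assume "\<not> e > int P"
  obtain p where p: "prime p" "p dvd e" using prime_divisor_exists[of e] assms(1) by auto
  then have "p \<le> e" using assms(1) by (intro zdvd_imp_le) auto
  then have "p dvd q" using small_primes[OF p(1)] \<open>\<not> e > int P\<close> by simp
  moreover have "coprime e q" using common_divisor_coprime assms by simp
  ultimately show False using p by (meson coprime_common_divisor not_prime_unit)
qed

end

text \<open>
  Representations are counted over \<open>u \<in> (X0, X] \<times> [1, Y]\<^sup>2\<close>. The weight of \<open>u\<close> is the increment of the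
  one-variable polynomial \<open>l\<^sub>1 u\<^sub>1 + q a\<^sub>1 u\<^sub>1\<^sup>2\<close>, which makes the expected weighted count constant.
  For fixed \<open>t = u + u'\<close>, \<open>Nset t\<close> collects \<open>(u'\<^sub>2, u'\<^sub>3)\<close>, from which \<open>u'\<^sub>1\<close> is recovered. Exceptional \<open>t\<close>
  (\<open>exc\<close>) are those whose lattice has a vector of size at most \<open>K\<close>; they are few, and all but
  \<open>O(X)\<close> of them (\<open>deg\<close>) admit at most \<open>Y (Y/T + 1)\<close> points.
\<close>

locale second_moment = quadratic_progression +
  fixes X0 X Y m h K T J C :: int
  assumes X0: "0 \<le> X0" "X0 < X" and Y: "Y = 2 * m" "m > 0" "Y \<le> X"
    and qY: "q * a1 \<le> Y"
    and c1_lower: "Y \<le> c1 (2 * X0)" and c1_upper: "c1 (2 * X) \<le> C"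
    and J: "0 \<le> J" "\<And>t. t \<in> {2..2 * Y} \<Longrightarrow> \<bar>c2 t\<bar> \<le> J * Y" "\<And>t. t \<in> {2..2 * Y} \<Longrightarrow> \<bar>c3 t\<bar> \<le> J * Y"
    and K: "0 \<le> K" "K \<le> h" "C < (K + 1) * (h + 1)" and h: "4 * h \<le> Y" and T: "T > 0"
begin

section \<open>Pairs with equal value, fibred over the sum of the two vectors\<close>

definition T1 :: "int set" where "T1 = {2 * X0 + 2..2 * X}"
definition T2 :: "int set" where "T2 = {2..2 * Y}"
definition Box :: "(int \<times> int \<times> int) set" where "Box = {X0 + 1..X} \<times> {1..Y} \<times> {1..Y}"
definition Tset :: "(int \<times> int \<times> int) set" where "Tset = T1 \<times> T2 \<times> T2"

definition lo :: "int \<Rightarrow> int" where "lo t = max 1 (t - Y)"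
definition hi :: "int \<Rightarrow> int" where "hi t = min Y (t - 1)"

text \<open>If F u = F v and t = u + v, then the sum of c_i (u_i - v_i) vanishes, so the sum of c_i
  t_i is twice the sum of c_i v_i. Thus \<open>half t\<close> is the latter sum, and reducing it
  modulo c_1 gives the congruence in \<open>Nset\<close>.\<close>

definition half :: "int \<times> int \<times> int \<Rightarrow> int" where
  "half = (\<lambda>(t1, t2, t3). (c1 t1 * t1 + c2 t2 * t2 + c3 t3 * t3) div 2)"

definition Nset :: "int \<times> int \<times> int \<Rightarrow> (int \<times> int) set" where
  "Nset = (\<lambda>(t1, t2, t3). {(x, y) \<in> {lo t2..hi t2} \<times> {lo t3..hi t3}.
     c1 t1 dvd c2 t2 * x + c3 t3 * y - half (t1, t2, t3)})"

text \<open>The sum of c_i t_i must be even for \<open>half\<close> to be an exact half; since q is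
  even, this concerns the l_i only.\<close>

definition evenT :: "int \<times> int \<times> int \<Rightarrow> bool" where
  "evenT = (\<lambda>(t1, t2, t3). even (l1 * t1 + l2 * t2 + l3 * t3))"

definition weight :: "int \<times> int \<times> int \<Rightarrow> int" where
  "weight = (\<lambda>(u1, _, _). l1 + q * a1 * (2 * u1 - 1))"

lemma qa1_pos: "q * a1 > 0" using q_pos a1_pos by simp

lemma c1_bounds:
  assumes "t \<in> T1"
  shows "Y \<le> c1 t" "c1 t \<le> C" "0 < c1 t" "q * a1 \<le> c1 t"
proof -
  have "q * a1 * (2 * X0) \<le> q * a1 * t" "q * a1 * t \<le> q * a1 * (2 * X)"
    using assms qa1_pos unfolding T1_def by (auto intro!: mult_left_mono)
  then show "Y \<le> c1 t" "c1 t \<le> C" using c1_lower c1_upper unfolding c1_def by auto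
  then show "0 < c1 t" "q * a1 \<le> c1 t" using Y qY by auto
qed

lemma C_ge: "Y \<le> C" "C > 0" using c1_bounds(1,2)[of "2 * X"] X0 Y unfolding T1_def by auto

lemma finite_sets [simp]: "finite T1" "finite T2" "finite Box" "finite Tset" "finite (Nset t)"
proof -
  show "finite (Nset t)" unfolding Nset_def
    by (cases t) (auto intro: finite_subset[of _ "{lo (fst (snd t))..hi (fst (snd t))} \<times> {lo (snd (snd t))..hi (snd (snd t))}"])
qed (auto simp: T1_def T2_def Box_def Tset_def)

lemma lo_hi: "t \<in> T2 \<Longrightarrow> lo t \<le> hi t \<and> hi t - lo t + 1 = sum_width Y t \<and> hi t - lo t + 1 \<le> Y"
  unfolding T2_def lo_def hi_def sum_width_def using Y by auto

text \<open>A pair (u, v) is recovered from t = u + v and (v_2, v_3), because F u = F v determines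
  u_1 - v_1 when c_1 is positive. The mean of the two weights is c_1 - q a_1, so their product is at
  most c_1^2.\<close>

lemma pair_sum_le:
  "(\<Sum>(u, v)\<in>{(u, v) \<in> Box \<times> Box. F u = F v}. real_of_int (weight u) * real_of_int (weight v))
    \<le> (\<Sum>t\<in>{t \<in> Tset. evenT t}. (real_of_int (c1 (fst t)))^2 * real (card (Nset t)))"
proof -
  let ?Pairs = "{(u, v) \<in> Box \<times> Box. F u = F v}"
  let ?\<pi> = "\<lambda>((u1, u2, u3), (v1, v2, v3)). ((u1 + v1, u2 + v2, u3 + v3), (v2, v3)) :: (int \<times> int \<times> int) \<times> (int \<times> int)"
  let ?\<omega> = "\<lambda>(t, z :: int \<times> int). (real_of_int (c1 (fst t)))^2"
  have finP: "finite ?Pairs" by (rule finite_subset[of _ "Box \<times> Box"]) auto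
  have inj: "inj_on ?\<pi> ?Pairs"
  proof (rule inj_onI)
    fix p p' assume p: "p \<in> ?Pairs" and p': "p' \<in> ?Pairs" and eq: "?\<pi> p = ?\<pi> p'"
    obtain u1 u2 u3 v1 v2 v3 where pd: "p = ((u1, u2, u3), (v1, v2, v3))" by (metis surj_pair)
    obtain u1' u2' u3' v1' v2' v3' where pd': "p' = ((u1', u2', u3'), (v1', v2', v3'))" by (metis surj_pair)
    have e: "u1 + v1 = u1' + v1'" "v2 = v2'" "v3 = v3'" "u2 = u2'" "u3 = u3'" using eq unfolding pd pd' by auto
    have t1: "u1 + v1 \<in> T1" using p unfolding pd Box_def T1_def by auto
    have "F (u1, u2, u3) - F (v1, v2, v3) = 0" "F (u1', u2', u3') - F (v1', v2', v3') = 0"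
      using p p' unfolding pd pd' by auto
    then have "(u1 - v1) * c1 (u1 + v1) = (u1' - v1') * c1 (u1 + v1)"
      unfolding F_diff e by linarith
    then have "u1 - v1 = u1' - v1'" using c1_bounds(3)[OF t1] by simp
    then show "p = p'" using e unfolding pd pd' by simp
  qed
  have sub: "?\<pi> ` ?Pairs \<subseteq> Sigma {t \<in> Tset. evenT t} Nset"
  proof (rule image_subsetI)
    fix p assume p: "p \<in> ?Pairs"
    obtain u1 u2 u3 v1 v2 v3 where pd: "p = ((u1, u2, u3), (v1, v2, v3))" by (metis surj_pair)
    let ?t1 = "u1 + v1" and ?t2 = "u2 + v2" and ?t3 = "u3 + v3"
    have r: "u1 \<in> {X0 + 1..X}" "v1 \<in> {X0 + 1..X}" "u2 \<in> {1..Y}" "v2 \<in> {1..Y}" "u3 \<in> {1..Y}" "v3 \<in> {1..Y}"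
      using p unfolding pd Box_def by auto
    have "F (u1, u2, u3) - F (v1, v2, v3) = 0" using p unfolding pd by auto
    then have 0: "(u1 - v1) * c1 ?t1 + (u2 - v2) * c2 ?t2 + (u3 - v3) * c3 ?t3 = 0" unfolding F_diff .
    have G: "c1 ?t1 * ?t1 + c2 ?t2 * ?t2 + c3 ?t3 * ?t3 = 2 * (c1 ?t1 * v1 + c2 ?t2 * v2 + c3 ?t3 * v3)"
      using 0 by (simp add: algebra_simps)
    have "c1 ?t1 * ?t1 + c2 ?t2 * ?t2 + c3 ?t3 * ?t3
      = (l1 * ?t1 + l2 * ?t2 + l3 * ?t3) + q * (a1 * ?t1^2 + a2 * ?t2^2 + a3 * ?t3^2)"
      by (simp add: c1_def c2_def c3_def algebra_simps power2_eq_square)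
    then have ev: "evenT (?t1, ?t2, ?t3)" unfolding evenT_def prod.case using G q_even
      by (metis dvd_triv_left dvd_add_left_iff dvd_mult2)
    have "half (?t1, ?t2, ?t3) = c1 ?t1 * v1 + c2 ?t2 * v2 + c3 ?t3 * v3"
      unfolding half_def prod.case G by simp
    then have "c2 ?t2 * v2 + c3 ?t3 * v3 - half (?t1, ?t2, ?t3) = c1 ?t1 * (- v1)" by simp
    then have "c1 ?t1 dvd c2 ?t2 * v2 + c3 ?t3 * v3 - half (?t1, ?t2, ?t3)" by (metis dvd_triv_left)
    then have "(v2, v3) \<in> Nset (?t1, ?t2, ?t3)" unfolding Nset_def lo_def hi_def using r by auto
    then show "?\<pi> p \<in> Sigma {t \<in> Tset. evenT t} Nset"
      unfolding pd Tset_def T1_def T2_def using ev r by auto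
  qed
  have "(\<Sum>(u, v)\<in>?Pairs. real_of_int (weight u) * real_of_int (weight v)) \<le> (\<Sum>p\<in>?Pairs. ?\<omega> (?\<pi> p))"
  proof (rule sum_mono)
    fix p assume p: "p \<in> ?Pairs"
    obtain u1 u2 u3 v1 v2 v3 where pd: "p = ((u1, u2, u3), (v1, v2, v3))" by (metis surj_pair)
    let ?a = "real_of_int (l1 + q * a1 * (2 * u1 - 1))" and ?b = "real_of_int (l1 + q * a1 * (2 * v1 - 1))"
    let ?c = "real_of_int (c1 (u1 + v1))"
    have "u1 + v1 \<in> T1" using p unfolding pd Box_def T1_def by auto
    note cb = c1_bounds[OF this]
    have ab: "?a + ?b = 2 * (?c - q * a1)" by (simp add: c1_def algebra_simps)
    have "4 * (?a * ?b) \<le> (?a + ?b)^2" using sum_squares_ge_zero[of "?a - ?b" 0]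
      by (simp add: power2_eq_square algebra_simps)
    also have "\<dots> = 4 * (?c - q * a1)^2" unfolding ab power_mult_distrib by simp
    also have "(?c - q * a1)^2 \<le> ?c^2"
    proof (rule power_mono)
      show "?c - q * a1 \<le> ?c" using qa1_pos by (simp flip: of_int_mult)
      have "real_of_int (q * a1) \<le> ?c" using cb(4) by (simp only: of_int_le_iff)
      then show "0 \<le> ?c - q * a1" by simp
    qed
    finally have "?a * ?b \<le> ?c^2" by simp
    then show "(case p of (u, v) \<Rightarrow> real_of_int (weight u) * real_of_int (weight v)) \<le> ?\<omega> (?\<pi> p)"
      unfolding pd weight_def by simp
  qed
  also have "\<dots> = (\<Sum>z\<in>?\<pi> ` ?Pairs. ?\<omega> z)" using inj by (simp add: sum.reindex)
  also have "\<dots> \<le> (\<Sum>z\<in>Sigma {t \<in> Tset. evenT t} Nset. ?\<omega> z)"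
    using sub by (intro sum_mono2) auto
  also have "\<dots> = (\<Sum>t\<in>{t \<in> Tset. evenT t}. \<Sum>z\<in>Nset t. (real_of_int (c1 (fst t)))^2)"
    by (rule sum.Sigma[symmetric]) auto
  also have "\<dots> = (\<Sum>t\<in>{t \<in> Tset. evenT t}. (real_of_int (c1 (fst t)))^2 * real (card (Nset t)))"
    by (simp add: mult.commute)
  finally show ?thesis .
qed

definition exc :: "int \<times> int \<times> int \<Rightarrow> bool" where
  "exc = (\<lambda>(t1, t2, t3). \<exists>x y. (x, y) \<noteq> (0, 0) \<and> \<bar>x\<bar> \<le> K \<and> \<bar>y\<bar> \<le> K \<and> c1 t1 dvd c2 t2 * x + c3 t3 * y)"

definition deg :: "int \<times> int \<times> int \<Rightarrow> bool" where
  "deg = (\<lambda>(t1, t2, t3). (\<exists>i\<in>{1..<T}. c1 t1 dvd c2 t2 * i) \<and> (\<exists>i\<in>{1..<T}. c1 t1 dvd c3 t3 * i))"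

text \<open>Area of the rectangle of \<open>Nset\<close>, enlarged by the margins that
  \<open>card_congruence_solutions_le\<close> costs.\<close>

definition V :: "int \<times> int \<times> int \<Rightarrow> int" where
  "V = (\<lambda>(t1, t2, t3). (sum_width Y t2 + 4 * h) * (sum_width Y t3 + 4 * h))"

definition g :: "int \<times> int \<times> int \<Rightarrow> int" where
  "g = (\<lambda>(t1, t2, t3). gcd (c1 t1) (gcd (c2 t2) (c3 t3)))"

lemma card_Nset_good:
  assumes t: "t \<in> Tset" and "\<not> exc t"
  shows "int (card (Nset t)) * c1 (fst t) \<le> g t * V t"
proof -
  obtain t1 t2 t3 where td: "t = (t1, t2, t3)" by (metis surj_pair)
  have tt: "t1 \<in> T1" "t2 \<in> T2" "t3 \<in> T2" using t unfolding td Tset_def by auto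
  have "int (card (Nset t)) * c1 t1
    \<le> gcd (c1 t1) (gcd (c2 t2) (c3 t3)) * ((hi t2 - lo t2 + 1 + 4 * h) * (hi t3 - lo t3 + 1 + 4 * h))"
    unfolding td Nset_def prod.case
  proof (rule card_congruence_solutions_le)
    show "0 < c1 t1" using c1_bounds tt by simp
    show "0 \<le> K" "K \<le> h" using K by auto
    show "c1 t1 < (K + 1) * (h + 1)" using K c1_bounds[OF tt(1)] by simp
    show "\<not> c1 t1 dvd c2 t2 * x + c3 t3 * y" if "(x, y) \<noteq> (0, 0)" "\<bar>x\<bar> \<le> K" "\<bar>y\<bar> \<le> K" for x y
      using that assms(2) unfolding exc_def td by auto
  qed (use lo_hi tt in force)+
  then show ?thesis unfolding td g_def V_def using lo_hi tt by simp
qed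

lemma card_Nset_trivial: assumes "t \<in> Tset" shows "real (card (Nset t)) \<le> real_of_int (Y * Y)"
proof -
  obtain t1 t2 t3 where td: "t = (t1, t2, t3)" by (metis surj_pair)
  have tt: "t2 \<in> T2" "t3 \<in> T2" using assms unfolding td Tset_def by auto
  have "card (Nset t) \<le> card ({1..Y} \<times> {1..Y})"
    unfolding td Nset_def lo_def hi_def by (rule card_mono) auto
  then have "int (card (Nset t)) \<le> int (card ({1..Y} \<times> {1..Y}))" by (simp only: of_nat_le_iff)
  also have "\<dots> = Y * Y" using Y by (simp add: card_cartesian_product)
  finally have "int (card (Nset t)) \<le> Y * Y" .
  then have "real_of_int (int (card (Nset t))) \<le> real_of_int (Y * Y)" by (simp only: of_int_le_iff)
  then show ?thesis by simp
qed

text \<open>Two solutions in one column differ by some i with c dividing b i, hence by at least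
  T.\<close>

lemma card_column_le:
  assumes "\<not> (\<exists>i\<in>{1..<T}. c dvd b * i)" "A \<le> A' + 1" "A' - A + 1 \<le> Y"
  shows "int (card {y \<in> {A..A'}. c dvd b * y - r}) * T \<le> Y + T"
proof (cases "A \<le> A'")
  case True
  have "int (card {y \<in> {A..A'}. c dvd b * y - r}) * T \<le> A' - A + T"
  proof (rule card_separated_le)
    fix x y assume "x \<in> {y \<in> {A..A'}. c dvd b * y - r}" "y \<in> {y \<in> {A..A'}. c dvd b * y - r}" "x < y"
    then have "c dvd (b * y - r) - (b * x - r)" "x < y" by (blast intro: dvd_diff)+
    then have "c dvd b * (y - x)" by (simp add: algebra_simps)
    then have "\<not> y - x \<in> {1..<T}" using assms(1) by blast
    then show "x + T \<le> y" using \<open>x < y\<close> by auto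
  qed (use T True in auto)
  then show ?thesis using assms by simp
next
  case False
  then have "{y \<in> {A..A'}. c dvd b * y - r} = {}" by auto
  then show ?thesis using Y T by (simp only: card.empty)
qed

lemma card_rectangle_le:
  assumes "\<not> (\<exists>i\<in>{1..<T}. c dvd b * i)" "t \<in> T2" "t' \<in> T2"
  shows "int (card {(x, y) \<in> {lo t..hi t} \<times> {lo t'..hi t'}. c dvd a * x + b * y - r}) * T \<le> Y * (Y + T)"
proof -
  have "{(x, y) \<in> {lo t..hi t} \<times> {lo t'..hi t'}. c dvd a * x + b * y - r}
    = Sigma {lo t..hi t} (\<lambda>x. {y \<in> {lo t'..hi t'}. c dvd b * y - (r - a * x)})" (is "?N = _")
    by (auto simp: algebra_simps)
  then have "int (card ?N) * T = (\<Sum>x\<in>{lo t..hi t}. int (card {y \<in> {lo t'..hi t'}. c dvd b * y - (r - a * x)}) * T)"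
    by (simp only: card_Sigma_filter finite_atLeastAtMost_int of_nat_sum sum_distrib_right)
  also have "\<dots> \<le> (\<Sum>x\<in>{lo t..hi t}. Y + T)"
    using lo_hi[OF assms(3)] by (intro sum_mono card_column_le assms(1)) auto
  also have "\<dots> = int (card {lo t..hi t}) * (Y + T)" by simp
  also have "\<dots> \<le> Y * (Y + T)" using lo_hi[OF assms(2)] Y T by (intro mult_right_mono) auto
  finally show ?thesis .
qed

text \<open>In one of the two directions no multiple below T is killed modulo c_1. Solutions are
  counted in lines along that direction, after a swap of the coordinates if it is the first
  one.\<close>

lemma card_Nset_nondeg:
  assumes t: "t \<in> Tset" and nd: "\<not> deg t"
  shows "real (card (Nset t)) \<le> real_of_int (Y * (Y + T)) / real_of_int T"
proof -
  obtain t1 t2 t3 where td: "t = (t1, t2, t3)" by (metis surj_pair)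
  have tt: "t2 \<in> T2" "t3 \<in> T2" using t unfolding td Tset_def by auto
  have "int (card (Nset t)) * T \<le> Y * (Y + T)"
  proof (cases "\<exists>i\<in>{1..<T}. c1 t1 dvd c3 t3 * i")
    case False
    then show ?thesis unfolding td Nset_def prod.case by (rule card_rectangle_le[OF _ tt])
  next
    case True
    then have nd2: "\<not> (\<exists>i\<in>{1..<T}. c1 t1 dvd c2 t2 * i)" using nd unfolding deg_def td by auto
    have eq: "Nset t = prod.swap ` {(y, x) \<in> {lo t3..hi t3} \<times> {lo t2..hi t2}. c1 t1 dvd c3 t3 * y + c2 t2 * x - half t}"
      unfolding td Nset_def by (force simp: add.commute image_iff)
    show ?thesis
      using card_rectangle_le[OF nd2 tt(2,1), of "c3 t3" "half t"] unfolding eq card_image[OF inj_swap] .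
  qed
  then have "real_of_int (int (card (Nset t)) * T) \<le> real_of_int (Y * (Y + T))" by (simp only: of_int_le_iff)
  then show ?thesis using T by (simp add: field_simps)
qed

end

section \<open>Triples t whose lattice has short vectors\<close>

lemma card_UN_le_bound:
  assumes "finite I" "\<And>i. i \<in> I \<Longrightarrow> int (card (A i)) \<le> b"
  shows "int (card (\<Union>i\<in>I. A i)) \<le> int (card I) * b"
proof -
  have "int (card (\<Union>i\<in>I. A i)) \<le> int (\<Sum>i\<in>I. card (A i))"
    using card_UN_le[OF assms(1), of A] by (simp only: of_nat_le_iff)
  also have "\<dots> = (\<Sum>i\<in>I. int (card (A i)))" by simp
  also have "\<dots> \<le> (\<Sum>i\<in>I. b)" using assms(2) by (intro sum_mono) auto
  finally show ?thesis by simp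
qed

context second_moment
begin

lemma Y_pos: "Y > 0" using Y by simp

lemma card_T: "int (card T1) \<le> 2 * X" "int (card T2) \<le> 2 * Y"
  unfolding T1_def T2_def using X0 Y by auto

lemma card_T1_T2: "int (card (T1 \<times> T2)) \<le> 4 * X * Y"
proof -
  have "int (card (T1 \<times> T2)) = int (card T1) * int (card T2)" by (simp add: card_cartesian_product)
  also have "\<dots> \<le> (2 * X) * (2 * Y)" using card_T X0 by (intro mult_mono) auto
  finally show ?thesis by simp
qed

lemma c_inj: "c2 t = c2 t' \<Longrightarrow> t = t'" "c3 t = c3 t' \<Longrightarrow> t = t'"
  using a2_nz a3_nz q_pos by (auto simp: c2_def c3_def)

lemma quotient_bound:
  assumes "t1 \<in> T1" "c1 t1 * j = r" "\<bar>r\<bar> \<le> B * Y"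
  shows "\<bar>j\<bar> \<le> B"
proof -
  have "Y * \<bar>j\<bar> \<le> c1 t1 * \<bar>j\<bar>" using c1_bounds[OF assms(1)] by (intro mult_right_mono) auto
  also have "\<dots> = \<bar>r\<bar>" using assms(2) c1_bounds[OF assms(1)] by (auto simp: abs_mult)
  finally have "Y * \<bar>j\<bar> \<le> Y * B" using assms(3) by (simp add: mult.commute)
  then show ?thesis using Y by simp
qed

text \<open>A short vector (x, y) satisfies c_2 x + c_3 y = c_1 j, where |j| <= 2KJ because c_2 and
  c_3 are at most J Y in absolute value and c_1 >= Y. For given x, y, j two of the t_i determine the
  third: t_2 if x is nonzero, t_3 if y is. This leaves O(XY) triples out of about XY^2.\<close>

lemma card_exc:
  "int (card {t \<in> Tset. exc t}) \<le> (2 * K + 1) * ((2 * K + 1) * (4 * K * J + 1)) * (8 * X * Y)"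
proof -
  let ?I = "{-K..K} \<times> {-K..K} \<times> {-(2 * K * J)..2 * K * J}"
  define E1 where "E1 = (\<lambda>(x, y, j). {(t1, t2, t3) \<in> Tset. x \<noteq> 0 \<and> c2 t2 * x + c3 t3 * y = c1 t1 * j})"
  define E2 where "E2 = (\<lambda>(x, y, j). {(t1, t2, t3) \<in> Tset. y \<noteq> 0 \<and> c2 t2 * x + c3 t3 * y = c1 t1 * j})"
  have sub: "{t \<in> Tset. exc t} \<subseteq> (\<Union>i\<in>?I. E1 i \<union> E2 i)"
  proof
    fix t assume t: "t \<in> {t \<in> Tset. exc t}"
    obtain t1 t2 t3 where td: "t = (t1, t2, t3)" by (metis surj_pair)
    obtain x y where xy: "(x, y) \<noteq> (0, 0)" "\<bar>x\<bar> \<le> K" "\<bar>y\<bar> \<le> K" "c1 t1 dvd c2 t2 * x + c3 t3 * y"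
      using t unfolding exc_def td by auto
    then obtain j where j: "c2 t2 * x + c3 t3 * y = c1 t1 * j" by blast
    have tt: "t1 \<in> T1" "t2 \<in> {2..2 * Y}" "t3 \<in> {2..2 * Y}" using t unfolding td Tset_def T2_def by auto
    have "\<bar>c2 t2 * x + c3 t3 * y\<bar> \<le> \<bar>c2 t2\<bar> * \<bar>x\<bar> + \<bar>c3 t3\<bar> * \<bar>y\<bar>"
      unfolding abs_mult[symmetric] by (rule abs_triangle_ineq)
    also have "\<dots> \<le> (J * Y) * K + (J * Y) * K"
      using J tt xy Y by (intro add_mono mult_mono) auto
    finally have "\<bar>c2 t2 * x + c3 t3 * y\<bar> \<le> (2 * K * J) * Y" by (simp add: algebra_simps)
    then have "\<bar>j\<bar> \<le> 2 * K * J" using quotient_bound[OF tt(1)] j by simp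
    then have "(x, y, j) \<in> ?I" using xy by auto
    moreover have "t \<in> E1 (x, y, j) \<union> E2 (x, y, j)" using t xy j unfolding td E1_def E2_def by auto
    ultimately show "t \<in> (\<Union>i\<in>?I. E1 i \<union> E2 i)" by blast
  qed
  have fin: "finite (E1 i)" "finite (E2 i)" for i
    unfolding E1_def E2_def by (cases i; auto intro: finite_subset[of _ Tset])+
  have card1: "int (card (E1 i)) \<le> 4 * X * Y" for i
  proof -
    obtain x y j where i: "i = (x, y, j)" by (metis surj_pair)
    have "inj_on (\<lambda>(t1, t2, t3). (t1, t3)) (E1 i)"
    proof (rule inj_onI)
      fix s s' assume s: "s \<in> E1 i" "s' \<in> E1 i" "(\<lambda>(t1, t2, t3). (t1, t3)) s = (\<lambda>(t1, t2, t3). (t1, t3)) s'"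
      obtain t1 t2 t3 where sd: "s = (t1, t2, t3)" by (metis surj_pair)
      obtain t2' where sd': "s' = (t1, t2', t3)" using s(3) unfolding sd by (cases s') auto
      have "x \<noteq> 0" "c2 t2 * x + c3 t3 * y = c1 t1 * j" "c2 t2' * x + c3 t3 * y = c1 t1 * j"
        using s(1,2) unfolding sd sd' E1_def i by auto
      moreover from this have "c2 t2 * x = c2 t2' * x" by linarith
      ultimately show "s = s'" using c_inj(1)[of t2 t2'] unfolding sd sd' by simp
    qed
    then have "card (E1 i) \<le> card (T1 \<times> T2)"
      by (rule card_inj_on_le) (auto simp: E1_def Tset_def i)
    then show ?thesis using card_T1_T2 by linarith
  qed
  have card2: "int (card (E2 i)) \<le> 4 * X * Y" for i
  proof -
    obtain x y j where i: "i = (x, y, j)" by (metis surj_pair)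
    have "inj_on (\<lambda>(t1, t2, t3). (t1, t2)) (E2 i)"
    proof (rule inj_onI)
      fix s s' assume s: "s \<in> E2 i" "s' \<in> E2 i" "(\<lambda>(t1, t2, t3). (t1, t2)) s = (\<lambda>(t1, t2, t3). (t1, t2)) s'"
      obtain t1 t2 t3 where sd: "s = (t1, t2, t3)" by (metis surj_pair)
      obtain t3' where sd': "s' = (t1, t2, t3')" using s(3) unfolding sd by (cases s') auto
      have "y \<noteq> 0" "c2 t2 * x + c3 t3 * y = c1 t1 * j" "c2 t2 * x + c3 t3' * y = c1 t1 * j"
        using s(1,2) unfolding sd sd' E2_def i by auto
      moreover from this have "c3 t3 * y = c3 t3' * y" by linarith
      ultimately show "s = s'" using c_inj(2)[of t3 t3'] unfolding sd sd' by simp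
    qed
    then have "card (E2 i) \<le> card (T1 \<times> T2)"
      by (rule card_inj_on_le) (auto simp: E2_def Tset_def i)
    then show ?thesis using card_T1_T2 by linarith
  qed
  have "finite (\<Union>i\<in>?I. E1 i \<union> E2 i)" using fin by auto
  then have "int (card {t \<in> Tset. exc t}) \<le> int (card (\<Union>i\<in>?I. E1 i \<union> E2 i))"
    using card_mono[OF _ sub] by (simp only: of_nat_le_iff)
  also have "\<dots> \<le> int (card ?I) * (8 * X * Y)"
  proof (rule card_UN_le_bound)
    fix i
    show "int (card (E1 i \<union> E2 i)) \<le> 8 * X * Y"
      using card_Un_le[of "E1 i" "E2 i"] card1[of i] card2[of i] by linarith
  qed auto
  also have "int (card ?I) = (2 * K + 1) * ((2 * K + 1) * (4 * K * J + 1))"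
  proof -
    have "0 \<le> 4 * K * J + 1" "0 \<le> 4 * (J * K) + 1" using K J by simp_all
    then show ?thesis using K by (simp add: card_cartesian_product)
  qed
  finally show ?thesis .
qed

text \<open>The argument of \<open>card_exc\<close> with two equations: now t_1 determines both t_2
  and t_3, which leaves only O(X) triples, few enough for the trivial bound Y^2 on the number of
  points.\<close>

lemma card_deg:
  "int (card {t \<in> Tset. deg t}) \<le> T * (T * ((2 * T * J + 1) * (2 * T * J + 1))) * (2 * X)"
proof -
  let ?I = "{1..T} \<times> {1..T} \<times> {-(T * J)..T * J} \<times> {-(T * J)..T * J}"
  define D where "D = (\<lambda>(i, i', j, j'). {(t1, t2, t3) \<in> Tset. i \<noteq> 0 \<and> i' \<noteq> 0 \<and> c2 t2 * i = c1 t1 * j \<and> c3 t3 * i' = c1 t1 * j'})"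
  have qb: "\<bar>j\<bar> \<le> T * J" if "t1 \<in> T1" "\<bar>c\<bar> \<le> J * Y" "i \<in> {1..<T}" "c * i = c1 t1 * j" for t1 c i j
  proof -
    have "\<bar>c * i\<bar> = \<bar>c\<bar> * i" unfolding abs_mult using that(3) by simp
    also have "\<dots> \<le> (J * Y) * T" using that J Y by (intro mult_mono) auto
    finally have "\<bar>c * i\<bar> \<le> (T * J) * Y" by (simp add: algebra_simps)
    then show ?thesis using quotient_bound[OF that(1)] that(4) by simp
  qed
  have sub: "{t \<in> Tset. deg t} \<subseteq> (\<Union>i\<in>?I. D i)"
  proof
    fix t assume t: "t \<in> {t \<in> Tset. deg t}"
    obtain t1 t2 t3 where td: "t = (t1, t2, t3)" by (metis surj_pair)
    obtain i i' where i: "i \<in> {1..<T}" "i' \<in> {1..<T}" "c1 t1 dvd c2 t2 * i" "c1 t1 dvd c3 t3 * i'"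
      using t unfolding deg_def td by auto
    then obtain j j' where j: "c2 t2 * i = c1 t1 * j" "c3 t3 * i' = c1 t1 * j'" by blast
    have tt: "t1 \<in> T1" "t2 \<in> {2..2 * Y}" "t3 \<in> {2..2 * Y}" using t unfolding td Tset_def T2_def by auto
    have "\<bar>j\<bar> \<le> T * J" "\<bar>j'\<bar> \<le> T * J"
      using qb[OF tt(1) J(2)[OF tt(2)] i(1) j(1)] qb[OF tt(1) J(3)[OF tt(3)] i(2) j(2)] by auto
    then have "(i, i', j, j') \<in> ?I" using i by auto
    moreover have "t \<in> D (i, i', j, j')" using t i j unfolding td D_def by auto
    ultimately show "t \<in> (\<Union>i\<in>?I. D i)" by blast
  qed
  have fin: "finite (D i)" for i
    unfolding D_def by (cases i; auto intro: finite_subset[of _ Tset])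
  have card1: "int (card (D i)) \<le> 2 * X" for i
  proof -
    obtain x y j j' where i: "i = (x, y, j, j')" by (metis surj_pair)
    have "inj_on (\<lambda>(t1, t2, t3). t1) (D i)"
    proof (rule inj_onI)
      fix s s' assume s: "s \<in> D i" "s' \<in> D i" "(\<lambda>(t1, t2, t3). t1) s = (\<lambda>(t1, t2, t3). t1) s'"
      obtain t1 t2 t3 where sd: "s = (t1, t2, t3)" by (metis surj_pair)
      obtain t2' t3' where sd': "s' = (t1, t2', t3')" using s(3) unfolding sd by (cases s') auto
      have "x \<noteq> 0" "y \<noteq> 0" "c2 t2 * x = c2 t2' * x" "c3 t3 * y = c3 t3' * y"
        using s(1,2) unfolding sd sd' D_def i by auto
      then show "s = s'" unfolding sd sd' using c_inj(1)[of t2 t2'] c_inj(2)[of t3 t3'] by simp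
    qed
    then have "card (D i) \<le> card T1"
      by (rule card_inj_on_le) (auto simp: D_def Tset_def i)
    then show ?thesis using card_T by linarith
  qed
  have "finite (\<Union>i\<in>?I. D i)" using fin by auto
  then have "int (card {t \<in> Tset. deg t}) \<le> int (card (\<Union>i\<in>?I. D i))"
    using card_mono[OF _ sub] by (simp only: of_nat_le_iff)
  also have "\<dots> \<le> int (card ?I) * (2 * X)"
    by (rule card_UN_le_bound) (use card1 in auto)
  also have "int (card ?I) = T * (T * ((2 * T * J + 1) * (2 * T * J + 1)))"
  proof -
    have "0 \<le> T * J" using T J by simp
    then show ?thesis using T by (simp add: card_cartesian_product algebra_simps)
  qed
  finally show ?thesis .
qed

text \<open>O(XY) triples with Y^2 points each would be of the order of the main term. On the
  non-degenerate ones the bound Y (Y + T) / T saves a factor of about T, a constant that can be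
  chosen large.\<close>

lemma exceptional_sum:
  "(\<Sum>t\<in>{t \<in> Tset. exc t}. (real_of_int (c1 (fst t)))^2 * real (card (Nset t)))
    \<le> (real_of_int C)^2 * (real (card {t \<in> Tset. exc t}) * (real_of_int (Y * (Y + T)) / real_of_int T)
      + real (card {t \<in> Tset. deg t}) * real_of_int (Y * Y))"
proof -
  let ?E = "{t \<in> Tset. exc t}" and ?EN = "{t \<in> Tset. exc t \<and> \<not> deg t}" and ?ED = "{t \<in> Tset. exc t \<and> deg t}"
  let ?N = "\<lambda>t. real (card (Nset t))" and ?B = "real_of_int (Y * (Y + T)) / real_of_int T"
  have TT: "?E = ?EN \<union> ?ED" by auto
  have "(\<Sum>t\<in>?E. (real_of_int (c1 (fst t)))^2 * ?N t)
    \<le> (\<Sum>t\<in>?E. (real_of_int C)^2 * ?N t)"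
  proof (rule sum_mono, rule mult_right_mono)
    fix t assume "t \<in> ?E"
    then have "fst t \<in> T1" unfolding Tset_def by auto
    then show "(real_of_int (c1 (fst t)))^2 \<le> (real_of_int C)^2"
      using c1_bounds(2,3)[of "fst t"] by (intro power_mono) auto
  qed auto
  also have "\<dots> = (real_of_int C)^2 * (\<Sum>t\<in>?E. ?N t)"
    by (simp add: sum_distrib_left)
  also have "(\<Sum>t\<in>?E. ?N t)
    = (\<Sum>t\<in>?EN. ?N t) + (\<Sum>t\<in>?ED. ?N t)"
    by (subst TT, rule sum.union_disjoint) auto
  also have "(\<Sum>t\<in>?EN. ?N t)
    \<le> (\<Sum>t\<in>?EN. ?B)"
    using card_Nset_nondeg by (intro sum_mono) auto
  also have "\<dots> \<le> (\<Sum>t\<in>?E. ?B)"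
    using Y_pos T by (intro sum_mono2) auto
  also have "(\<Sum>t\<in>?ED. ?N t)
    \<le> (\<Sum>t\<in>?ED. real_of_int (Y * Y))"
    using card_Nset_trivial by (intro sum_mono) auto
  also have "\<dots> \<le> (\<Sum>t\<in>{t \<in> Tset. deg t}. real_of_int (Y * Y))"
    using Y_pos by (intro sum_mono2) auto
  finally show ?thesis by (simp add: mult_left_mono)
qed

text \<open>By \<open>common_divisor_coprime\<close> each coordinate of t lies in one class modulo
  e, so e^3 times the number of triples is at most (2X + e)(2Y + e)^2.\<close>

lemma gcd_term:
  fixes e :: nat
  assumes e: "e > P"
  shows "real e * real (card {t \<in> Tset. g t = int e})
    \<le> 64 * real_of_int X * (real_of_int Y)^2 * (1 / (real e)^2) + 4 * (2 * real_of_int X + real_of_int C)"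
proof (cases "{t \<in> Tset. g t = int e} = {}")
  case True
  then show ?thesis using X0 C_ge by (simp only: card.empty) simp
next
  case False
  let ?e = "int e"
  let ?G = "{t \<in> Tset. g t = ?e}"
  have epos: "?e > 0" "real e > 0" using e by auto
  obtain t1 t2 t3 where t: "(t1, t2, t3) \<in> Tset" "g (t1, t2, t3) = ?e" using False by auto
  have dv: "?e dvd c1 s1" "?e dvd c2 s2" "?e dvd c3 s3" if "g (s1, s2, s3) = ?e" for s1 s2 s3
  proof -
    have eq: "?e = gcd (c1 s1) (gcd (c2 s2) (c3 s3))" using that by (simp add: g_def)
    show "?e dvd c1 s1" "?e dvd c2 s2" "?e dvd c3 s3" unfolding eq by (auto intro: dvd_trans[OF gcd_dvd2])
  qed
  note cop = common_divisor_coprime[OF epos(1) dv[OF t(2)]]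
  have "?e \<le> c1 t1" using dv[OF t(2)] c1_bounds(3)[of t1] t(1) by (intro zdvd_imp_le) (auto simp: Tset_def)
  then have eC: "?e \<le> C" using c1_bounds(2)[of t1] t(1) by (auto simp: Tset_def)
  define N1 where "N1 = {t \<in> T1. ?e dvd l1 + (q * a1) * t}"
  define N2 where "N2 = {t \<in> T2. ?e dvd l2 + (q * a2) * t}"
  define N3 where "N3 = {t \<in> T2. ?e dvd l3 + (q * a3) * t}"
  have fin: "finite N1" "finite N2" "finite N3" unfolding N1_def N2_def N3_def by auto
  have n1: "int (card N1) * ?e \<le> 2 * X + ?e"
    using card_progression_multiples_le[OF cop(2) epos(1), of "2 * X0 + 2" "2 * X" l1] X0
    unfolding N1_def T1_def by simp
  have n2: "int (card N2) * ?e \<le> 2 * Y + ?e"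
    using card_progression_multiples_le[OF cop(3) epos(1), of "2" "2 * Y" l2] Y
    unfolding N2_def T2_def by simp
  have n3: "int (card N3) * ?e \<le> 2 * Y + ?e"
    using card_progression_multiples_le[OF cop(4) epos(1), of "2" "2 * Y" l3] Y
    unfolding N3_def T2_def by simp
  have "?G \<subseteq> N1 \<times> N2 \<times> N3"
  proof
    fix s assume s: "s \<in> ?G"
    obtain s1 s2 s3 where sd: "s = (s1, s2, s3)" by (metis surj_pair)
    have "g (s1, s2, s3) = ?e" using s unfolding sd by simp
    from dv[OF this] s show "s \<in> N1 \<times> N2 \<times> N3"
      unfolding sd N1_def N2_def N3_def Tset_def c1_def c2_def c3_def by simp
  qed
  then have "card ?G \<le> card (N1 \<times> N2 \<times> N3)" using fin by (intro card_mono) auto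
  then have "real (card ?G) \<le> real (card (N1 \<times> N2 \<times> N3))" by (simp only: of_nat_le_iff)
  then have cd: "real (card ?G) \<le> real (card N1) * (real (card N2) * real (card N3))"
    by (simp add: card_cartesian_product)
  have toreal: "real k * real e \<le> 2 * real_of_int Z + real e" if "int k * ?e \<le> 2 * Z + ?e" for k Z
  proof -
    have "real_of_int (int k * ?e) \<le> real_of_int (2 * Z + ?e)" using that by (simp only: of_int_le_iff)
    then show ?thesis by simp
  qed
  let ?x = "real_of_int X" and ?y = "real_of_int Y" and ?r = "real e"
  have pos: "0 < ?x" "0 < ?y" "?y \<le> ?x" using X0 Y by auto
  have "?r^2 * (?r * real (card ?G))
    \<le> ?r^2 * (?r * (real (card N1) * (real (card N2) * real (card N3))))"
    using cd by (intro mult_left_mono) auto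
  also have "\<dots> = (real (card N1) * ?r) * ((real (card N2) * ?r) * (real (card N3) * ?r))"
    by (simp add: power2_eq_square)
  also have "\<dots> \<le> (2 * ?x + ?r) * ((2 * ?y + ?r) * (2 * ?y + ?r))"
    using toreal[OF n1] toreal[OF n2] toreal[OF n3] pos by (intro mult_mono) auto
  finally have main: "?r^2 * (?r * real (card ?G)) \<le> (2 * ?x + ?r) * ((2 * ?y + ?r) * (2 * ?y + ?r))" .
  \<comment> \<open>For e <= 2Y the sides of the box dominate and the decay 1/e^2 results. For
    larger e, which are at most C, the progressions have O(1) members in two coordinates; the second
    summand of the claim pays for them.\<close>
  show ?thesis
  proof (cases "?r \<le> 2 * ?y")
    case True
    have "(2 * ?x + ?r) * ((2 * ?y + ?r) * (2 * ?y + ?r)) \<le> (4 * ?x) * ((4 * ?y) * (4 * ?y))"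
      using True pos by (intro mult_mono) auto
    also have "\<dots> = 64 * ?x * ?y^2" by (simp add: power2_eq_square)
    finally have "?r^2 * (?r * real (card ?G)) \<le> 64 * ?x * ?y^2" using main by linarith
    then have "?r * real (card ?G) \<le> 64 * ?x * ?y^2 * (1 / ?r^2)"
      using epos by (simp add: field_simps)
    then show ?thesis using pos C_ge by simp
  next
    case False
    have "(2 * ?x + ?r) * ((2 * ?y + ?r) * (2 * ?y + ?r)) \<le> (2 * ?x + ?r) * ((2 * ?r) * (2 * ?r))"
      using False pos by (intro mult_left_mono mult_mono) auto
    also have "\<dots> = ?r^2 * (4 * (2 * ?x + ?r))" by (simp add: power2_eq_square)
    finally have "?r^2 * (?r * real (card ?G)) \<le> ?r^2 * (4 * (2 * ?x + ?r))" using main by linarith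
    then have "?r * real (card ?G) \<le> 4 * (2 * ?x + ?r)" using epos by simp
    also have "\<dots> \<le> 4 * (2 * ?x + real_of_int C)" using eC by simp
    finally show ?thesis using pos by (simp add: add_increasing)
  qed
qed

text \<open>Grouping by the value e of g, which exceeds P by \<open>common_divisor_large\<close>,
  leaves the tail of the sum of 1/e^2.\<close>

lemma gcd_sum:
  "(\<Sum>t\<in>{t \<in> Tset. g t > 1}. real_of_int (g t))
    \<le> 64 * real_of_int X * (real_of_int Y)^2 / real P + real_of_int C * (4 * (2 * real_of_int X + real_of_int C))"
proof -
  let ?S = "{t \<in> Tset. g t > 1}"
  let ?x = "real_of_int X" and ?y = "real_of_int Y"
  have rng: "(\<lambda>t. nat (g t)) ` ?S \<subseteq> {P<..nat C}"
  proof (rule image_subsetI)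
    fix t assume t: "t \<in> ?S"
    obtain t1 t2 t3 where td: "t = (t1, t2, t3)" by (metis surj_pair)
    have dv: "g t dvd c1 t1" "g t dvd c2 t2" "g t dvd c3 t3"
      unfolding td g_def by (auto intro: dvd_trans[OF gcd_dvd2])
    have "g t > int P" using common_divisor_large dv t by auto
    moreover have "g t \<le> C"
      using zdvd_imp_le[OF dv(1)] c1_bounds[of t1] t unfolding td Tset_def by auto
    ultimately show "nat (g t) \<in> {P<..nat C}" by auto
  qed
  have "(\<Sum>t\<in>?S. real_of_int (g t)) = (\<Sum>e\<in>{P<..nat C}. \<Sum>t\<in>{t \<in> ?S. nat (g t) = e}. real_of_int (g t))"
    using rng by (intro sum.group[symmetric]) auto
  also have "\<dots> \<le> (\<Sum>e\<in>{P<..nat C}. 64 * ?x * ?y^2 * (1 / (real e)^2) + 4 * (2 * ?x + real_of_int C))"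
  proof (rule sum_mono)
    fix e assume e: "e \<in> {P<..nat C}"
    have "{t \<in> ?S. nat (g t) = e} \<subseteq> {t \<in> Tset. g t = int e}" by auto
    moreover have "(\<Sum>t\<in>{t \<in> ?S. nat (g t) = e}. real_of_int (g t)) = real e * real (card {t \<in> ?S. nat (g t) = e})"
    proof -
      have "(\<Sum>t\<in>{t \<in> ?S. nat (g t) = e}. real_of_int (g t)) = (\<Sum>t\<in>{t \<in> ?S. nat (g t) = e}. real e)"
        by (intro sum.cong) auto
      then show ?thesis by simp
    qed
    ultimately have "(\<Sum>t\<in>{t \<in> ?S. nat (g t) = e}. real_of_int (g t)) \<le> real e * real (card {t \<in> Tset. g t = int e})"
      by (auto intro!: mult_left_mono card_mono)
    also have "\<dots> \<le> 64 * ?x * ?y^2 * (1 / (real e)^2) + 4 * (2 * ?x + real_of_int C)"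
      using gcd_term e by simp
    finally show "(\<Sum>t\<in>{t \<in> ?S. nat (g t) = e}. real_of_int (g t)) \<le> \<dots>" .
  qed
  also have "\<dots> = 64 * ?x * ?y^2 * (\<Sum>e\<in>{P<..nat C}. 1 / (real e)^2) + real (card {P<..nat C}) * (4 * (2 * ?x + real_of_int C))"
    by (simp add: sum.distrib sum_distrib_left)
  also have "\<dots> \<le> 64 * ?x * ?y^2 * (1 / real P) + real_of_int C * (4 * (2 * ?x + real_of_int C))"
    using sum_inverse_squares_le[of P "nat C"] P2 X0 C_ge
    by (intro add_mono mult_left_mono mult_right_mono) auto
  finally show ?thesis by simp
qed

text \<open>As 2 m m = Y^2 / 2, the right-hand side is about q a1 X^2 Y^4 when h is small against Y;
  this agrees with the square of the first moment divided by the q a1 X^2 integers available as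
  values.\<close>

lemma main_sum:
  "(\<Sum>t\<in>{t \<in> Tset. evenT t}. c1 (fst t) * V t)
    \<le> 4 * ((q * a1 * (X * (X + 1)) + \<bar>l1\<bar> * X) * ((2 * m * m + 4 * h * Y) * (2 * m * m + 4 * h * Y)))"
proof -
  have "(\<Sum>t\<in>{t \<in> Tset. evenT t}. c1 (fst t) * V t) = (\<Sum>t\<in>Tset. if evenT t then c1 (fst t) * V t else 0)"
    by (simp add: sum.inter_filter)
  also have "\<dots> = (\<Sum>t1\<in>T1. \<Sum>t2\<in>T2. \<Sum>t3\<in>T2. if evenT (t1, t2, t3) then c1 t1 * V (t1, t2, t3) else 0)"
    unfolding Tset_def by (simp only: sum.cartesian_product' fst_conv)
  also have "\<dots> = (\<Sum>t1\<in>T1. \<Sum>t2\<in>T2. \<Sum>t3\<in>T2. if even (l1 * t1 + l2 * t2 + l3 * t3)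
      then c1 t1 * ((sum_width Y t2 + 4 * h) * (sum_width Y t3 + 4 * h)) else 0)"
    by (simp only: evenT_def V_def prod.case)
  also have "\<dots> \<le> 4 * ((q * a1 * (X * (X + 1)) + \<bar>l1\<bar> * X) * ((2 * m * m + 4 * h * Y) * (2 * m * m + 4 * h * Y)))"
  proof (rule sum_even_combination_le)
    show "parity_bounded T1 c1 (q * a1 * (X * (X + 1)) + \<bar>l1\<bar> * X)"
      unfolding parity_bounded_def
    proof (intro conjI ballI)
      show "0 \<le> c1 t" if "t \<in> T1" for t using c1_bounds(3)[OF that] by simp
      fix e :: int assume "e \<in> {0, 1}"
      then have e: "e = 0 \<or> e = 1" by simp
      let ?A = "{t \<in> {1..2 * X}. t mod 2 = e}"
      have "(\<Sum>t\<in>{t \<in> T1. t mod 2 = e}. c1 t) \<le> (\<Sum>t\<in>{t \<in> T1. t mod 2 = e}. q * a1 * t + \<bar>l1\<bar>)"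
        unfolding c1_def by (intro sum_mono) auto
      also have "\<dots> \<le> (\<Sum>t\<in>?A. q * a1 * t + \<bar>l1\<bar>)"
        using X0 qa1_pos unfolding T1_def by (intro sum_mono2) (auto intro: finite_subset[of _ "{1..2 * X}"])
      also have "\<dots> = q * a1 * (\<Sum>t\<in>?A. t) + int (card ?A) * \<bar>l1\<bar>"
        by (simp add: sum.distrib sum_distrib_left)
      also have "int (card ?A) = X" using card_parity_class[OF e, of X 0] X0 by simp
      also have "q * a1 * (\<Sum>t\<in>?A. t) \<le> q * a1 * (X * (X + 1))"
        using sum_parity_class_le[OF e, of X] X0 qa1_pos by (intro mult_left_mono) auto
      finally show "(\<Sum>t\<in>{t \<in> T1. t mod 2 = e}. c1 t) \<le> q * a1 * (X * (X + 1)) + \<bar>l1\<bar> * X"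
        by (simp add: mult.commute)
    qed simp
    show W: "parity_bounded T2 (\<lambda>t. sum_width Y t + 4 * h) (2 * m * m + 4 * h * Y)"
      unfolding parity_bounded_def
    proof (intro conjI ballI)
      show "0 \<le> sum_width Y t + 4 * h" if "t \<in> T2" for t
        using sum_width_bounds that K unfolding T2_def by fastforce
      fix e :: int assume "e \<in> {0, 1}"
      then have e: "e = 0 \<or> e = 1" by simp
      let ?A = "{t \<in> T2. t mod 2 = e}"
      have "card ?A \<le> card {t \<in> {0 + 1..0 + 2 * Y}. t mod 2 = e}"
        unfolding T2_def by (intro card_mono) (auto intro: finite_subset[of _ "{1..2 * Y}"])
      then have cd: "int (card ?A) \<le> Y" using card_parity_class[OF e, of Y 0] Y by simp
      have "(\<Sum>t\<in>?A. sum_width Y t + 4 * h) = (\<Sum>t\<in>?A. sum_width Y t) + int (card ?A) * (4 * h)"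
        by (simp add: sum.distrib)
      also have "(\<Sum>t\<in>?A. sum_width Y t) = 2 * m * m"
        unfolding T2_def using sum_sum_width_parity[OF e Y(1)] Y by simp
      also have "int (card ?A) * (4 * h) \<le> Y * (4 * h)" using cd K by (intro mult_right_mono) auto
      finally show "(\<Sum>t\<in>?A. sum_width Y t + 4 * h) \<le> 2 * m * m + 4 * h * Y" by (simp add: mult_ac)
    qed simp
    show "parity_bounded T2 (\<lambda>t. sum_width Y t + 4 * h) (2 * m * m + 4 * h * Y)" by (rule W)
  qed (rule some_odd)
  finally show ?thesis .
qed

section \<open>Assembly of the second moment\<close>

lemma V_bounds: "t \<in> Tset \<Longrightarrow> 0 \<le> V t \<and> V t \<le> 4 * Y^2"
proof -
  assume t: "t \<in> Tset"
  obtain t1 t2 t3 where td: "t = (t1, t2, t3)" by (metis surj_pair)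
  have w: "0 \<le> sum_width Y t2" "sum_width Y t2 \<le> Y" "0 \<le> sum_width Y t3" "sum_width Y t3 \<le> Y"
    using t sum_width_bounds unfolding td Tset_def T2_def by auto
  have "(sum_width Y t2 + 4 * h) * (sum_width Y t3 + 4 * h) \<le> (2 * Y) * (2 * Y)"
    using w h K Y by (intro mult_mono) auto
  then show ?thesis using w K unfolding td V_def by (simp add: power2_eq_square)
qed

text \<open>In this order: the main term, the excess from triples with gcd above 1, the exceptional
  triples. For C = 3 q a1 X the leading part of the second is 3 * 4 * 64 / P = 768 / P times q a1
  X^2 Y^4, the source of the constant 768.\<close>

definition moment_bound :: real where
  "moment_bound =
    4 * ((q * a1 * (X * (X + 1)) + \<bar>l1\<bar> * X) * ((2 * m * m + 4 * h * Y) * (2 * m * m + 4 * h * Y)))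
    + C * (4 * Y^2) * (64 * X * Y^2 / P + C * (4 * (2 * X + C)))
    + C^2 * ((2 * K + 1) * ((2 * K + 1) * (4 * K * J + 1)) * (8 * X * Y) * (Y * (Y + T) / T)
      + T * (T * ((2 * T * J + 1) * (2 * T * J + 1))) * (2 * X) * Y^2)"

lemma pair_sum_bound:
  "(\<Sum>(u, v)\<in>{(u, v) \<in> Box \<times> Box. F u = F v}. real_of_int (weight u) * real_of_int (weight v)) \<le> moment_bound"
proof -
  let ?f = "\<lambda>t. (real_of_int (c1 (fst t)))^2 * real (card (Nset t))"
  let ?E = "{t \<in> Tset. evenT t}" and ?X = "{t \<in> Tset. exc t}" and ?D = "{t \<in> Tset. deg t}"
  let ?Eg = "{t \<in> ?E. \<not> exc t}"
  let ?cE = "(2 * K + 1) * ((2 * K + 1) * (4 * K * J + 1)) * (8 * X * Y)" and ?cD = "T * (T * ((2 * T * J + 1) * (2 * T * J + 1))) * (2 * X)"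
  have c1p: "0 < c1 (fst t)" "c1 (fst t) \<le> C" if "t \<in> Tset" for t using that c1_bounds unfolding Tset_def by auto
  \<comment> \<open>Only g = 1 needs the precise bound c_1 V. For g > 1 the bound c_1 V g is
    coarsened to 4 C Y^2 g, since those t are controlled only through the sum of g in
    \<open>gcd_sum\<close>.\<close>
  have good: "?f t \<le> real_of_int (c1 (fst t) * V t) + (if g t > 1 then real_of_int (C * (4 * Y^2)) * real_of_int (g t) else 0)"
    if t: "t \<in> Tset" "\<not> exc t" for t
  proof -
    have "c1 (fst t) * (int (card (Nset t)) * c1 (fst t)) \<le> c1 (fst t) * (g t * V t)"
      using card_Nset_good[OF t] c1p[OF t(1)] by (intro mult_left_mono) auto
    then have "real_of_int (c1 (fst t) * (int (card (Nset t)) * c1 (fst t))) \<le> real_of_int (c1 (fst t) * (g t * V t))"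
      by (simp only: of_int_le_iff)
    then have 1: "?f t \<le> real_of_int (c1 (fst t) * (g t * V t))" by (simp add: power2_eq_square mult_ac)
    have gpos: "g t \<ge> 1"
    proof -
      obtain t1 t2 t3 where td: "t = (t1, t2, t3)" by (metis surj_pair)
      have "g t > 0" using c1p[OF t(1)] unfolding td g_def by (simp add: gcd_pos_int)
      then show ?thesis by simp
    qed
    show ?thesis
    proof (cases "g t > 1")
      case True
      have "c1 (fst t) * V t * g t \<le> C * (4 * Y^2) * g t"
        using V_bounds[OF t(1)] c1p[OF t(1)] gpos by (intro mult_right_mono mult_mono) auto
      then have "real_of_int (c1 (fst t) * V t * g t) \<le> real_of_int (C * (4 * Y^2) * g t)" by (simp only: of_int_le_iff)
      moreover have "0 \<le> real_of_int (c1 (fst t) * V t)"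
        using V_bounds[OF t(1)] c1p[OF t(1)] by (simp only: of_int_0_le_iff) simp
      moreover have "real_of_int (c1 (fst t) * (g t * V t)) = real_of_int (c1 (fst t) * V t * g t)" by (simp add: mult_ac)
      ultimately have "?f t \<le> real_of_int (C * (4 * Y^2) * g t) + real_of_int (c1 (fst t) * V t)" using 1 by linarith
      then show ?thesis using True by (simp only: of_int_mult) simp
    next
      case False
      then have "g t = 1" using gpos by simp
      then show ?thesis using 1 by simp
    qed
  qed
  have "(\<Sum>(u, v)\<in>{(u, v) \<in> Box \<times> Box. F u = F v}. real_of_int (weight u) * real_of_int (weight v)) \<le> sum ?f ?E"
    by (rule pair_sum_le)
  also have "\<dots> = sum ?f ?Eg + sum ?f {t \<in> ?E. exc t}"
  proof -
    have "?E = ?Eg \<union> {t \<in> ?E. exc t}" by auto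
    then have "sum ?f ?E = sum ?f (?Eg \<union> {t \<in> ?E. exc t})" by (rule arg_cong)
    also have "\<dots> = sum ?f ?Eg + sum ?f {t \<in> ?E. exc t}" by (intro sum.union_disjoint) auto
    finally show ?thesis .
  qed
  also have "sum ?f {t \<in> ?E. exc t} \<le> sum ?f ?X" by (intro sum_mono2) auto
  also have "\<dots> \<le> (real_of_int C)^2 * (real (card ?X) * (real_of_int (Y * (Y + T)) / real_of_int T)
      + real (card ?D) * real_of_int (Y * Y))" by (rule exceptional_sum)
  also have "\<dots> \<le> (real_of_int C)^2 *
      (real_of_int ?cE * (real_of_int (Y * (Y + T)) / real_of_int T)
      + real_of_int ?cD * real_of_int (Y * Y))"
  proof (intro mult_left_mono add_mono mult_right_mono)
    have "real_of_int (int (card ?X)) \<le> real_of_int ?cE"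
      using card_exc by (simp only: of_int_le_iff)
    then show "real (card ?X) \<le> real_of_int ?cE"
      by (simp only: of_int_of_nat_eq)
    have "real_of_int (int (card ?D)) \<le> real_of_int ?cD"
      using card_deg by (simp only: of_int_le_iff)
    then show "real (card ?D) \<le> real_of_int ?cD"
      by (simp only: of_int_of_nat_eq)
  qed (use Y T in auto)
  also have "sum ?f ?Eg \<le> (\<Sum>t\<in>?Eg. real_of_int (c1 (fst t) * V t)
      + (if g t > 1 then real_of_int (C * (4 * Y^2)) * real_of_int (g t) else 0))"
    using good by (intro sum_mono) auto
  also have "\<dots> = (\<Sum>t\<in>?Eg. real_of_int (c1 (fst t) * V t))
      + (\<Sum>t\<in>?Eg. if g t > 1 then real_of_int (C * (4 * Y^2)) * real_of_int (g t) else 0)"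
    by (rule sum.distrib)
  also have "(\<Sum>t\<in>?Eg. real_of_int (c1 (fst t) * V t)) \<le> (\<Sum>t\<in>?E. real_of_int (c1 (fst t) * V t))"
  proof (rule sum_mono2)
    fix t assume "t \<in> ?E - ?Eg"
    then have "t \<in> Tset" by auto
    then show "0 \<le> real_of_int (c1 (fst t) * V t)" using V_bounds c1p by (simp only: of_int_0_le_iff) (simp add: less_imp_le)
  qed auto
  also have "\<dots> = real_of_int (\<Sum>t\<in>?E. c1 (fst t) * V t)" by (simp only: of_int_sum)
  also have "\<dots> \<le> real_of_int (4 * ((q * a1 * (X * (X + 1)) + \<bar>l1\<bar> * X) * ((2 * m * m + 4 * h * Y) * (2 * m * m + 4 * h * Y))))"
    using main_sum by (simp only: of_int_le_iff)
  also have "(\<Sum>t\<in>?Eg. if g t > 1 then real_of_int (C * (4 * Y^2)) * real_of_int (g t) else 0)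
    \<le> (\<Sum>t\<in>Tset. if g t > 1 then real_of_int (C * (4 * Y^2)) * real_of_int (g t) else 0)"
    using C_ge by (intro sum_mono2) auto
  also have "\<dots> = real_of_int (C * (4 * Y^2)) * (\<Sum>t\<in>{t \<in> Tset. g t > 1}. real_of_int (g t))"
    by (subst sum_distrib_left, rule sum.inter_filter[symmetric]) simp
  also have "\<dots> \<le> real_of_int (C * (4 * Y^2)) * (64 * real_of_int X * (real_of_int Y)^2 / real P + real_of_int C * (4 * (2 * real_of_int X + real_of_int C)))"
    using gcd_sum C_ge by (intro mult_left_mono) auto
  finally show ?thesis
    unfolding moment_bound_def by (simp add: power2_eq_square)
qed

lemma sum_weight: "(\<Sum>u\<in>Box. weight u) = ((l1 * X + q * a1 * X^2) - (l1 * X0 + q * a1 * X0^2)) * Y^2"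
proof -
  have *: "(\<Sum>u\<in>{X0 + 1..Z}. l1 + q * a1 * (2 * u - 1)) = (l1 * Z + q * a1 * Z^2) - (l1 * X0 + q * a1 * X0^2)"
    if "X0 \<le> Z" for Z
    using that
  proof (induction Z rule: int_ge_induct)
    case (step i)
    have "{X0 + 1..i + 1} = insert (i + 1) {X0 + 1..i}" using step by auto
    then show ?case using step by (simp add: algebra_simps power2_eq_square)
  qed auto
  have "(\<Sum>u\<in>Box. weight u) = (\<Sum>u1\<in>{X0 + 1..X}. \<Sum>z\<in>{1..Y} \<times> {1..Y}. l1 + q * a1 * (2 * u1 - 1))"
    unfolding Box_def weight_def by (simp only: sum.cartesian_product' prod.case)
  also have "\<dots> = (\<Sum>u1\<in>{X0 + 1..X}. (l1 + q * a1 * (2 * u1 - 1)) * Y^2)"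
    using Y by (simp add: card_cartesian_product power2_eq_square mult_ac)
  also have "\<dots> = (\<Sum>u1\<in>{X0 + 1..X}. l1 + q * a1 * (2 * u1 - 1)) * Y^2" by (rule sum_distrib_right[symmetric])
  finally show ?thesis using * X0 by simp
qed

lemma card_values_lower:
  "(real_of_int (((l1 * X + q * a1 * X^2) - (l1 * X0 + q * a1 * X0^2)) * Y^2))^2 \<le> real (card (F ` Box)) * moment_bound"
proof -
  have "(\<Sum>u\<in>Box. real_of_int (weight u))^2 \<le> real (card (F ` Box)) *
      (\<Sum>(u, v)\<in>{(u, v) \<in> Box \<times> Box. F u = F v}. real_of_int (weight u) * real_of_int (weight v))"
    by (rule weighted_second_moment) simp
  also have "\<dots> \<le> real (card (F ` Box)) * moment_bound" using pair_sum_bound by (intro mult_left_mono) auto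
  finally show ?thesis using sum_weight by (simp only: of_int_sum[symmetric])
qed

end

section \<open>Almost all positive integers are values\<close>

text \<open>Passage from N near w n^2 to all N, by taking n as the integral part of sqrt(N / w). The
  rounding costs O(sqrt N), which the strict inequality c < \<rho> / w absorbs.\<close>

lemma eventually_sqrt_scale:
  fixes f :: "nat \<Rightarrow> real" and \<rho> w c :: real
  assumes "w > 0" "\<rho> \<ge> 0" "c < \<rho> / w"
    and ev: "eventually (\<lambda>n. \<forall>N. w * (real n)^2 \<le> real N \<longrightarrow> \<rho> * (real n)^2 \<le> f N) sequentially"
  shows "eventually (\<lambda>N. c * real N \<le> f N) sequentially"
proof -
  define \<nu> where "\<nu> = (\<lambda>N. nat \<lfloor>sqrt (real N / w)\<rfloor>)"
  have lim: "filterlim \<nu> at_top sequentially"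
    unfolding filterlim_at_top
  proof
    fix Z
    show "eventually (\<lambda>N. Z \<le> \<nu> N) sequentially"
      using eventually_ge_at_top[of "nat \<lceil>w * (real Z)^2\<rceil>"]
    proof eventually_elim
      case (elim N)
      then have "w * (real Z)^2 \<le> real N" by linarith
      then have "(real Z)^2 \<le> real N / w" using assms(1) by (simp add: field_simps)
      then have "real Z \<le> sqrt (real N / w)" by (rule real_le_rsqrt)
      then show "Z \<le> \<nu> N" unfolding \<nu>_def by linarith
    qed
  qed
  have ev': "eventually (\<lambda>N. \<forall>M. w * (real (\<nu> N))^2 \<le> real M \<longrightarrow> \<rho> * (real (\<nu> N))^2 \<le> f M) sequentially"
    using lim ev by (rule eventually_compose_filterlim[rotated])
  define d where "d = \<rho> / w - c"
  have d: "d > 0" using assms(3) by (simp add: d_def)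
  have big: "eventually (\<lambda>N. 2 * \<rho> * sqrt (real N / w) \<le> d * real N) sequentially"
  proof -
    have "eventually (\<lambda>N. N \<ge> nat \<lceil>(2 * \<rho> / d)^2 / w\<rceil> + 1) sequentially" by (rule eventually_ge_at_top)
    then show ?thesis
    proof eventually_elim
      case (elim N)
      then have N: "real N \<ge> (2 * \<rho> / d)^2 / w" "real N > 0" by linarith+
      have "(2 * \<rho> * sqrt (real N / w))^2 = (2 * \<rho>)^2 * (real N / w)" using assms(1) N by (simp add: power_mult_distrib)
      also have "\<dots> = d^2 * real N * ((2 * \<rho> / d)^2 / w)" using d by (simp add: field_simps)
      also have "\<dots> \<le> d^2 * real N * real N" using N d by (intro mult_left_mono) auto
      also have "\<dots> = (d * real N)^2" by (simp add: power2_eq_square)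
      finally show ?case by (rule power2_le_imp_le) (use N d in simp)
    qed
  qed
  show ?thesis using ev' big
  proof eventually_elim
    case (elim N)
    let ?r = "sqrt (real N / w)"
    have r0: "?r \<ge> 0" using assms(1) by simp
    have n: "real (\<nu> N) \<le> ?r" "?r - 1 \<le> real (\<nu> N)" unfolding \<nu>_def using r0 by linarith+
    have r2: "w * ?r^2 = real N" using assms(1) by simp
    have "w * (real (\<nu> N))^2 \<le> w * ?r^2" using n assms(1) by (intro mult_left_mono power_mono) auto
    then have f: "\<rho> * (real (\<nu> N))^2 \<le> f N" using elim(1) r2 by auto
    have "?r^2 - 2 * ?r \<le> (real (\<nu> N))^2"
    proof (cases "?r \<ge> 1")
      case True
      have "?r^2 - 2 * ?r \<le> (?r - 1)^2" by (simp add: power2_eq_square algebra_simps)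
      also have "\<dots> \<le> (real (\<nu> N))^2" using n True by (intro power_mono) auto
      finally show ?thesis .
    next
      case False
      then have "?r * ?r \<le> 1 * ?r" using r0 by (intro mult_right_mono) auto
      then have "?r^2 - 2 * ?r \<le> 0" using r0 unfolding power2_eq_square by linarith
      then show ?thesis by (meson order_trans zero_le_power2)
    qed
    then have "\<rho> * (?r^2 - 2 * ?r) \<le> \<rho> * (real (\<nu> N))^2" using assms(2) by (intro mult_left_mono)
    moreover have "\<rho> * ?r^2 = (\<rho> / w) * real N" using assms(1) by simp
    ultimately have "(\<rho> / w) * real N - 2 * \<rho> * ?r \<le> f N" using f by (simp add: algebra_simps)
    then have "(\<rho> / w) * real N - d * real N \<le> f N" using elim(2) by linarith
    then show ?case by (simp add: d_def algebra_simps)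
  qed
qed

context quadratic_progression
begin

text \<open>The box has X = s Y, Y = s h and X0 = \<kappa> Y, with s fixed and n tending to
  infinity. The three summands in the denominator of \<rho> stem from the three parts of
  \<open>moment_bound\<close>. For w near its lower bound, \<rho> / w tends to 1 / (1 + 768 / P) as
  s grows.\<close>

lemma values_many:
  fixes s :: nat and \<kappa> :: int and A \<rho> \<rho>' w :: real
  defines "\<kappa> \<equiv> \<bar>a2\<bar> + \<bar>a3\<bar> + 1"
  defines "A \<equiv> real_of_int (q * a1)"
  defines "\<rho> \<equiv> 4 * A * (real s)^2 * ((real s)^2 - (real_of_int \<kappa>)^2)^2 / ((real s + 8)^2 + 768 * (real s)^2 / real P + real s)"
  assumes s: "s \<ge> 4" "int s > \<kappa>" and \<rho>': "\<rho>' < \<rho>" and w: "w > 4 * A * real s ^ 4 + 4 * real_of_int q * real_of_int \<kappa> * (real s)^2"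
  shows "eventually (\<lambda>n. \<forall>N. w * (real n)^2 \<le> real N \<longrightarrow>
    \<rho>' * (real n)^2 \<le> real (card ({1..int N} \<inter> range F))) sequentially"
proof -
  define A' where "A' = q * a1"
  have A': "A' > 0" "A = real_of_int A'" using q_pos a1_pos by (auto simp: A'_def A_def)
  define S where "S = int s"
  \<comment> \<open>Chosen with K h = C, so that C < (K + 1)(h + 1) although h is only a small
    fraction of Y.\<close>
  define K where "K = 3 * A' * S^2"
  define J where "J = \<bar>l2\<bar> + \<bar>l3\<bar> + 2 * q * (\<bar>a2\<bar> + \<bar>a3\<bar>)"
  define cK where "cK = (2 * K + 1) * ((2 * K + 1) * (4 * K * J + 1))"
  \<comment> \<open>Chosen so that the leading part of the exceptional term is exactly 64 A' s^7
    n^6, a factor of about s below the main term.\<close>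
  define T where "T = 72 * A' * cK * S^2"
  define cT where "cT = T * (T * ((2 * T * J + 1) * (2 * T * J + 1)))"
  have S: "S \<ge> 4" "S > \<kappa>" using s by (auto simp: S_def)
  have \<kappa>: "\<kappa> \<ge> 1" by (simp add: \<kappa>_def)
  have K0: "K \<ge> 0" using A' by (simp add: K_def)
  have J0: "J \<ge> 0" using q_pos by (simp add: J_def)
  have cK: "cK > 0" using K0 J0 by (simp add: cK_def add_nonneg_pos)
  have T: "T > 0" using A' cK S by (simp add: T_def)
  define X Y h C X0 where "X = (\<lambda>n::nat. 2 * S^2 * int n)" and "Y = (\<lambda>n::nat. 2 * (S * int n))"
    and "h = (\<lambda>n::nat. 2 * int n)" and "C = (\<lambda>n::nat. 6 * A' * S^2 * int n)" and "X0 = (\<lambda>n. \<kappa> * Y n)"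
  define U where "U = (\<lambda>n. A' * (X n)^2 + \<bar>l1\<bar> * X n + (\<bar>l2\<bar> + \<bar>l3\<bar>) * Y n + q * (\<bar>a2\<bar> + \<bar>a3\<bar>) * (Y n)^2)"
  define n0 where "n0 = nat (\<bar>l1\<bar> + \<bar>l2\<bar> + \<bar>l3\<bar> + A' + K + 1)"
  have sm: "second_moment l1 l2 l3 a1 a2 a3 q P (X0 n) (X n) (Y n) (S * int n) (h n) K T J (C n)"
    and pos: "\<And>u. u \<in> {X0 n + 1..X n} \<times> {1..Y n} \<times> {1..Y n} \<Longrightarrow> F u \<ge> 1 \<and> F u \<le> U n"
    if n: "n \<ge> n0" for n
  proof -
    have n1: "int n \<ge> \<bar>l1\<bar> + \<bar>l2\<bar> + \<bar>l3\<bar> + A' + K + 1" using n unfolding n0_def by linarith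
    then have npos: "int n \<ge> 1" "int n \<ge> \<bar>l1\<bar>" "int n \<ge> \<bar>l2\<bar> + \<bar>l3\<bar>" "int n \<ge> A'" "int n \<ge> K" "int n \<ge> \<bar>l1\<bar> + \<bar>l2\<bar> + \<bar>l3\<bar> + 1" using A' K0 by linarith+
    have Sn: "int n \<le> S * int n" using S npos mult_right_mono[of 1 S "int n"] by simp
    have Yn: "Y n \<ge> 2 * int n" "Y n > 0" using Sn npos by (auto simp: Y_def)
    have XY: "X n = S * Y n" by (simp add: X_def Y_def power2_eq_square)
    have X0X: "X0 n < X n" unfolding X0_def XY using S Yn by simp
    have YX0: "Y n \<le> X0 n" unfolding X0_def using \<kappa> Yn mult_right_mono[of 1 \<kappa> "Y n"] by simp
    have "A' * X0 n \<ge> 1 * X0 n" using A' YX0 Yn by (intro mult_right_mono) auto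
    then have AX0: "A' * X0 n \<ge> Y n" using YX0 by simp
    have cb: "\<bar>l + q * a * t\<bar> \<le> J * Y n" if "t \<in> {2..2 * Y n}" "\<bar>l\<bar> + 2 * q * \<bar>a\<bar> \<le> J" for l a t
    proof -
      have "\<bar>l + q * a * t\<bar> \<le> \<bar>l\<bar> + \<bar>q * a * t\<bar>" by (rule abs_triangle_ineq)
      moreover have "\<bar>q * a * t\<bar> = q * \<bar>a\<bar> * t" using q_pos that by (simp add: abs_mult)
      moreover have "q * \<bar>a\<bar> * t \<le> q * \<bar>a\<bar> * (2 * Y n)" using q_pos that by (intro mult_left_mono) auto
      moreover have "\<bar>l\<bar> * 1 \<le> \<bar>l\<bar> * Y n" using Yn by (intro mult_left_mono) auto
      ultimately have "\<bar>l + q * a * t\<bar> \<le> \<bar>l\<bar> * Y n + q * \<bar>a\<bar> * (2 * Y n)" by linarith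
      also have "\<dots> = (\<bar>l\<bar> + 2 * q * \<bar>a\<bar>) * Y n" by (simp add: algebra_simps)
      also have "\<dots> \<le> J * Y n" using Yn that(2) by (intro mult_right_mono) auto
      finally show ?thesis .
    qed
    have c2b: "\<bar>c2 t\<bar> \<le> J * Y n" if "t \<in> {2..2 * Y n}" for t
      unfolding c2_def by (rule cb[OF that]) (use q_pos in \<open>simp add: J_def algebra_simps\<close>)
    have c3b: "\<bar>c3 t\<bar> \<le> J * Y n" if "t \<in> {2..2 * Y n}" for t
      unfolding c3_def by (rule cb[OF that]) (use q_pos in \<open>simp add: J_def algebra_simps\<close>)
    show "second_moment l1 l2 l3 a1 a2 a3 q P (X0 n) (X n) (Y n) (S * int n) (h n) K T J (C n)"
    proof unfold_locales
      show "0 \<le> X0 n" "X0 n < X n" "Y n \<le> X n" using YX0 X0X Yn by auto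
      show "Y n = 2 * (S * int n)" by (simp add: Y_def)
      show "0 < S * int n" using Sn npos by linarith
      show "q * a1 \<le> Y n" using npos Yn by (simp add: A'_def)
      have "c1 (2 * X0 n) = l1 + 2 * (A' * X0 n)" by (simp add: c1_def A'_def)
      then show "Y n \<le> c1 (2 * X0 n)" using AX0 npos Yn by linarith
      have "A' * X n \<ge> A' * X0 n" using X0X A' by (intro mult_left_mono) auto
      then have "l1 \<le> A' * X n" using AX0 npos Yn by linarith
      moreover have "c1 (2 * X n) = l1 + 2 * (A' * X n)" "C n = 3 * (A' * X n)" by (auto simp: c1_def A'_def C_def X_def)
      ultimately show "c1 (2 * X n) \<le> C n" by linarith
      show "K \<le> h n" "4 * h n \<le> Y n" using npos S mult_right_mono[of 4 S "int n"] by (auto simp: h_def Y_def)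
      have "C n = K * (2 * int n)" by (simp add: C_def K_def)
      also have "\<dots> < (K + 1) * (2 * int n + 1)" using K0 npos by (simp add: algebra_simps)
      finally show "C n < (K + 1) * (h n + 1)" by (simp add: h_def)
    qed (use J0 c2b c3b K0 T in auto)
    show "F u \<ge> 1 \<and> F u \<le> U n"
      if u: "u \<in> {X0 n + 1..X n} \<times> {1..Y n} \<times> {1..Y n}" for u
    proof -
      obtain u1 u2 u3 where ud: "u = (u1, u2, u3)" by (metis surj_pair)
      have r: "X0 n < u1" "u1 \<le> X n" "1 \<le> u2" "u2 \<le> Y n" "1 \<le> u3" "u3 \<le> Y n" using u unfolding ud by auto
      have lin: "\<bar>l * v\<bar> \<le> \<bar>l\<bar> * Z" if "0 \<le> v" "v \<le> Z" for l v Z :: int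
        unfolding abs_mult using that by (intro mult_left_mono) auto
      have sqr: "\<bar>a * v^2\<bar> \<le> \<bar>a\<bar> * Z^2" if "0 \<le> v" "v \<le> Z" for a v Z :: int
        unfolding abs_mult using that by (intro mult_mono) (auto intro: power_mono)
      have E: "\<bar>l2 * u2 + l3 * u3 + q * (a2 * u2^2 + a3 * u3^2)\<bar> \<le> (\<bar>l2\<bar> + \<bar>l3\<bar>) * Y n + q * (\<bar>a2\<bar> + \<bar>a3\<bar>) * (Y n)^2"
      proof -
        have "\<bar>a2 * u2^2 + a3 * u3^2\<bar> \<le> (\<bar>a2\<bar> + \<bar>a3\<bar>) * (Y n)^2"
          using sqr[of u2 "Y n" a2] sqr[of u3 "Y n" a3] r unfolding distrib_right by linarith
        then have "\<bar>q * (a2 * u2^2 + a3 * u3^2)\<bar> \<le> q * ((\<bar>a2\<bar> + \<bar>a3\<bar>) * (Y n)^2)"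
          unfolding abs_mult using q_pos by simp
        moreover have "\<bar>l2 * u2\<bar> \<le> \<bar>l2\<bar> * Y n" "\<bar>l3 * u3\<bar> \<le> \<bar>l3\<bar> * Y n" using lin r by auto
        ultimately show ?thesis unfolding distrib_right mult.assoc by linarith
      qed
      have Fu: "F u = A' * u1^2 + l1 * u1 + (l2 * u2 + l3 * u3 + q * (a2 * u2^2 + a3 * u3^2))"
        unfolding ud F_def A'_def by (simp add: algebra_simps)
      have "A' * u1^2 \<le> A' * (X n)^2" using A' r YX0 Yn by (intro mult_left_mono power_mono) auto
      moreover have "\<bar>l1 * u1\<bar> \<le> \<bar>l1\<bar> * X n" using lin r YX0 Yn by auto
      ultimately have up: "F u \<le> A' * (X n)^2 + \<bar>l1\<bar> * X n + ((\<bar>l2\<bar> + \<bar>l3\<bar>) * Y n + q * (\<bar>a2\<bar> + \<bar>a3\<bar>) * (Y n)^2)"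
        unfolding Fu using E by linarith
      \<comment> \<open>Positivity of F for u1 > \<kappa> Y: in \<kappa>^2 = \<kappa> + \<kappa>
        (\<kappa> - 1) the second part outweighs |a2| + |a3| and thus the other quadratic terms,
        while the first part, with n large, outweighs the linear ones.\<close>
      have "q * 1 \<le> A'" unfolding A'_def using q_pos a1_pos by (intro mult_left_mono) auto
      then have qA: "q * u1^2 \<le> A' * u1^2" by (intro mult_right_mono) auto
      have qY: "Y n \<le> q * Y n" using q_pos Yn mult_right_mono[of 1 q "Y n"] by simp
      have nn: "0 \<le> q * Y n - \<bar>l1\<bar>" using qY Yn npos by linarith
      have "Y n \<le> q * X0 n" using q_pos YX0 Yn mult_mono[of 1 q "Y n" "X0 n"] by simp
      then have "X0 n * (q * X0 n - \<bar>l1\<bar>) \<le> u1 * (q * u1 - \<bar>l1\<bar>)"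
        using r YX0 Yn npos q_pos by (intro mult_mono) auto
      moreover have "X0 n * (q * X0 n - \<bar>l1\<bar>) = \<kappa> * (Y n * (q * Y n - \<bar>l1\<bar>)) + q * (\<kappa> * (\<kappa> - 1)) * (Y n)^2"
        unfolding X0_def by (simp add: algebra_simps power2_eq_square)
      moreover have "Y n * (\<bar>l2\<bar> + \<bar>l3\<bar> + 1) \<le> Y n * (q * Y n - \<bar>l1\<bar>)"
        using qY Yn npos by (intro mult_left_mono) linarith+
      moreover have "1 * (Y n * (q * Y n - \<bar>l1\<bar>)) \<le> \<kappa> * (Y n * (q * Y n - \<bar>l1\<bar>))"
        using \<kappa> nn Yn by (intro mult_right_mono mult_nonneg_nonneg) auto
      moreover have "q * (\<bar>a2\<bar> + \<bar>a3\<bar>) * (Y n)^2 \<le> q * (\<kappa> * (\<kappa> - 1)) * (Y n)^2"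
        using q_pos \<kappa> mult_right_mono[of 1 \<kappa> "\<kappa> - 1"] by (intro mult_right_mono mult_left_mono) (auto simp: \<kappa>_def)
      ultimately have "(\<bar>l2\<bar> + \<bar>l3\<bar>) * Y n + 1 + q * (\<bar>a2\<bar> + \<bar>a3\<bar>) * (Y n)^2 \<le> u1 * (q * u1 - \<bar>l1\<bar>)"
        using Yn unfolding distrib_left by (simp only: mult_1 mult_1_right mult.commute[of "Y n"] distrib_right)
      also have "\<dots> \<le> A' * u1^2 - \<bar>l1\<bar> * u1" using qA by (simp add: algebra_simps power2_eq_square)
      also have "\<dots> \<le> A' * u1^2 + l1 * u1" using lin[of u1 u1 l1] r YX0 Yn by auto
      finally have "F u \<ge> 1" unfolding Fu using E by linarith
      then show ?thesis using up by (simp add: U_def)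
    qed
  qed
  define a r \<kappa>r k t where "a = real_of_int A'" and "r = real s" and "\<kappa>r = real_of_int \<kappa>"
    and "k = real_of_int cK" and "t = real_of_int T"
  have t: "t = 72 * a * k * r^2" by (simp add: t_def T_def a_def k_def r_def S_def)
  have rpos: "a > 0" "r \<ge> 4" "k > 0" "t > 0" "r > \<kappa>r" "\<kappa>r \<ge> 1" "A = a"
    using A' S cK T \<kappa> by (auto simp: a_def r_def k_def t_def S_def \<kappa>r_def)
  \<comment> \<open>With these parameters \<open>moment_bound\<close> is exactly \<alpha> n^6 +
    \<beta> n^5. In the same way \<delta> and \<upsilon> below are the leading coefficients of the
    first moment and of the bound for the largest value; the primed constants disappear in the
    limit.\<close>
  define \<alpha> where "\<alpha> = 64 * a * r ^ 6 * ((r + 8)^2 + 768 * r^2 / P + r)"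
  define \<beta> where "\<beta> = 32 * r ^ 4 * (r + 8)^2 * (a + \<bar>l1\<bar>)
    + 64 * (36 * a^2 * r ^ 4) * r^2 * (4 * r^2 + 6 * a * r^2)
    + 36 * a^2 * r ^ 4 * (64 * k * r ^ 4 + 16 * real_of_int cT * r ^ 4)"
  have mb: "second_moment.moment_bound l1 a1 q P (X n) (Y n) (S * int n) (h n) K T J (C n) = \<alpha> * real n ^ 6 + \<beta> * real n ^ 5"
    if "n \<ge> n0" for n
  proof -
    let ?x = "real n"
    have qa: "real_of_int q * real_of_int a1 = a" by (simp add: a_def A'_def)
    let ?X = "2 * r^2 * ?x" and ?Y = "2 * (r * ?x)" and ?C = "6 * a * r^2 * ?x"
    let ?H = "2 * (r * ?x) * (r * ?x) + 4 * (2 * ?x) * ?Y"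
    have e1: "4 * ((a * (?X * (?X + 1)) + \<bar>l1\<bar> * ?X) * (?H * ?H))
      = 64 * a * r ^ 6 * (r + 8)^2 * ?x ^ 6 + 32 * r ^ 4 * (r + 8)^2 * (a + \<bar>l1\<bar>) * ?x ^ 5"
      by algebra
    have e2: "?C * (4 * ?Y^2) * (64 * ?X * ?Y^2 * ip + ?C * (4 * (2 * ?X + ?C)))
      = 64 * a * r ^ 6 * (768 * r^2 * ip) * ?x ^ 6 + 64 * (36 * a^2 * r ^ 4) * r^2 * (4 * r^2 + 6 * a * r^2) * ?x ^ 5" for ip
      by algebra
    have e3: "?C^2 * (k * (8 * ?X * ?Y) * (?Y * (?Y + t) / t) + real_of_int cT * (2 * ?X) * ?Y^2)
      = 64 * a * r ^ 6 * r * ?x ^ 6 + 36 * a^2 * r ^ 4 * (64 * k * r ^ 4 + 16 * real_of_int cT * r ^ 4) * ?x ^ 5"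
    proof -
      have "?Y * (?Y + t) / t = 4 * r^2 * ?x^2 * (1 / t) + ?Y"
        using rpos by (simp add: field_simps power2_eq_square)
      moreover have "a * k * r^2 * 72 * (1 / t) = 1" using t rpos by simp
      moreover have "?C^2 * (k * (8 * ?X * ?Y) * z + c * (2 * ?X) * ?Y^2)
        = 64 * a * r ^ 6 * r * ?x ^ 6 + 36 * a^2 * r ^ 4 * (64 * k * r ^ 4 + 16 * c * r ^ 4) * ?x ^ 5"
        if "z = 4 * r^2 * ?x^2 * i + ?Y" "a * k * r^2 * 72 * i = 1" for z i c :: real
        using that by algebra
      ultimately show ?thesis by blast
    qed
    have "second_moment.moment_bound l1 a1 q P (X n) (Y n) (S * int n) (h n) K T J (C n)
      = 4 * ((a * (?X * (?X + 1)) + \<bar>l1\<bar> * ?X) * (?H * ?H))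
      + ?C * (4 * ?Y^2) * (64 * ?X * ?Y^2 * (1 / P) + ?C * (4 * (2 * ?X + ?C)))
      + ?C^2 * (k * (8 * ?X * ?Y) * (?Y * (?Y + t) / t) + real_of_int cT * (2 * ?X) * ?Y^2)"
      unfolding second_moment.moment_bound_def[OF sm[OF that]]
      by (simp add: X_def Y_def h_def C_def cK_def k_def cT_def t_def r_def S_def qa flip: a_def)
    also have "\<dots> = \<alpha> * ?x ^ 6 + \<beta> * ?x ^ 5"
      unfolding e1 e2 e3 \<alpha>_def \<beta>_def by (simp add: algebra_simps)
    finally show ?thesis .
  qed
  define \<delta> where "\<delta> = 16 * a * r ^ 4 * (r^2 - \<kappa>r^2)"
  define \<delta>' where "\<delta>' = 8 * real_of_int l1 * r ^ 3 * (r - \<kappa>r)"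
  have D: "real_of_int (((l1 * X n + q * a1 * (X n)^2) - (l1 * X0 n + q * a1 * (X0 n)^2)) * (Y n)^2) = \<delta> * real n ^ 4 + \<delta>' * real n ^ 3" for n
  proof -
    have qa: "real_of_int q * real_of_int a1 = a" by (simp add: a_def A'_def)
    have "real_of_int (((l1 * X n + q * a1 * (X n)^2) - (l1 * X0 n + q * a1 * (X0 n)^2)) * (Y n)^2)
      = ((l1 * (2 * r^2 * real n) + a * (2 * r^2 * real n)^2) - (l1 * (\<kappa>r * (2 * (r * real n))) + a * (\<kappa>r * (2 * (r * real n)))^2)) * (2 * (r * real n))^2"
      by (simp add: X_def X0_def Y_def r_def S_def \<kappa>r_def qa)
    also have "\<dots> = \<delta> * real n ^ 4 + \<delta>' * real n ^ 3" unfolding \<delta>_def \<delta>'_def by algebra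
    finally show ?thesis .
  qed
  define \<upsilon> where "\<upsilon> = 4 * a * r ^ 4 + 4 * real_of_int q * \<kappa>r * r^2"
  define \<upsilon>' where "\<upsilon>' = 2 * real_of_int \<bar>l1\<bar> * r^2 + 2 * (real_of_int \<bar>l2\<bar> + real_of_int \<bar>l3\<bar>) * r"
  have Ub: "real_of_int (U n) \<le> \<upsilon> * real n ^ 2 + \<upsilon>' * real n ^ 1" for n
  proof -
    have "U n \<le> A' * (X n)^2 + \<bar>l1\<bar> * X n + (\<bar>l2\<bar> + \<bar>l3\<bar>) * Y n + q * \<kappa> * (Y n)^2" (is "_ \<le> ?R")
      using q_pos by (simp add: U_def \<kappa>_def mult_right_mono)
    then have "real_of_int (U n) \<le> real_of_int ?R" by (simp only: of_int_le_iff)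
    also have "\<dots> = a * (2 * r^2 * real n)^2 + real_of_int \<bar>l1\<bar> * (2 * r^2 * real n) + (real_of_int \<bar>l2\<bar> + real_of_int \<bar>l3\<bar>) * (2 * (r * real n)) + real_of_int q * \<kappa>r * (2 * (r * real n))^2"
      by (simp add: X_def Y_def r_def S_def \<kappa>r_def a_def)
    also have "\<dots> = \<upsilon> * real n ^ 2 + \<upsilon>' * real n ^ 1" unfolding \<upsilon>_def \<upsilon>'_def by algebra
    finally show ?thesis .
  qed
  have lim: "(\<lambda>n. (x * real n ^ Suc i + y * real n ^ i) / real n ^ Suc i) \<longlonglongrightarrow> x" for x y i
  proof -
    have "(\<lambda>n. x + y / real n) \<longlonglongrightarrow> x + 0" by (intro tendsto_intros lim_const_over_n)
    moreover have "eventually (\<lambda>n. x + y / real n = (x * real n ^ Suc i + y * real n ^ i) / real n ^ Suc i) sequentially"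
      using eventually_gt_at_top[of 0] by eventually_elim (simp add: field_simps)
    ultimately show ?thesis by (simp add: tendsto_cong)
  qed
  have Bpos: "0 < (r + 8)^2 + 768 * r^2 / P + r" using rpos by (intro add_nonneg_pos) auto
  have apos: "\<alpha> > 0" using rpos Bpos by (simp add: \<alpha>_def)
  \<comment> \<open>So \<rho> is the limit of the squared first moment over
    \<open>moment_bound\<close>, divided by n^2.\<close>
  have \<rho>eq: "\<rho> * \<alpha> = \<delta>^2"
  proof -
    have "\<rho> = 4 * a * r^2 * (r^2 - \<kappa>r^2)^2 / ((r + 8)^2 + 768 * r^2 / P + r)"
      unfolding \<rho>_def using rpos(7) by (simp add: r_def \<kappa>r_def)
    then have "\<rho> * ((r + 8)^2 + 768 * r^2 / P + r) = 4 * a * r^2 * (r^2 - \<kappa>r^2)^2" using Bpos by simp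
    moreover have "\<rho> * \<alpha> = 64 * a * r ^ 6 * (\<rho> * ((r + 8)^2 + 768 * r^2 / P + r))" by (simp add: \<alpha>_def)
    ultimately show ?thesis unfolding \<delta>_def by algebra
  qed
  have ev1: "eventually (\<lambda>n. (\<alpha> * real n ^ 6 + \<beta> * real n ^ 5) / real n ^ 6 > 0) sequentially"
    using order_tendstoD(1)[OF lim[of \<alpha> 5 \<beta>] apos] by simp
  have "(\<lambda>n. ((\<delta> * real n ^ Suc 3 + \<delta>' * real n ^ 3) / real n ^ Suc 3)^2
      - \<rho>' * ((\<alpha> * real n ^ Suc 5 + \<beta> * real n ^ 5) / real n ^ Suc 5)) \<longlonglongrightarrow> \<delta>^2 - \<rho>' * \<alpha>"
    by (intro tendsto_intros lim)
  moreover have "\<delta>^2 - \<rho>' * \<alpha> > 0" using \<rho>' apos unfolding \<rho>eq[symmetric] by simp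
  ultimately have ev2: "eventually (\<lambda>n. ((\<delta> * real n ^ 4 + \<delta>' * real n ^ 3) / real n ^ 4)^2
      - \<rho>' * ((\<alpha> * real n ^ 6 + \<beta> * real n ^ 5) / real n ^ 6) > 0) sequentially"
    using order_tendstoD(1) by fastforce
  have "\<upsilon> < w" using w rpos(7) by (simp add: \<upsilon>_def r_def \<kappa>r_def)
  then have ev3: "eventually (\<lambda>n. (\<upsilon> * real n ^ 2 + \<upsilon>' * real n ^ 1) / real n ^ 2 < w) sequentially"
    using order_tendstoD(2)[OF lim[of \<upsilon> 1 \<upsilon>']] by (simp add: numeral_2_eq_2)
  show ?thesis using ev1 ev2 ev3 eventually_ge_at_top[of "max n0 1"]
  proof eventually_elim
    case (elim n)
    have n: "n \<ge> n0" "real n > 0" using elim(4) by auto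
    interpret sm: second_moment l1 l2 l3 a1 a2 a3 q P "X0 n" "X n" "Y n" "S * int n" "h n" K T J "C n"
      by (rule sm[OF n(1)])
    let ?mb = "\<alpha> * real n ^ 6 + \<beta> * real n ^ 5" and ?D = "\<delta> * real n ^ 4 + \<delta>' * real n ^ 3"
    have mbpos: "?mb > 0" using elim(1) n by (simp add: zero_less_divide_iff)
    have low: "?D^2 \<le> real (card (F ` sm.Box)) * ?mb"
      using sm.card_values_lower unfolding D mb[OF n(1)] .
    have "\<rho>' * (?mb / real n ^ 6) < (?D / real n ^ 4)^2" using elim(2) by simp
    then have "real n ^ 8 * (\<rho>' * (?mb / real n ^ 6)) < real n ^ 8 * (?D / real n ^ 4)^2"
      using n(2) by (intro mult_strict_left_mono) auto
    also have "real n ^ 8 * (?D / real n ^ 4)^2 = ?D^2"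
    proof -
      have "real n ^ 8 = (real n ^ 4)^2" by (simp flip: power_mult)
      then show ?thesis using n by (simp add: power_divide)
    qed
    also have "real n ^ 8 * (\<rho>' * (?mb / real n ^ 6)) = (\<rho>' * (real n)^2) * ?mb"
    proof -
      have "real n ^ 8 * (\<rho>' * (?mb / real n ^ 6)) = (real n)^2 * (real n ^ 6 * (\<rho>' * (?mb / real n ^ 6)))"
        unfolding mult.assoc[symmetric] by (simp flip: power_add)
      also have "real n ^ 6 * (\<rho>' * (?mb / real n ^ 6)) = \<rho>' * ?mb" using n by simp
      finally show ?thesis by (simp only: mult_ac)
    qed
    finally have "(\<rho>' * (real n)^2) * ?mb \<le> real (card (F ` sm.Box)) * ?mb" using low by linarith
    then have cnt: "\<rho>' * (real n)^2 \<le> real (card (F ` sm.Box))" using mbpos by simp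
    show ?case
    proof (intro allI impI)
      fix N assume N: "w * (real n)^2 \<le> real N"
      have "\<upsilon> * real n ^ 2 + \<upsilon>' * real n ^ 1 < w * (real n)^2" using elim(3) n by (simp add: divide_less_eq)
      then have "real_of_int (U n) \<le> real_of_int (int N)"
        using Ub[of n] N by simp
      then have UN: "U n \<le> int N"
        by (simp only: of_int_le_iff)
      have "F ` sm.Box \<subseteq> {1..int N} \<inter> range F"
      proof (rule image_subsetI)
        fix u assume "u \<in> sm.Box"
        then have "F u \<ge> 1 \<and> F u \<le> U n"
          unfolding sm.Box_def by (rule pos[OF n(1)])
        then show "F u \<in> {1..int N} \<inter> range F" using UN by auto
      qed
      then have "card (F ` sm.Box) \<le> card ({1..int N} \<inter> range F)" by (intro card_mono) auto
      then show "\<rho>' * (real n)^2 \<le> real (card ({1..int N} \<inter> range F))" using cnt by linarith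
    qed
  qed
qed

theorem values_lower_density:
  assumes c: "c < 1 / (1 + 768 / P)"
  shows "eventually (\<lambda>N. c * real N \<le> real (card ({1..int N} \<inter> range F))) sequentially"
proof -
  define \<kappa> where "\<kappa> = real_of_int (\<bar>a2\<bar> + \<bar>a3\<bar> + 1)"
  define p where "p = 768 / real P"
  have p: "p \<ge> 0" by (simp add: p_def)
  define A where "A = real_of_int (q * a1)"
  have A: "A > 0" "real_of_int q \<le> A" using q_pos a1_pos by (auto simp: A_def mult_le_cancel_left1 simp flip: of_int_mult)
  have \<kappa>: "\<kappa> \<ge> 1" by (simp add: \<kappa>_def)
  \<comment> \<open>The quotient \<rho> / w written in powers of 1/s, so that its limit can be read
    off; \<open>ratio\<close> below is the identification.\<close>
  let ?\<theta> = "\<lambda>s :: nat. (1 - (\<kappa> / real s)^2)^2 / (((1 + 8 / real s)^2 + p + 1 / real s) * (1 + \<kappa> * (1 / real s)^2))"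
  have "(?\<theta> \<longlongrightarrow> (1 - 0^2)^2 / (((1 + 0)^2 + p + 0) * (1 + \<kappa> * 0^2))) sequentially"
    using p by (intro tendsto_intros lim_const_over_n lim_1_over_n) auto
  then have "eventually (\<lambda>s. c < ?\<theta> s) sequentially"
    using c by (intro order_tendstoD(1)[where y = "1 / (1 + p)"]) (auto simp: p_def)
  moreover have "eventually (\<lambda>s. real s > \<kappa>) sequentially"
    using filterlim_real_sequentially by (simp add: filterlim_at_top_dense)
  ultimately have "eventually (\<lambda>s. s \<ge> 4 \<and> real s > \<kappa> \<and>
      c < ?\<theta> s) sequentially"
    using eventually_ge_at_top[of 4] by eventually_elim auto
  then obtain s :: nat where s: "s \<ge> 4" "real s > \<kappa>"
    and cs: "c < ?\<theta> s"
    unfolding eventually_sequentially by blast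
  let ?r = "real s"
  define B where "B = (?r + 8)^2 + p * ?r^2 + ?r"
  have r: "?r > 0" using s by simp
  have B: "B > 0" unfolding B_def using r p by (intro add_nonneg_pos) auto
  define \<rho> where "\<rho> = 4 * A * ?r^2 * (?r^2 - \<kappa>^2)^2 / B"
  define w where "w = 4 * A * (?r ^ 4 + \<kappa> * ?r^2)"
  have w: "w > 0" unfolding w_def using A r \<kappa> by (intro mult_pos_pos add_pos_nonneg) auto
  have \<rho>pos: "\<rho> > 0"
  proof -
    have "\<kappa>^2 < ?r^2" using s \<kappa> by (intro power_strict_mono) auto
    then show ?thesis unfolding \<rho>_def using A r B by simp
  qed
  have ratio: "?\<theta> s = \<rho> / w"
  proof -
    have 1: "1 - (\<kappa> / ?r)^2 = (?r^2 - \<kappa>^2) / ?r^2" using r by (simp add: field_simps)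
    have 2: "(1 + 8 / ?r)^2 + p + 1 / ?r = B / ?r^2" unfolding B_def using r by (simp add: field_simps power2_eq_square)
    have 3: "1 + \<kappa> * (1 / ?r)^2 = (?r ^ 4 + \<kappa> * ?r^2) / (?r^2)^2" using r by (simp add: field_simps power2_eq_square power4_eq_xxxx)
    have q4: "?r ^ 4 + \<kappa> * ?r^2 > 0" using r \<kappa> by (intro add_pos_nonneg) auto
    have "(E / R)^2 / ((B / R) * (Q / R^2)) = (4 * A * R * E^2 / B) / (4 * A * Q)" if "R > 0" "Q > 0" for E R Q
      using that B A by (simp add: field_simps power2_eq_square)
    from this[of "?r^2" "?r ^ 4 + \<kappa> * ?r^2" "?r^2 - \<kappa>^2"] show ?thesis
      unfolding 1 2 3 \<rho>_def w_def using r q4 by simp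
  qed
  then have "c < \<rho> / w" using cs by simp
  \<comment> \<open>Both inequalities required by \<open>values_many\<close> are strict, so \<rho>
    and w are shifted by a small e.\<close>
  moreover have "((\<lambda>e. (\<rho> - e) / (w + e)) \<longlongrightarrow> (\<rho> - 0) / (w + 0)) (at_right 0)"
    using w by (intro tendsto_intros) auto
  ultimately have "eventually (\<lambda>e. c < (\<rho> - e) / (w + e)) (at_right 0)"
    using order_tendstoD(1) by fastforce
  moreover have "eventually (\<lambda>e. 0 < e \<and> e < \<rho>) (at_right 0)"
    using \<rho>pos by (intro eventually_conj eventually_at_right_less eventually_at_right[THEN iffD2]) auto
  ultimately have "eventually (\<lambda>e. c < (\<rho> - e) / (w + e) \<and> 0 < e \<and> e < \<rho>) (at_right 0)" by eventually_elim auto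
  then obtain e where e: "c < (\<rho> - e) / (w + e)" "0 < e" "e < \<rho>"
    using eventually_happens'[OF trivial_limit_at_right_real] by blast
  show ?thesis
  proof (rule eventually_sqrt_scale[where \<rho> = "\<rho> - e" and w = "w + e"])
    have \<rho>eq: "\<rho> = 4 * real_of_int (q * a1) * (real s)^2 * ((real s)^2 - (real_of_int (\<bar>a2\<bar> + \<bar>a3\<bar> + 1))^2)^2 / ((real s + 8)^2 + 768 * (real s)^2 / real P + real s)"
      (is "_ = ?\<rho>")
      unfolding \<rho>_def B_def A_def \<kappa>_def p_def by simp
    have "4 * real_of_int q * \<kappa> * ?r^2 \<le> 4 * A * \<kappa> * ?r^2" using A \<kappa> by (intro mult_right_mono) auto
    then have weq: "4 * A * ?r ^ 4 + 4 * real_of_int q * \<kappa> * ?r^2 < w + e" unfolding w_def using e(2) by (simp add: algebra_simps)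
    show "eventually (\<lambda>n. \<forall>N. (w + e) * (real n)^2 \<le> real N \<longrightarrow> (\<rho> - e) * (real n)^2 \<le> real (card ({1..int N} \<inter> range F))) sequentially"
    proof (rule values_many[where s = s])
      show "4 \<le> s" using s by simp
      show "int s > \<bar>a2\<bar> + \<bar>a3\<bar> + 1" using s(2) unfolding \<kappa>_def by linarith
      show "\<rho> - e < ?\<rho>"
        using e \<rho>eq by simp
      show "4 * real_of_int (q * a1) * real s ^ 4 + 4 * real_of_int q * real_of_int (\<bar>a2\<bar> + \<bar>a3\<bar> + 1) * (real s)^2 < w + e"
        using weq by (simp add: A_def \<kappa>_def)
    qed
  qed (use w e in auto)
qed

end

section \<open>Legendre descent and a missed residue class\<close>

text \<open>Isotropy over the p-adic numbers in terms of integers: for prime p, primitive zeros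
  modulo all powers of p amount to a nontrivial p-adic zero, by compactness.\<close>

definition isotropic_at :: "int \<Rightarrow> int \<Rightarrow> int \<Rightarrow> int \<Rightarrow> bool" where
  "isotropic_at p a b c \<longleftrightarrow> (\<forall>k. \<exists>x y z. \<not> (p dvd x \<and> p dvd y \<and> p dvd z) \<and> p ^ k dvd a * x^2 + b * y^2 + c * z^2)"

text \<open>Each step of the induction divides the vector by p and the value by p^2.\<close>

lemma anisotropic_power_dvd:
  fixes p a b c :: int
  assumes "p > 0"
    and an: "\<And>x y z. p ^ k dvd a * x^2 + b * y^2 + c * z^2 \<Longrightarrow> p dvd x \<and> p dvd y \<and> p dvd z"
    and "p ^ (k + 2 * i) dvd a * x^2 + b * y^2 + c * z^2"
  shows "p ^ Suc i dvd x \<and> p ^ Suc i dvd y \<and> p ^ Suc i dvd z"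
  using assms(3)
proof (induction i arbitrary: x y z)
  case 0
  then show ?case using an by simp
next
  case (Suc i)
  have "p ^ k dvd a * x^2 + b * y^2 + c * z^2" using Suc.prems by (rule dvd_trans[OF le_imp_power_dvd, rotated]) simp
  from an[OF this] obtain x' y' z' where v: "x = p * x'" "y = p * y'" "z = p * z'" by blast
  have "a * x^2 + b * y^2 + c * z^2 = p^2 * (a * x'^2 + b * y'^2 + c * z'^2)"
    by (simp add: v power_mult_distrib algebra_simps)
  moreover have "p ^ (k + 2 * Suc i) = p^2 * p ^ (k + 2 * i)" by (simp flip: power_add)
  ultimately have "p^2 * p ^ (k + 2 * i) dvd p^2 * (a * x'^2 + b * y'^2 + c * z'^2)"
    using Suc.prems by (simp only:)
  then have "p ^ (k + 2 * i) dvd a * x'^2 + b * y'^2 + c * z'^2" using assms(1) by simp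
  from Suc.IH[OF this] show ?case by (simp add: v)
qed

text \<open>Rational substitutions spoil primitivity, but only up to a power p^j independent of k,
  and that is enough by \<open>anisotropic_power_dvd\<close>.\<close>

lemma isotropic_atI:
  assumes "p > 0"
    and j: "\<And>k. \<exists>x y z. \<not> (p ^ j dvd x \<and> p ^ j dvd y \<and> p ^ j dvd z) \<and> p ^ k dvd a * x^2 + b * y^2 + c * z^2"
  shows "isotropic_at p a b c"
proof (rule ccontr)
  assume "\<not> isotropic_at p a b c"
  then obtain k where k: "\<And>x y z. p ^ k dvd a * x^2 + b * y^2 + c * z^2 \<Longrightarrow> p dvd x \<and> p dvd y \<and> p dvd z"
    unfolding isotropic_at_def by blast
  obtain x y z where v: "\<not> (p ^ j dvd x \<and> p ^ j dvd y \<and> p ^ j dvd z)" "p ^ (k + 2 * j) dvd a * x^2 + b * y^2 + c * z^2"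
    using j by blast
  have "p ^ Suc j dvd x \<and> p ^ Suc j dvd y \<and> p ^ Suc j dvd z"
    by (rule anisotropic_power_dvd[OF assms(1) k v(2)])
  moreover have "p ^ j dvd p ^ Suc j" by simp
  ultimately show False using v(1) dvd_trans by blast
qed

text \<open>A crude explicit exponent, from n < 2^n, that takes the place of the p-adic valuation in
  the arguments below.\<close>

lemma prime_power_exceeds:
  fixes p m :: int
  assumes "prime p" "m \<noteq> 0"
  shows "\<not> p ^ Suc (nat \<bar>m\<bar>) dvd m"
proof
  assume "p ^ Suc (nat \<bar>m\<bar>) dvd m"
  then have "p ^ Suc (nat \<bar>m\<bar>) \<le> \<bar>m\<bar>" using assms(2) by (intro zdvd_imp_le) auto
  moreover have "(2::int) ^ Suc (nat \<bar>m\<bar>) \<le> p ^ Suc (nat \<bar>m\<bar>)"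
    using prime_ge_2_int[OF assms(1)] by (intro power_mono) auto
  moreover have "int (nat \<bar>m\<bar>) < 2 ^ nat \<bar>m\<bar>" using less_exp[of "nat \<bar>m\<bar>"] by (metis of_nat_less_iff of_nat_power of_nat_numeral)
  moreover have "int (nat \<bar>m\<bar>) = \<bar>m\<bar>" by simp
  ultimately show False unfolding power_Suc by linarith
qed

text \<open>Modulo p the equation reads z^2 = a x^2, and x is invertible: otherwise p divides x and
  z, hence p^2 divides b y^2, and p divides y because it divides b only once.\<close>

lemma square_residue_at_prime:
  fixes p a b :: int
  assumes p: "prime p" and iso: "isotropic_at p (- a) (- b) 1" and pb: "p dvd b" "\<not> p^2 dvd b"
  shows "\<exists>t. p dvd t^2 - a"
proof -
  obtain x y z where v: "\<not> (p dvd x \<and> p dvd y \<and> p dvd z)" "p ^ 2 dvd - a * x^2 + - b * y^2 + 1 * z^2"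
    using iso unfolding isotropic_at_def by blast
  have "p dvd p ^ 2" by (simp add: power2_eq_square)
  then have "p dvd - a * x^2 + - b * y^2 + 1 * z^2" using v(2) by (rule dvd_trans)
  then have "p dvd (- a * x^2 + - b * y^2 + 1 * z^2) + b * y^2" using dvd_mult2[OF pb(1)] by (rule dvd_add)
  then have zx: "p dvd z^2 - a * x^2" by (simp add: algebra_simps)
  have px: "\<not> p dvd x"
  proof
    assume px: "p dvd x"
    then have "p dvd (z^2 - a * x^2) + a * x^2" using zx by (intro dvd_add) (auto simp: power2_eq_square)
    then have pz: "p dvd z" using p by (simp add: prime_dvd_power_iff)
    have "p^2 dvd z^2" "p^2 dvd a * x^2" using px pz by (auto intro: dvd_mult)
    then have "p^2 dvd z^2 - a * x^2 - (- a * x^2 + - b * y^2 + 1 * z^2)" using v(2) by (intro dvd_diff)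
    then have pby: "p^2 dvd b * y^2" by (simp add: algebra_simps)
    obtain b' where b': "b = p * b'" using pb(1) by blast
    have "p * p dvd p * (b' * y^2)" using pby by (simp add: b' power2_eq_square mult.assoc)
    then have "p dvd b' * y^2" using p by simp
    moreover have "\<not> p dvd b'" using pb(2) by (auto simp: b' power2_eq_square)
    ultimately have "p dvd y" using p by (simp add: prime_dvd_mult_iff prime_dvd_power_iff)
    then show False using v(1) px pz by simp
  qed
  then have "coprime x p" using p by (metis coprime_commute prime_imp_coprime)
  then obtain u w where uw: "u * x + w * p = 1" using bezout_int[of x p] by (auto simp: coprime_iff_gcd_eq_1)
  have "(z * u)^2 - a = u^2 * (z^2 - a * x^2) - a * (1 - (u * x)^2)" by (simp add: algebra_simps power_mult_distrib)
  also have "1 - (u * x)^2 = p * (w * (1 + u * x))"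
  proof -
    have "1 - (u * x)^2 = (1 - u * x) * (1 + u * x)" by (simp add: power2_eq_square algebra_simps)
    also have "1 - u * x = w * p" using uw by simp
    finally show ?thesis by (simp add: mult_ac)
  qed
  finally have "(z * u)^2 - a = u^2 * (z^2 - a * x^2) - a * (p * (w * (1 + u * x)))" .
  moreover have "p dvd u^2 * (z^2 - a * x^2) - a * (p * (w * (1 + u * x)))"
    using zx by (intro dvd_diff) (auto intro: dvd_mult)
  ultimately show ?thesis by metis
qed

text \<open>The Chinese remainder theorem, one prime factor at a time.\<close>

lemma square_residue_squarefree:
  fixes a b :: int
  assumes "b \<noteq> 0" "\<And>p. prime p \<Longrightarrow> \<not> p^2 dvd b" "\<And>p. prime p \<Longrightarrow> p dvd b \<Longrightarrow> \<exists>t. p dvd t^2 - a"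
  shows "\<exists>t. b dvd t^2 - a"
  using assms
proof (induction "nat \<bar>b\<bar>" arbitrary: b rule: less_induct)
  case less
  show ?case
  proof (cases "is_unit b")
    case True
    then show ?thesis by (meson dvd_trans one_dvd)
  next
    case False
    then obtain p where p: "prime p" "p dvd b" using prime_divisor_exists less.prems(1) by blast
    obtain b' where b': "b = p * b'" using p by blast
    have nb': "\<not> p dvd b'" using less.prems(2)[OF p(1)] by (auto simp: b' power2_eq_square)
    have b'0: "b' \<noteq> 0" using less.prems(1) by (simp add: b')
    have p2: "p \<ge> 2" using prime_ge_2_int p by simp
    have "nat \<bar>b'\<bar> < nat \<bar>b\<bar>"
    proof -
      have "\<bar>b\<bar> = p * \<bar>b'\<bar>" using p2 by (simp add: b' abs_mult)
      moreover have "2 * \<bar>b'\<bar> \<le> p * \<bar>b'\<bar>" using p2 by (intro mult_right_mono) auto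
      ultimately show ?thesis using b'0 by linarith
    qed
    moreover have "\<not> r^2 dvd b'" if "prime r" for r using less.prems(2)[OF that] by (auto simp: b')
    moreover have "\<exists>t. r dvd t^2 - a" if "prime r" "r dvd b'" for r using less.prems(3)[OF that(1)] that by (auto simp: b')
    ultimately obtain t' where t': "b' dvd t'^2 - a" using less.hyps[of b'] b'0 by blast
    obtain s where s: "p dvd s^2 - a" using less.prems(3) p by blast
    have cop: "coprime p b'" using p nb' by (simp add: prime_imp_coprime)
    then obtain u v where uv: "u * p + v * b' = 1" using bezout_int[of p b'] by (auto simp: coprime_iff_gcd_eq_1)
    define t where "t = t' * (u * p) + s * (v * b')"
    have "v * b' = 1 - u * p" using uv by simp
    then have "t = t' * (u * p) + s * (1 - u * p)" unfolding t_def by (simp only:)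
    then have "t - s = p * (u * (t' - s))" by (simp add: algebra_simps)
    then have "t^2 - a = p * (u * (t' - s)) * (t + s) + (s^2 - a)" by (metis (no_types) add_diff_eq diff_add_cancel square_diff_square_factored power2_eq_square mult.commute)
    then have d1: "p dvd t^2 - a" using s by (metis dvd_add dvd_mult2 dvd_triv_left mult.assoc)
    have "u * p = 1 - v * b'" using uv by simp
    then have "t = t' * (1 - v * b') + s * (v * b')" unfolding t_def by (simp only:)
    then have "t - t' = b' * (v * (s - t'))" by (simp add: algebra_simps)
    then have "t^2 - a = b' * (v * (s - t')) * (t + t') + (t'^2 - a)" by (metis (no_types) add_diff_eq diff_add_cancel square_diff_square_factored power2_eq_square mult.commute)
    then have d2: "b' dvd t^2 - a" using t' by (metis dvd_add dvd_mult2 dvd_triv_left mult.assoc)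
    have "b dvd t^2 - a" unfolding b' using d1 d2 cop by (rule divides_mult)
    then show ?thesis ..
  qed
qed

lemma small_square_root_residue:
  fixes a b t :: int
  assumes "b \<noteq> 0" "b dvd t^2 - a"
  obtains t' where "b dvd t'^2 - a" "2 * \<bar>t'\<bar> \<le> \<bar>b\<bar>"
proof -
  define r where "r = t mod \<bar>b\<bar>"
  have r: "0 \<le> r" "r < \<bar>b\<bar>" using assms(1) by (auto simp: r_def)
  have shift: "b dvd t'^2 - a" if "b dvd t' - t" for t'
  proof -
    have "t'^2 - a = (t' - t) * (t' + t) + (t^2 - a)" by (simp add: power2_eq_square algebra_simps)
    then show ?thesis using dvd_add[OF dvd_mult2[OF that] assms(2)] by (simp only:)
  qed
  have br: "b dvd r - t" unfolding r_def by (metis abs_dvd_iff dvd_minus_mod dvd_diff_commute)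
  show ?thesis
  proof (cases "2 * r \<le> \<bar>b\<bar>")
    case True
    then show ?thesis using that[of r] shift[OF br] r by simp
  next
    case False
    have "b dvd (r - \<bar>b\<bar>) - t" using dvd_diff[OF br, of "\<bar>b\<bar>"] by (simp add: algebra_simps)
    then show ?thesis using that[of "r - \<bar>b\<bar>"] shift False r by simp
  qed
qed

section \<open>The descent on z^2 = a x^2 + b y^2\<close>

definition soluble :: "int \<Rightarrow> int \<Rightarrow> bool" where
  "soluble a b \<longleftrightarrow> (\<exists>x y z. (x, y, z) \<noteq> (0, 0, 0) \<and> z^2 = a * x^2 + b * y^2)"

lemma soluble_swap: "soluble a b \<Longrightarrow> soluble b a"
proof -
  assume "soluble a b"
  then obtain x y z where v: "(x, y, z) \<noteq> (0, 0, 0)" "z^2 = a * x^2 + b * y^2" unfolding soluble_def by blast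
  then have "(y, x, z) \<noteq> (0, 0, 0)" "z^2 = b * y^2 + a * x^2" by auto
  then show ?thesis unfolding soluble_def by blast
qed

lemma isotropic_at_swap: "isotropic_at p a b c \<Longrightarrow> isotropic_at p b a c"
  unfolding isotropic_at_def
proof
  fix k
  assume "\<forall>k. \<exists>x y z. \<not> (p dvd x \<and> p dvd y \<and> p dvd z) \<and> p ^ k dvd a * x^2 + b * y^2 + c * z^2"
  then obtain x y z where "\<not> (p dvd x \<and> p dvd y \<and> p dvd z)" "p ^ k dvd a * x^2 + b * y^2 + c * z^2" by blast
  then have "\<not> (p dvd y \<and> p dvd x \<and> p dvd z) \<and> p ^ k dvd b * y^2 + a * x^2 + c * z^2"
    by (auto simp: add_ac)
  then show "\<exists>x y z. \<not> (p dvd x \<and> p dvd y \<and> p dvd z) \<and> p ^ k dvd b * x^2 + a * y^2 + c * z^2" by blast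
qed

text \<open>The substitution x -> r x relates the two forms over the rationals; the exponent
  \<open>j\<close> bounds how far it can spoil primitivity.\<close>

lemma square_factor_reduction:
  fixes a b r :: int
  assumes r: "prime r" and a: "a = r^2 * a'"
    and iso: "\<And>p. prime p \<Longrightarrow> isotropic_at p (- a) (- b) 1"
  shows "\<And>p. prime p \<Longrightarrow> isotropic_at p (- a') (- b) 1" and "soluble a' b \<Longrightarrow> soluble a b"
proof -
  fix p :: int assume p: "prime p"
  define j where "j = Suc (nat \<bar>r\<bar>)"
  have r0: "r \<noteq> 0" using r by auto
  show "isotropic_at p (- a') (- b) 1"
  proof (rule isotropic_atI[where j = j])
    fix k
    obtain x y z where v: "\<not> (p dvd x \<and> p dvd y \<and> p dvd z)" "p ^ k dvd - a * x^2 + - b * y^2 + 1 * z^2"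
      using iso[OF p] unfolding isotropic_at_def by blast
    have "\<not> (p ^ j dvd r * x \<and> p ^ j dvd y \<and> p ^ j dvd z)"
    proof
      assume d: "p ^ j dvd r * x \<and> p ^ j dvd y \<and> p ^ j dvd z"
      have pj: "p dvd p ^ j" by (simp add: j_def)
      have "p dvd y" "p dvd z" using d dvd_trans[OF pj] by blast+
      then have "\<not> p dvd x" using v(1) by simp
      then have "coprime (p ^ j) x" using p by (simp add: prime_imp_coprime)
      then have "p ^ j dvd r" using d by (simp add: coprime_dvd_mult_left_iff)
      then show False using prime_power_exceeds[OF p r0] unfolding j_def by simp
    qed
    moreover have "- a * x^2 + - b * y^2 + 1 * z^2 = - a' * (r * x)^2 + - b * y^2 + 1 * z^2"
      by (simp add: a power_mult_distrib)
    ultimately show "\<exists>x y z. \<not> (p ^ j dvd x \<and> p ^ j dvd y \<and> p ^ j dvd z) \<and> p ^ k dvd - a' * x^2 + - b * y^2 + 1 * z^2"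
      using v(2) by metis
  qed (use p prime_gt_0_int in auto)
next
  assume "soluble a' b"
  then obtain x y z where v: "(x, y, z) \<noteq> (0, 0, 0)" "z^2 = a' * x^2 + b * y^2" unfolding soluble_def by blast
  have r0: "r \<noteq> 0" using r by auto
  have "(r * z)^2 = a * x^2 + b * (r * y)^2" by (simp add: a power_mult_distrib v(2) algebra_simps)
  moreover have "(x, r * y, r * z) \<noteq> (0, 0, 0)" using v r0 by auto
  ultimately show "soluble a b" unfolding soluble_def by blast
qed

text \<open>If \<open>t\<^sup>2 - a = b b'\<close> then \<open>b b'\<close> is a norm from \<open>\<rat>(\<surd>a)\<close>, so \<open>b\<close> and \<open>b'\<close> are interchangeable.\<close>

lemma norm_reduction:
  fixes a b b' t :: int
  assumes t: "t^2 - a = b * b'" and bb': "b \<noteq> 0" "b' \<noteq> 0"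
    and iso: "\<And>p. prime p \<Longrightarrow> isotropic_at p (- a) (- b) 1"
  shows "\<And>p. prime p \<Longrightarrow> isotropic_at p (- a) (- b') 1" and "soluble a b' \<Longrightarrow> soluble a b"
proof -
  \<comment> \<open>Norm of the product (t + sqrt a)(z + x sqrt a).\<close>
  have norm: "(t * z + a * x)^2 - a * (t * x + z)^2 = (t^2 - a) * (z^2 - a * x^2)" for x z
    by (simp add: power2_eq_square algebra_simps)
  \<comment> \<open>Multiplication by the conjugate t - sqrt a, which inverts the substitution up to
    the factor b b'.\<close>
  have undo: "t * (t * z + a * x) - a * (t * x + z) = b * b' * z" "t * (t * x + z) - (t * z + a * x) = b * b' * x" for x z
    unfolding t[symmetric] by (simp_all add: power2_eq_square algebra_simps)
  {
    fix p :: int assume p: "prime p"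
    define j where "j = Suc (nat \<bar>b * b'\<bar>)"
    show "isotropic_at p (- a) (- b') 1"
    proof (rule isotropic_atI[where j = j])
      fix k
      obtain x y z where v: "\<not> (p dvd x \<and> p dvd y \<and> p dvd z)" "p ^ k dvd - a * x^2 + - b * y^2 + 1 * z^2"
        using iso[OF p] unfolding isotropic_at_def by blast
      let ?Z = "t * z + a * x" and ?X = "t * x + z" and ?Y = "b * y"
      have "- a * ?X^2 + - b' * ?Y^2 + 1 * ?Z^2 = (?Z^2 - a * ?X^2) - b' * ?Y^2" by simp
      also have "\<dots> = b * b' * (- a * x^2 + - b * y^2 + 1 * z^2)" unfolding norm t by (simp add: power2_eq_square algebra_simps)
      finally have "p ^ k dvd - a * ?X^2 + - b' * ?Y^2 + 1 * ?Z^2" using v(2) by simp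
      moreover have "\<not> (p ^ j dvd ?X \<and> p ^ j dvd ?Y \<and> p ^ j dvd ?Z)"
      proof
        assume d: "p ^ j dvd ?X \<and> p ^ j dvd ?Y \<and> p ^ j dvd ?Z"
        have "p ^ j dvd t * ?Z - a * ?X" "p ^ j dvd t * ?X - ?Z" using d by (auto intro!: dvd_diff dvd_mult simp del: mult.commute)
        then have d': "p ^ j dvd b * b' * z" "p ^ j dvd b * b' * x" unfolding undo .
        have "p ^ j dvd b' * ?Y" using d by (intro dvd_mult[of _ ?Y]) simp
        then have d'': "p ^ j dvd b * b' * y" by (simp add: mult_ac)
        have "p ^ j dvd b * b'" if "\<not> p dvd w" "p ^ j dvd b * b' * w" for w
        proof -
          have "coprime (p ^ j) w" using p that by (simp add: prime_imp_coprime)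
          then show ?thesis using that by (simp add: coprime_dvd_mult_left_iff)
        qed
        then have "p ^ j dvd b * b'" using v(1) d' d'' by blast
        then show False using prime_power_exceeds[OF p, of "b * b'"] bb' unfolding j_def by simp
      qed
      ultimately show "\<exists>x y z. \<not> (p ^ j dvd x \<and> p ^ j dvd y \<and> p ^ j dvd z) \<and> p ^ k dvd - a * x^2 + - b' * y^2 + 1 * z^2"
        by blast
    qed (use p prime_gt_0_int in auto)
  next
    assume "soluble a b'"
    then obtain x y z where v: "(x, y, z) \<noteq> (0, 0, 0)" "z^2 = a * x^2 + b' * y^2" unfolding soluble_def by blast
    let ?Z = "t * z + a * x" and ?X = "t * x + z" and ?Y = "b' * y"
    have "?Z^2 - a * ?X^2 = b * b' * (z^2 - a * x^2)" unfolding norm t by simp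
    also have "\<dots> = b * ?Y^2" unfolding v(2) by (simp add: power2_eq_square)
    finally have "?Z^2 = a * ?X^2 + b * ?Y^2" by simp
    moreover have "(?X, ?Y, ?Z) \<noteq> (0, 0, 0)"
    proof
      assume "(?X, ?Y, ?Z) = (0, 0, 0)"
      then have "?X = 0" "?Z = 0" "y = 0" using bb' by auto
      then have "b * b' * z = 0" "b * b' * x = 0" using undo(1)[of z x] undo(2)[of x z] by simp_all
      then show False using v(1) bb' \<open>y = 0\<close> by simp
    qed
    ultimately show "soluble a b" unfolding soluble_def by blast
  }
qed

text \<open>Square factors are stripped first. For squarefree b and |a| <= |b|, a square root t of a
  modulo b with 2 |t| <= |b| gives t^2 - a = b b' with 4 |b'| <= |b| + 4, so b' is smaller than b
  once |b| >= 2.\<close>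

theorem legendre_descent:
  fixes a b :: int
  assumes "a \<noteq> 0" "b \<noteq> 0" "\<And>p. prime p \<Longrightarrow> isotropic_at p (- a) (- b) 1"
  shows "soluble a b"
  using assms
proof (induction "nat (\<bar>a\<bar> + \<bar>b\<bar>)" arbitrary: a b rule: less_induct)
  case less
  \<comment> \<open>Stated for an arbitrary pair because it is applied to (a, b) or (b, a),
    according to which entry has the larger absolute value.\<close>
  have sqf: "soluble a b" if ih: "\<And>a' b'. nat (\<bar>a'\<bar> + \<bar>b'\<bar>) < nat (\<bar>a\<bar> + \<bar>b\<bar>) \<Longrightarrow> a' \<noteq> 0 \<Longrightarrow> b' \<noteq> 0 \<Longrightarrow>
      (\<And>p. prime p \<Longrightarrow> isotropic_at p (- a') (- b') 1) \<Longrightarrow> soluble a' b'"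
    and nz: "a \<noteq> 0" "b \<noteq> 0" and iso: "\<And>p. prime p \<Longrightarrow> isotropic_at p (- a) (- b) 1"
    and sq: "\<And>r. prime r \<Longrightarrow> \<not> r^2 dvd b" and le: "\<bar>a\<bar> \<le> \<bar>b\<bar>" for a b
  proof (cases "\<bar>b\<bar> = 1")
    case True
    then have "\<bar>a\<bar> = 1" using le nz by linarith
    then consider "a = 1" | "b = 1" | "a = -1" "b = -1" using True by linarith
    then show ?thesis
    proof cases
      case 1
      have "(1, 0, 1) \<noteq> (0::int, 0::int, 0::int) \<and> 1^2 = a * 1^2 + b * 0^2" using 1 by simp
      then show ?thesis unfolding soluble_def by blast
    next
      case 2
      have "(0, 1, 1) \<noteq> (0::int, 0::int, 0::int) \<and> 1^2 = a * 0^2 + b * 1^2" using 2 by simp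
      then show ?thesis unfolding soluble_def by blast
    next
      case 3
      \<comment> \<open>Here 4 divides x^2 + y^2 + z^2 with x, y, z not all even, which the squares
        modulo 4 exclude.\<close>
      have "isotropic_at 2 (- a) (- b) 1" by (rule iso) simp
      then obtain x y z where v: "\<not> (2 dvd x \<and> 2 dvd y \<and> 2 dvd z)" "(2::int) ^ 2 dvd - a * x^2 + - b * y^2 + 1 * z^2"
        unfolding isotropic_at_def by blast
      then have d: "4 dvd x^2 + y^2 + z^2" using 3 by simp
      have m4: "w^2 mod 4 = (if even w then 0 else 1)" for w :: int
      proof (cases "even w")
        case True
        then obtain u where "w = 2 * u" by blast
        then show ?thesis by (simp add: power_mult_distrib)
      next
        case False
        then obtain u where "w = 2 * u + 1" by (rule oddE)
        then have "w^2 = 4 * (u^2 + u) + 1" by (simp add: power2_eq_square algebra_simps)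
        then obtain k where "w^2 = 4 * k + 1" by blast
        then show ?thesis using False by simp
      qed
      have "even x \<and> even y \<and> even z"
        using d m4[of x] m4[of y] m4[of z] by (cases "even x"; cases "even y"; cases "even z"; simp; presburger)
      then show ?thesis using v(1) by blast
    qed
  next
    case False
    then have b2: "\<bar>b\<bar> \<ge> 2" using nz by linarith
    obtain t0 where "b dvd t0^2 - a"
      using square_residue_squarefree[OF nz(2) sq, of a] square_residue_at_prime[OF _ iso _ sq] by blast
    then obtain t where t: "b dvd t^2 - a" "2 * \<bar>t\<bar> \<le> \<bar>b\<bar>" using small_square_root_residue[OF nz(2)] by blast
    then obtain b' where b': "t^2 - a = b * b'" by blast
    show ?thesis
    proof (cases "b' = 0")
      case True
      have "(1, 0, t) \<noteq> (0::int, 0::int, 0::int) \<and> t^2 = a * 1^2 + b * 0^2" using b' True by simp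
      then show ?thesis unfolding soluble_def by blast
    next
      case False
      have "\<bar>b'\<bar> < \<bar>b\<bar>"
      proof -
        have "4 * (\<bar>b\<bar> * \<bar>b'\<bar>) = 4 * \<bar>t^2 - a\<bar>" by (simp add: b' abs_mult)
        also have "\<dots> \<le> (2 * \<bar>t\<bar>)^2 + 4 * \<bar>a\<bar>"
          using abs_triangle_ineq4[of "t^2" a] by (simp add: power_mult_distrib)
        also have "\<dots> \<le> \<bar>b\<bar>^2 + 4 * \<bar>b\<bar>" using t(2) le by (intro add_mono power_mono) auto
        also have "\<dots> = \<bar>b\<bar> * (\<bar>b\<bar> + 4)" by (simp add: power2_eq_square algebra_simps)
        finally have "\<bar>b\<bar> * (4 * \<bar>b'\<bar>) \<le> \<bar>b\<bar> * (\<bar>b\<bar> + 4)" by (simp add: mult_ac)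
        then have "4 * \<bar>b'\<bar> \<le> \<bar>b\<bar> + 4" using nz(2) by simp
        then show ?thesis using b2 by linarith
      qed
      then have "soluble a b'"
        using norm_reduction(1)[OF b' nz(2) False iso] nz False by (intro ih) auto
      then show ?thesis using norm_reduction(2)[OF b' nz(2) False iso] by blast
    qed
  qed
  have sqred: "\<exists>a'. a = r^2 * a' \<and> a' \<noteq> 0 \<and> \<bar>a'\<bar> < \<bar>a\<bar>" if ra: "prime r" "r^2 dvd a" "a \<noteq> 0" for a r :: int
  proof -
    obtain a' where a': "a = r^2 * a'" using ra(2) by blast
    have "r \<ge> 2" using prime_ge_2_int ra(1) by simp
    then have "2^2 \<le> r^2" by (intro power_mono) auto
    then have "4 * \<bar>a'\<bar> \<le> \<bar>a\<bar>" by (simp add: a' abs_mult mult_right_mono)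
    then show ?thesis using a' ra(3) by (intro exI[of _ a']) auto
  qed
  show ?case
  proof (cases "\<exists>r. prime r \<and> (r^2 dvd a \<or> r^2 dvd b)")
    case True
    then consider r where "prime r" "r^2 dvd a" | r where "prime r" "r^2 dvd b" by blast
    then show ?thesis
    proof cases
      case 1
      then obtain a' where a': "a = r^2 * a'" "a' \<noteq> 0" "\<bar>a'\<bar> < \<bar>a\<bar>" using sqred less.prems by blast
      have "soluble a' b"
        by (rule less.hyps) (use a' less.prems square_factor_reduction(1)[OF 1(1) a'(1) less.prems(3)] in auto)
      then show ?thesis using square_factor_reduction(2)[OF 1(1) a'(1) less.prems(3)] by blast
    next
      case 2
      then obtain b' where b': "b = r^2 * b'" "b' \<noteq> 0" "\<bar>b'\<bar> < \<bar>b\<bar>" using sqred less.prems by blast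
      have iso: "\<And>p. prime p \<Longrightarrow> isotropic_at p (- b) (- a) 1" using less.prems(3) isotropic_at_swap by blast
      have "soluble b' a"
        by (rule less.hyps) (use b' less.prems square_factor_reduction(1)[OF 2(1) b'(1) iso] in auto)
      then show ?thesis using square_factor_reduction(2)[OF 2(1) b'(1) iso] soluble_swap by blast
    qed
  next
    case False
    show ?thesis
    proof (cases "\<bar>a\<bar> \<le> \<bar>b\<bar>")
      case True
      show ?thesis
      proof (rule sqf)
        show "soluble a' b'" if "nat (\<bar>a'\<bar> + \<bar>b'\<bar>) < nat (\<bar>a\<bar> + \<bar>b\<bar>)" "a' \<noteq> 0" "b' \<noteq> 0"
          "\<And>p. prime p \<Longrightarrow> isotropic_at p (- a') (- b') 1" for a' b'
          using that by (rule less.hyps)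
        show "\<not> r^2 dvd b" if "prime r" for r using False that by blast
      qed (rule less.prems True; assumption?)+
    next
      case ba: False
      have "soluble b a"
      proof (rule sqf)
        show "soluble a' b'" if "nat (\<bar>a'\<bar> + \<bar>b'\<bar>) < nat (\<bar>b\<bar> + \<bar>a\<bar>)" "a' \<noteq> 0" "b' \<noteq> 0"
          "\<And>p. prime p \<Longrightarrow> isotropic_at p (- a') (- b') 1" for a' b'
          by (rule less.hyps) (use that in \<open>auto simp: add.commute\<close>)
        show "\<not> r^2 dvd a" if "prime r" for r using False that by blast
        show "isotropic_at p (- b) (- a) 1" if "prime p" for p using less.prems(3)[OF that] by (rule isotropic_at_swap)
        show "b \<noteq> 0" "a \<noteq> 0" by (rule less.prems)+
        show "\<bar>b\<bar> \<le> \<bar>a\<bar>" using ba by simp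
      qed
      then show ?thesis by (rule soluble_swap)
    qed
  qed
qed

text \<open>Multiplied by a, the form becomes (a x)^2 + a b y^2 + a c z^2, to which the descent
  applies with the pair - a b, - a c.\<close>

corollary anisotropic_at_some_prime:
  fixes a b c :: int
  assumes nz: "a \<noteq> 0" "b \<noteq> 0" "c \<noteq> 0"
    and an: "\<And>x y z. a * x^2 + b * y^2 + c * z^2 = 0 \<Longrightarrow> x = 0 \<and> y = 0 \<and> z = 0"
  obtains p k where "prime p" "\<And>x y z. p ^ k dvd a * x^2 + b * y^2 + c * z^2 \<Longrightarrow> p dvd x \<and> p dvd y \<and> p dvd z"
proof (rule ccontr)
  note witness = that
  assume nt: "\<not> thesis"
  have iso: "isotropic_at p a b c" if p: "prime p" for p
  proof (rule ccontr)
    assume "\<not> isotropic_at p a b c"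
    then obtain k where "\<And>x y z. p ^ k dvd a * x^2 + b * y^2 + c * z^2 \<Longrightarrow> p dvd x \<and> p dvd y \<and> p dvd z"
      unfolding isotropic_at_def by blast
    then have thesis by (rule witness[OF p])
    then show False using nt by contradiction
  qed
  have "soluble (- (a * b)) (- (a * c))"
  proof (rule legendre_descent)
    fix p :: int assume p: "prime p"
    define j where "j = Suc (nat \<bar>a\<bar>)"
    show "isotropic_at p (- (- (a * b))) (- (- (a * c))) 1"
    proof (rule isotropic_atI[where j = j])
      fix k
      obtain x y z where v: "\<not> (p dvd x \<and> p dvd y \<and> p dvd z)" "p ^ k dvd a * x^2 + b * y^2 + c * z^2"
        using iso[OF p] unfolding isotropic_at_def by blast
      have "- (- (a * b)) * y^2 + - (- (a * c)) * z^2 + 1 * (a * x)^2 = a * (a * x^2 + b * y^2 + c * z^2)"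
        by (simp add: power2_eq_square algebra_simps)
      then have "p ^ k dvd - (- (a * b)) * y^2 + - (- (a * c)) * z^2 + 1 * (a * x)^2" using v(2) by simp
      moreover have "\<not> (p ^ j dvd y \<and> p ^ j dvd z \<and> p ^ j dvd a * x)"
      proof
        assume d: "p ^ j dvd y \<and> p ^ j dvd z \<and> p ^ j dvd a * x"
        have pj: "p dvd p ^ j" by (simp add: j_def)
        have "p dvd y" "p dvd z" using d dvd_trans[OF pj] by blast+
        then have "\<not> p dvd x" using v(1) by simp
        then have "coprime (p ^ j) x" using p by (simp add: prime_imp_coprime)
        then have "p ^ j dvd a" using d by (simp add: coprime_dvd_mult_left_iff)
        then show False using prime_power_exceeds[OF p nz(1)] unfolding j_def by simp
      qed
      ultimately show "\<exists>x y z. \<not> (p ^ j dvd x \<and> p ^ j dvd y \<and> p ^ j dvd z) \<and>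
          p ^ k dvd - (- (a * b)) * x^2 + - (- (a * c)) * y^2 + 1 * z^2" by blast
    qed (use p prime_gt_0_int in auto)
  qed (use nz in auto)
  then obtain x y z where v: "(x, y, z) \<noteq> (0, 0, 0)" "z^2 = - (a * b) * x^2 + - (a * c) * y^2"
    unfolding soluble_def by blast
  have "a * z^2 + b * (a * x)^2 + c * (a * y)^2 = 0" unfolding v(2) by (simp add: power2_eq_square algebra_simps)
  from an[OF this] show False using v(1) nz by auto
qed

text \<open>If v = (x, y, z) has value - a b c w^2 with w nonzero, its orthogonal complement has
  discriminant -1 up to squares and is a hyperbolic plane. The vector on the left is, up to the sign
  of its third coordinate, an isotropic vector of that plane.\<close>

lemma isotropic_vector_identity:
  fixes a b c w x y z :: int
  shows "a * (b * y^2 + c * z^2)^2 + b * (a * (c * w * z - x * y))^2 + c * (a * (x * z + b * w * y))^2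
    = a * (b * y^2 + c * z^2) * (a * x^2 + b * y^2 + c * z^2 + a * b * c * w^2)"
  by algebra

text \<open>A form representing minus its discriminant over the \<open>p\<close>-adic numbers is isotropic there.\<close>

lemma unrepresented_class:
  fixes p a b c w :: int
  assumes p: "prime p" and nz: "a * b * c * w \<noteq> 0"
    and an: "\<And>x y z. p ^ k dvd a * x^2 + b * y^2 + c * z^2 \<Longrightarrow> p dvd x \<and> p dvd y \<and> p dvd z"
  obtains K where "\<And>x y z n. a * x^2 + b * y^2 + c * z^2 = w^2 * n \<Longrightarrow> \<not> p ^ K dvd n + a * b * c"
proof
  define m where "m = 2 * w^2 * (a * b * c)"
  have m0: "m \<noteq> 0" using nz by (simp add: m_def)
  define i where "i = nat \<bar>m\<bar>"
  fix x y z n assume n: "a * x^2 + b * y^2 + c * z^2 = w^2 * n"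
  show "\<not> p ^ (k + 2 * i) dvd n + a * b * c"
  proof
    assume d: "p ^ (k + 2 * i) dvd n + a * b * c"
    have pp: "p > 0" using p prime_gt_0_int by blast
    have "a * x^2 + b * y^2 + c * z^2 + a * b * c * w^2 = w^2 * (n + a * b * c)" unfolding n by (simp add: algebra_simps)
    then have d': "p ^ (k + 2 * i) dvd a * x^2 + b * y^2 + c * z^2 + a * b * c * w^2" using d by simp
    have "p ^ (k + 2 * i) dvd a * (b * y^2 + c * z^2)^2 + b * (a * (c * w * z - x * y))^2 + c * (a * (x * z + b * w * y))^2"
      unfolding isotropic_vector_identity using d' by (rule dvd_mult)
    then have s1: "p ^ Suc i dvd b * y^2 + c * z^2"
      using anisotropic_power_dvd[where a = a and b = b and c = c, OF pp an] by blast
    \<comment> \<open>The cyclic shifts of the identity treat the other two pairwise sums. The three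
      sums add up to 2 w^2 n, so p^(i+1) divides both 2 w^2 n and n + a b c, and therefore m, which
      is impossible by the choice of i.\<close>
    have "b * (c * z^2 + a * x^2)^2 + c * (b * (a * w * x - y * z))^2 + a * (b * (y * x + c * w * z))^2
      = b * (c * z^2 + a * x^2) * (a * x^2 + b * y^2 + c * z^2 + a * b * c * w^2)"
      using isotropic_vector_identity[of b c z a x w y] by (simp add: algebra_simps)
    then have "p ^ (k + 2 * i) dvd a * (b * (y * x + c * w * z))^2 + b * (c * z^2 + a * x^2)^2 + c * (b * (a * w * x - y * z))^2"
      using dvd_mult[OF d', of "b * (c * z^2 + a * x^2)"] by (simp add: algebra_simps)
    then have s2: "p ^ Suc i dvd c * z^2 + a * x^2"
      using anisotropic_power_dvd[where a = a and b = b and c = c, OF pp an] by blast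
    have "c * (a * x^2 + b * y^2)^2 + a * (c * (b * w * y - z * x))^2 + b * (c * (z * y + a * w * x))^2
      = c * (a * x^2 + b * y^2) * (a * x^2 + b * y^2 + c * z^2 + a * b * c * w^2)"
      using isotropic_vector_identity[of c a x b y w z] by (simp add: algebra_simps)
    then have "p ^ (k + 2 * i) dvd a * (c * (b * w * y - z * x))^2 + b * (c * (z * y + a * w * x))^2 + c * (a * x^2 + b * y^2)^2"
      using dvd_mult[OF d', of "c * (a * x^2 + b * y^2)"] by (simp add: algebra_simps)
    then have s3: "p ^ Suc i dvd a * x^2 + b * y^2"
      using anisotropic_power_dvd[where a = a and b = b and c = c, OF pp an] by blast
    have "p ^ Suc i dvd (b * y^2 + c * z^2) + (c * z^2 + a * x^2) + (a * x^2 + b * y^2)"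
      by (rule dvd_add[OF dvd_add[OF s1 s2] s3])
    moreover have "(b * y^2 + c * z^2) + (c * z^2 + a * x^2) + (a * x^2 + b * y^2) = 2 * w^2 * n" using n by simp
    ultimately have e1: "p ^ Suc i dvd 2 * w^2 * n" by simp
    show False
    proof (cases "k + 2 * i \<ge> Suc i")
      case True
      then have "p ^ Suc i dvd n + a * b * c" using d by (meson dvd_trans le_imp_power_dvd)
      then have "p ^ Suc i dvd 2 * w^2 * (n + a * b * c) - 2 * w^2 * n" using e1 by (intro dvd_diff dvd_mult[of _ "n + a * b * c"])
      then have "p ^ Suc i dvd m" by (simp add: m_def algebra_simps)
      then show False using prime_power_exceeds[OF p m0] unfolding i_def by simp
    next
      case False
      then have "i = 0" by simp
      then show False using m0 by (simp add: i_def)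
    qed
  qed
qed

section \<open>Density of the values of an anisotropic form\<close>

text \<open>
  The frame behind the definition consists of pairwise orthogonal integer vectors \<open>e\<^sub>i\<close> with \<open>f(e\<^sub>i) = a\<^sub>i\<close>
  whose span contains \<open>N \<int>\<^sup>3\<close>. For \<open>v = (x, y, z)\<close>, \<open>u\<^sub>i\<close> are the coordinates of \<open>N v\<close> and \<open>b\<^sub>i\<close> is the polar form of
  \<open>f\<close> at \<open>(v, e\<^sub>i)\<close>; the last clause is evaluated at \<open>v + m \<Sum> w\<^sub>i e\<^sub>i\<close>.
\<close>

definition orthogonal_frame :: "ternary_form \<Rightarrow> int \<Rightarrow> int \<Rightarrow> int \<Rightarrow> int \<Rightarrow> bool" where
  "orthogonal_frame f N a1 a2 a3 \<longleftrightarrow> (\<forall>x y z :: int. \<exists>b1 b2 b3 u1 u2 u3.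
     u1 * b1 + u2 * b2 + u3 * b3 = 2 * N * form_eval f x y z \<and>
     a1 * u1^2 + a2 * u2^2 + a3 * u3^2 = N^2 * form_eval f x y z \<and>
     (\<forall>m w1 w2 w3. \<exists>x' y' z'. form_eval f x' y' z' =
        form_eval f x y z + m * (b1 * w1 + b2 * w2 + b3 * w3) + m^2 * (a1 * w1^2 + a2 * w2^2 + a3 * w3^2)))"

text \<open>Serves to bring a positive coefficient to the first place.\<close>

lemma orthogonal_frame_rotate:
  assumes "orthogonal_frame f N a1 a2 a3"
  shows "orthogonal_frame f N a2 a3 a1"
  unfolding orthogonal_frame_def
proof (intro allI)
  fix x y z :: int
  let ?v = "form_eval f x y z"
  obtain b1 b2 b3 u1 u2 u3 where *:
    "u1 * b1 + u2 * b2 + u3 * b3 = 2 * N * ?v" "a1 * u1^2 + a2 * u2^2 + a3 * u3^2 = N^2 * ?v"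
    "\<And>m w1 w2 w3. \<exists>x' y' z'. form_eval f x' y' z' =
      ?v + m * (b1 * w1 + b2 * w2 + b3 * w3) + m^2 * (a1 * w1^2 + a2 * w2^2 + a3 * w3^2)"
    using assms unfolding orthogonal_frame_def by metis
  have "\<exists>x' y' z'. form_eval f x' y' z' =
      ?v + m * (b2 * w2 + b3 * w3 + b1 * w1) + m^2 * (a2 * w2^2 + a3 * w3^2 + a1 * w1^2)" for m w1 w2 w3
    using *(3)[of m w1 w2 w3] by (simp only: add_ac)
  moreover have "u2 * b2 + u3 * b3 + u1 * b1 = 2 * N * ?v" "a2 * u2^2 + a3 * u3^2 + a1 * u1^2 = N^2 * ?v"
    using *(1,2) by (simp_all only: add_ac)
  ultimately show "\<exists>b1 b2 b3 u1 u2 u3. u1 * b1 + u2 * b2 + u3 * b3 = 2 * N * ?v \<and>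
     a2 * u1^2 + a3 * u2^2 + a1 * u3^2 = N^2 * ?v \<and>
     (\<forall>m w1 w2 w3. \<exists>x' y' z'. form_eval f x' y' z' =
        ?v + m * (b1 * w1 + b2 * w2 + b3 * w3) + m^2 * (a2 * w1^2 + a3 * w2^2 + a1 * w3^2))"
    by blast
qed

lemma anisotropic_int:
  assumes "anisotropic f" "form_eval f x y z = (0 :: int)"
  shows "x = 0 \<and> y = 0 \<and> z = 0"
proof -
  have "form_eval f (rat_of_int x) (rat_of_int y) (rat_of_int z) = of_int (form_eval f x y z)"
    by (simp add: form_eval_def)
  then show ?thesis using assms unfolding anisotropic_def by (metis of_int_0 of_int_eq_0_iff)
qed

lemma orthogonal_frame_exists:
  assumes an: "anisotropic f"
  obtains N a1 a2 a3 where "N \<noteq> 0" "a1 \<noteq> 0" "a2 \<noteq> 0" "a3 \<noteq> 0" "orthogonal_frame f N a1 a2 a3"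
    "\<And>x y z. a1 * x^2 + a2 * y^2 + a3 * z^2 = 0 \<Longrightarrow> x = 0 \<and> y = 0 \<and> z = 0"
proof -
  obtain A B C D E G where f: "f = Ternary_Form A B C D E G" by (cases f)
  \<comment> \<open>Gram-Schmidt without denominators. The frame is (1, 0, 0), (- D, 2 A, 0), (p, r,
    d), where the last vector is the cross product of (2 A, D, E) and (D, 2 B, G), the polar forms
    of the first two unit vectors. Its determinant is N = 2 A d.\<close>
  define d p r where "d = 4 * A * B - D^2" and "p = D * G - 2 * B * E" and "r = D * E - 2 * A * G"
  define a3 where "a3 = A * p^2 + B * r^2 + C * d^2 + D * p * r + E * p * d + G * r * d"
  have ev: "form_eval f x y z = A * x^2 + B * y^2 + C * z^2 + D * x * y + E * x * z + G * y * z" for x y z :: int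
    by (simp add: form_eval_def f)
  have A: "A \<noteq> 0"
  proof
    assume "A = 0"
    then have "form_eval f 1 0 0 = (0::int)" by (simp add: ev)
    from anisotropic_int[OF an this] show False by simp
  qed
  have d: "d \<noteq> 0"
  proof
    assume "d = 0"
    moreover have "form_eval f (- D) (2 * A) 0 = A * d" unfolding ev d_def by (simp add: power2_eq_square algebra_simps)
    ultimately have "form_eval f (- D) (2 * A) 0 = 0" by simp
    from anisotropic_int[OF an this] show False using A by simp
  qed
  have a3: "a3 \<noteq> 0"
  proof
    assume "a3 = 0"
    then have "form_eval f p r d = 0" unfolding ev a3_def .
    from anisotropic_int[OF an this] show False using d by simp
  qed
  have diag: "form_eval f (x + m * (w1 - D * w2 + p * w3)) (y + m * (2 * A * w2 + r * w3)) (z + m * (d * w3))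
    = form_eval f x y z + m * ((2 * A * x + D * y + E * z) * w1
        + (- D * (2 * A * x + D * y + E * z) + 2 * A * (D * x + 2 * B * y + G * z)) * w2
        + (d * (E * x + G * y + 2 * C * z) + p * (2 * A * x + D * y + E * z) + r * (D * x + 2 * B * y + G * z)) * w3)
      + m^2 * (A * w1^2 + A * d * w2^2 + a3 * w3^2)" for x y z m w1 w2 w3
    unfolding ev a3_def p_def r_def d_def by algebra
  show ?thesis
  proof
    show "2 * A * d \<noteq> 0" "A \<noteq> 0" "A * d \<noteq> 0" "a3 \<noteq> 0" using A d a3 by auto
    show "orthogonal_frame f (2 * A * d) A (A * d) a3"
      unfolding orthogonal_frame_def
    proof (intro allI)
      fix x y z :: int
      \<comment> \<open>The coordinates of N v, solved from the last one upwards since the frame is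
        triangular.\<close>
      let ?u3 = "2 * A * z" and ?u2 = "d * y - r * z"
      let ?u1 = "2 * A * d * x + D * ?u2 - p * ?u3"
      let ?b1 = "2 * A * x + D * y + E * z"
      let ?b2 = "- D * (2 * A * x + D * y + E * z) + 2 * A * (D * x + 2 * B * y + G * z)"
      let ?b3 = "d * (E * x + G * y + 2 * C * z) + p * (2 * A * x + D * y + E * z) + r * (D * x + 2 * B * y + G * z)"
      have "?u1 * ?b1 + ?u2 * ?b2 + ?u3 * ?b3 = 2 * (2 * A * d) * form_eval f x y z"
        unfolding ev by algebra
      moreover have "A * ?u1^2 + A * d * ?u2^2 + a3 * ?u3^2 = (2 * A * d)^2 * form_eval f x y z"
        unfolding ev a3_def p_def r_def d_def by algebra
      moreover have "\<exists>x' y' z'. form_eval f x' y' z' =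
        form_eval f x y z + m * (?b1 * w1 + ?b2 * w2 + ?b3 * w3) + m^2 * (A * w1^2 + A * d * w2^2 + a3 * w3^2)" for m w1 w2 w3
        using diag by blast
      ultimately show "\<exists>b1 b2 b3 u1 u2 u3.
         u1 * b1 + u2 * b2 + u3 * b3 = 2 * (2 * A * d) * form_eval f x y z \<and>
         A * u1^2 + A * d * u2^2 + a3 * u3^2 = (2 * A * d)^2 * form_eval f x y z \<and>
         (\<forall>m w1 w2 w3. \<exists>x' y' z'. form_eval f x' y' z' =
            form_eval f x y z + m * (b1 * w1 + b2 * w2 + b3 * w3) + m^2 * (A * w1^2 + A * d * w2^2 + a3 * w3^2))"
        by blast
    qed
    fix x y z assume "A * x^2 + A * d * y^2 + a3 * z^2 = 0"
    then have "form_eval f (x - D * y + p * z) (2 * A * y + r * z) (d * z) = 0"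
      using diag[of 0 1 x y z 0 0] by (simp add: ev)
    from anisotropic_int[OF an this] show "x = 0 \<and> y = 0 \<and> z = 0" using A d by auto
  qed
qed

section \<open>Values in a residue class modulo a power of a factorial\<close>

lemma prime_dvd_fact_int_iff:
  fixes p :: int
  assumes "prime p"
  shows "p dvd fact P \<longleftrightarrow> p \<le> int P"
proof -
  have "p dvd fact P \<longleftrightarrow> nat p dvd fact P"
    using prime_gt_0_int[OF assms] by (metis int_dvd_int_iff int_nat_eq less_imp_le of_nat_fact)
  also have "\<dots> \<longleftrightarrow> nat p \<le> P" using assms by (simp add: prime_dvd_fact_iff)
  finally show ?thesis by linarith
qed

text \<open>The gcd d of M and the b_i divides 2 N \<rho>, hence B^k = d e for some e by hypothesis,
  and M = d^2 q with q = B e^2. Moving by d q w in the frame changes the value from \<rho> to \<rho>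
  + M F(w). The odd exponent 2 k + 1 leaves the factor B in q, which supplies all small
  primes.\<close>

lemma values_in_class_lower:
  fixes f :: ternary_form and k P :: nat and c :: real
  defines "B \<equiv> fact P :: int"
  defines "M \<equiv> B ^ (2 * k + 1)"
  assumes fr: "orthogonal_frame f N a1 a2 a3" and a: "a1 > 0" "a2 \<noteq> 0" "a3 \<noteq> 0"
    and P: "P \<ge> 2" "\<bar>a1 * a2 * a3\<bar> \<le> int P"
    and \<rho>: "\<rho> = form_eval f x0 y0 z0" and nd: "gcd M (2 * N * \<rho>) dvd B ^ k"
    and c: "c < 1 / (1 + 768 / real P)"
  shows "eventually (\<lambda>n. c * (real n / real_of_int M) \<le>
    real (card {v \<in> nonzero_values f \<inter> {1..int n}. v mod M = \<rho> mod M})) sequentially"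
proof -
  have B: "B > 0" by (simp add: B_def)
  have M: "M > 0" using B by (simp add: M_def)
  obtain b1 b2 b3 u1 u2 u3 where b:
    "u1 * b1 + u2 * b2 + u3 * b3 = 2 * N * \<rho>"
    "\<And>m w1 w2 w3. \<exists>x' y' z'. form_eval f x' y' z' =
       \<rho> + m * (b1 * w1 + b2 * w2 + b3 * w3) + m^2 * (a1 * w1^2 + a2 * w2^2 + a3 * w3^2)"
    using fr unfolding orthogonal_frame_def \<rho> by metis
  define d where "d = gcd M (gcd b1 (gcd b2 b3))"
  have dpos: "d > 0" using M by (simp add: d_def gcd_pos_int)
  have dM: "d dvd M" by (simp add: d_def)
  have db: "d dvd b1" "d dvd b2" "d dvd b3" unfolding d_def by (auto intro: dvd_trans[OF gcd_dvd2])
  have "d dvd u1 * b1 + u2 * b2 + u3 * b3" using db by (intro dvd_add dvd_mult)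
  then have "d dvd gcd M (2 * N * \<rho>)" using dM b(1) by simp
  then have "d dvd B ^ k" using nd by (rule dvd_trans)
  then obtain e where e: "B ^ k = d * e" by blast
  define q where "q = B * e^2"
  have Mq: "M = d^2 * q"
  proof -
    have "M = B * (B ^ k)^2" unfolding M_def by (simp add: power_even_eq)
    then show ?thesis unfolding e q_def by (simp add: power_mult_distrib)
  qed
  have q: "q > 0" using Mq M dpos by (simp add: zero_less_mult_iff)
  obtain l1 l2 l3 where l: "b1 = d * l1" "b2 = d * l2" "b3 = d * l3" using db by blast
  interpret quadratic_progression l1 l2 l3 a1 a2 a3 q P
  proof
    \<comment> \<open>Otherwise p d would divide M and all b_i, against the choice of d.\<close>
    fix p :: int assume p: "prime p" "p dvd q" "p dvd l1" "p dvd l2" "p dvd l3"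
    have "p * d dvd M" unfolding Mq using p(2) by (auto simp: power2_eq_square mult_ac)
    moreover have "p * d dvd b1" "p * d dvd b2" "p * d dvd b3" unfolding l using p by (auto simp: mult_ac)
    ultimately have "p * d dvd 1 * d" unfolding d_def by simp
    then have "p dvd 1" using dpos by (metis dvd_times_right_cancel_iff less_irrefl)
    then show False using p(1) not_prime_unit by blast
  next
    fix p :: int assume p: "prime p" "p \<le> int P"
    then have "p dvd B" unfolding B_def using prime_dvd_fact_int_iff by blast
    then show "p dvd q" unfolding q_def by simp
  next
    fix p :: int assume p: "prime p" "p dvd a1 * a2 * a3"
    then have "p \<le> \<bar>a1 * a2 * a3\<bar>" using a by (intro zdvd_imp_le) auto
    then have "p \<le> int P" using P by simp
    then have "p dvd B" unfolding B_def using prime_dvd_fact_int_iff[OF p(1)] by blast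
    then show "p dvd q" unfolding q_def by simp
  qed (use q a P in auto)
  have repr: "\<exists>x y z. form_eval f x y z = \<rho> + M * F w" for w
  proof -
    obtain w1 w2 w3 where w: "w = (w1, w2, w3)" by (metis surj_pair)
    obtain x y z where "form_eval f x y z = \<rho> + (d * q) * (b1 * w1 + b2 * w2 + b3 * w3) + (d * q)^2 * (a1 * w1^2 + a2 * w2^2 + a3 * w3^2)"
      using b(2) by blast
    also have "\<dots> = \<rho> + M * F w" unfolding w F_def Mq l prod.case by algebra
    finally show ?thesis by blast
  qed
  have "max c 0 < 1 / (1 + 768 / real P)" using c by (simp add: add_pos_nonneg)
  then obtain c' where "max c 0 < c'" and c'_less: "c' < 1 / (1 + 768 / real P)" using dense by blast
  then have c': "c < c'" "0 < c'" by simp_all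
  define \<kappa> where "\<kappa> = (\<lambda>n::nat. nat ((int n - \<rho>) div M))"
  have \<kappa>low: "real (\<kappa> n) \<ge> (real n - real_of_int \<rho>) / real_of_int M - 1" for n
  proof -
    have "\<lfloor>real_of_int (int n - \<rho>) / real_of_int M\<rfloor> = (int n - \<rho>) div M" by (rule floor_divide_of_int_eq)
    then have "real_of_int (int n - \<rho>) / real_of_int M - 1 \<le> real_of_int ((int n - \<rho>) div M)" by linarith
    then show ?thesis unfolding \<kappa>_def by simp
  qed
  have lim: "filterlim \<kappa> at_top sequentially"
    unfolding filterlim_at_top
  proof
    fix Z
    show "eventually (\<lambda>n. Z \<le> \<kappa> n) sequentially"
      using eventually_ge_at_top[of "nat (\<bar>\<rho>\<bar> + M * int Z)"]
    proof eventually_elim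
      case (elim n)
      then have "M * int Z \<le> int n - \<rho>" by linarith
      then have "(M * int Z) div M \<le> (int n - \<rho>) div M" using M by (intro zdiv_mono1) auto
      then show "Z \<le> \<kappa> n" using M unfolding \<kappa>_def by simp
    qed
  qed
  have "eventually (\<lambda>n. c' * real (\<kappa> n) \<le> real (card ({1..int (\<kappa> n)} \<inter> range F))) sequentially"
    using values_lower_density[OF c'_less] lim by (rule eventually_compose_filterlim)
  moreover have "eventually (\<lambda>n. n \<ge> nat \<bar>\<rho>\<bar>) sequentially" by (rule eventually_ge_at_top)
  moreover have "eventually (\<lambda>n. real n \<ge> (c' * (real_of_int \<rho> / real_of_int M + 1) + \<bar>real_of_int \<rho>\<bar>) * real_of_int M / (c' - c)) sequentially"
    using filterlim_real_sequentially by (simp add: filterlim_at_top)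
  ultimately show ?thesis
  proof eventually_elim
    case (elim n)
    \<comment> \<open>Dropping k <= |\<rho>| keeps \<rho> + M k positive when \<rho> is negative;
      this bounded loss and the rounding in \<kappa> are absorbed by c < c'.\<close>
    let ?S = "({1..int (\<kappa> n)} \<inter> range F) - {1..\<bar>\<rho>\<bar>}"
    let ?V = "{v \<in> nonzero_values f \<inter> {1..int n}. v mod M = \<rho> mod M}"
    have n\<rho>: "int n - \<rho> \<ge> 0" using elim(2) by linarith
    then have \<kappa>n: "int (\<kappa> n) = (int n - \<rho>) div M" unfolding \<kappa>_def using M by (simp add: pos_imp_zdiv_nonneg_iff)
    have "M * ((int n - \<rho>) div M) \<le> int n - \<rho>"
      using M mult_div_mod_eq[of M "int n - \<rho>"] pos_mod_sign[of M "int n - \<rho>"] by linarith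
    then have up: "M * int (\<kappa> n) \<le> int n - \<rho>" unfolding \<kappa>n .
    have "(\<lambda>k. \<rho> + M * k) ` ?S \<subseteq> ?V"
    proof (rule image_subsetI)
      fix k assume k: "k \<in> ?S"
      then obtain w where w: "k = F w" by auto
      have kb: "1 \<le> k" "k \<le> int (\<kappa> n)" "k > \<bar>\<rho>\<bar>" using k by auto
      have "M * k \<le> M * int (\<kappa> n)" "1 * k \<le> M * k" using kb M by (auto intro: mult_left_mono mult_right_mono)
      then have "1 \<le> \<rho> + M * k" "\<rho> + M * k \<le> int n" using up kb by linarith+
      moreover have "\<rho> + M * k \<in> nonzero_values f"
        using repr[of w] calculation unfolding nonzero_values_def w by auto metis
      ultimately show "\<rho> + M * k \<in> ?V" by simp
    qed
    moreover have "finite ?V" by (rule finite_subset[of _ "{1..int n}"]) auto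
    ultimately have "card ((\<lambda>k. \<rho> + M * k) ` ?S) \<le> card ?V" by (intro card_mono)
    moreover have "card ((\<lambda>k. \<rho> + M * k) ` ?S) = card ?S" using M by (intro card_image) (auto simp: inj_on_def)
    moreover have "card ({1..int (\<kappa> n)} \<inter> range F) - card {1..\<bar>\<rho>\<bar>} \<le> card ?S" by (rule diff_card_le_card_Diff) simp
    ultimately have "real (card ({1..int (\<kappa> n)} \<inter> range F)) - real (nat \<bar>\<rho>\<bar>) \<le> real (card ?V)" by simp
    then have "c' * real (\<kappa> n) - \<bar>real_of_int \<rho>\<bar> \<le> real (card ?V)" using elim(1) by simp
    moreover have "c' * ((real n - real_of_int \<rho>) / real_of_int M - 1) \<le> c' * real (\<kappa> n)"
      using \<kappa>low c' by (intro mult_left_mono) auto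
    moreover have "c * (real n / real_of_int M) \<le> c' * ((real n - real_of_int \<rho>) / real_of_int M - 1) - \<bar>real_of_int \<rho>\<bar>"
    proof -
      have "(c' * (real_of_int \<rho> / real_of_int M + 1) + \<bar>real_of_int \<rho>\<bar>) * real_of_int M \<le> real n * (c' - c)"
        using elim(3) c' by (simp add: divide_le_eq)
      then have "c' * (real_of_int \<rho> / real_of_int M + 1) + \<bar>real_of_int \<rho>\<bar> \<le> real n * (c' - c) / real_of_int M"
        using M by (simp add: le_divide_eq)
      then show ?thesis using M by (simp add: diff_divide_distrib algebra_simps)
    qed
    ultimately show ?case by linarith
  qed
qed

text \<open>If the divisibility fails, p^(k+1) divides 2 N \<rho> for some prime p <= P. For each p
  such \<rho> are at least 2^k / |N| >= e apart, and there are at most P primes to consider.\<close>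

lemma card_deep_classes:
  fixes N :: int and k P :: nat
  defines "B \<equiv> fact P :: int"
  defines "M \<equiv> B ^ (2 * k + 1)"
  assumes N: "N \<noteq> 0" and P: "P \<ge> 2" and e: "0 < e" "e * \<bar>N\<bar> \<le> 2 ^ k"
  shows "int (card {\<rho> \<in> {0..<M}. \<not> gcd M (2 * N * \<rho>) dvd B ^ k}) * e \<le> 2 * int P * M"
proof -
  let ?I = "{p \<in> {0..int P}. prime p}"
  let ?A = "\<lambda>p. {\<rho> \<in> {0..<M}. p ^ Suc k dvd 2 * N * \<rho>}"
  have B: "B > 0" by (simp add: B_def)
  have M: "M > 0" using B by (simp add: M_def)
  have pB: "p dvd B \<longleftrightarrow> p \<le> int P" if "prime p" for p :: int
    unfolding B_def by (rule prime_dvd_fact_int_iff[OF that])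
  have sub: "{\<rho> \<in> {0..<M}. \<not> gcd M (2 * N * \<rho>) dvd B ^ k} \<subseteq> (\<Union>p\<in>?I. ?A p)"
  proof
    fix \<rho> assume \<rho>: "\<rho> \<in> {\<rho> \<in> {0..<M}. \<not> gcd M (2 * N * \<rho>) dvd B ^ k}"
    let ?g = "gcd M (2 * N * \<rho>)"
    have g0: "?g \<noteq> 0" using M by simp
    have "\<exists>p. prime p \<and> multiplicity p ?g > multiplicity p (B ^ k)"
    proof (rule ccontr)
      assume "\<nexists>p. prime p \<and> multiplicity p ?g > multiplicity p (B ^ k)"
      then have "multiplicity p ?g \<le> multiplicity p (B ^ k)" if "prime p" for p using that not_le by blast
      then have "?g dvd B ^ k" by (rule multiplicity_le_imp_dvd[OF g0])
      then show False using \<rho> by blast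
    qed
    then obtain p where p: "prime p" "multiplicity p ?g > multiplicity p (B ^ k)" by blast
    have "p dvd ?g" using p(2) by (metis not_dvd_imp_multiplicity_0 not_less_zero)
    then have "p dvd M" by simp
    then have "p dvd B" unfolding M_def using p(1) prime_dvd_power by blast
    then have pI: "p \<in> ?I" using pB[OF p(1)] p(1) prime_gt_0_int[OF p(1)] by simp
    have "p ^ k dvd B ^ k" using \<open>p dvd B\<close> by (rule dvd_power_same)
    then have "k \<le> multiplicity p (B ^ k)" using B p(1) by (intro multiplicity_geI) (auto simp: not_prime_unit)
    then have "Suc k \<le> multiplicity p ?g" using p(2) by simp
    then have "p ^ Suc k dvd ?g" by (rule multiplicity_dvd')
    then have "p ^ Suc k dvd 2 * N * \<rho>" by (metis gcd_dvd2 dvd_trans)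
    then show "\<rho> \<in> (\<Union>p\<in>?I. ?A p)" using pI \<rho> by blast
  qed
  have "1 \<le> B" using B by simp
  then have "B ^ 1 \<le> M" unfolding M_def by (intro power_increasing) auto
  have eM: "e \<le> M"
  proof -
    have "e * 1 \<le> e * \<bar>N\<bar>" using N e(1) by (intro mult_left_mono) auto
    then have "e \<le> 2 ^ k" using e by linarith
    also have "(2::int) ^ k \<le> B ^ k"
    proof -
      have "(2::int) dvd B" using pB[of 2] P by simp
      then have "2 \<le> B" using B by (intro zdvd_imp_le) auto
      then show ?thesis by (intro power_mono) auto
    qed
    also have "\<dots> \<le> M" unfolding M_def using \<open>1 \<le> B\<close> by (intro power_increasing) auto
    finally show ?thesis .
  qed
  have each: "int (card (?A p)) * e \<le> 2 * M" if p: "p \<in> ?I" for p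
  proof -
    have "int (card (?A p)) * e \<le> (M - 1) - 0 + e"
    proof (rule card_separated_le)
      fix x y assume xy: "x \<in> ?A p" "y \<in> ?A p" "x < y"
      have "p ^ Suc k dvd 2 * N * y - 2 * N * x" using xy by (intro dvd_diff) auto
      then have "p ^ Suc k dvd \<bar>2 * N * (y - x)\<bar>" by (simp add: algebra_simps)
      then have "p ^ Suc k \<le> \<bar>2 * N * (y - x)\<bar>" using xy N by (intro zdvd_imp_le) auto
      also have "\<dots> = 2 * (\<bar>N\<bar> * (y - x))" using xy by (simp add: abs_mult)
      finally have 1: "p ^ Suc k \<le> 2 * (\<bar>N\<bar> * (y - x))" .
      have "p \<ge> 2" using p prime_ge_2_int by auto
      then have "(2::int) ^ Suc k \<le> p ^ Suc k" by (intro power_mono) auto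
      then have "2 ^ k \<le> \<bar>N\<bar> * (y - x)" using 1 by simp
      then have "\<bar>N\<bar> * e \<le> \<bar>N\<bar> * (y - x)" using e by (simp add: mult.commute)
      then have "e \<le> y - x" using N by simp
      then show "x + e \<le> y" by simp
    qed (use e M in auto)
    then show ?thesis using eM by simp
  qed
  have fin: "finite ?I" by (rule finite_subset[of _ "{0..int P}"]) auto
  have "card ?I \<le> card {1..int P}" by (intro card_mono) (auto dest: prime_gt_0_int)
  then have cI: "int (card ?I) \<le> int P" by simp
  have fA: "finite (\<Union>p\<in>?I. ?A p)" by (rule finite_subset[of _ "{0..<M}"]) auto
  have "int (card {\<rho> \<in> {0..<M}. \<not> gcd M (2 * N * \<rho>) dvd B ^ k}) * e \<le> int (card (\<Union>p\<in>?I. ?A p)) * e"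
    using card_mono[OF fA sub] e by (intro mult_right_mono) auto
  also have "\<dots> \<le> (\<Sum>p\<in>?I. int (card (?A p))) * e"
  proof -
    have "int (card (\<Union>p\<in>?I. ?A p)) \<le> int (\<Sum>p\<in>?I. card (?A p))"
      using card_UN_le[OF fin, of ?A] by (simp only: of_nat_le_iff)
    then show ?thesis using e by (intro mult_right_mono) auto
  qed
  also have "\<dots> = (\<Sum>p\<in>?I. int (card (?A p)) * e)" by (rule sum_distrib_right)
  also have "\<dots> \<le> (\<Sum>p\<in>?I. 2 * M)" using each by (intro sum_mono) auto
  also have "\<dots> = int (card ?I) * (2 * M)" by simp
  also have "\<dots> \<le> int P * (2 * M)" using cI M by (intro mult_right_mono) auto
  finally show ?thesis by (simp add: mult_ac)
qed

lemma card_residue_class_le: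
  fixes M :: int
  assumes "M > 0"
  shows "real (card {v \<in> {1..int n}. v mod M = \<rho>}) \<le> real n / real_of_int M + 1"
proof (cases "n = 0")
  case False
  have "int (card {v \<in> {1..int n}. v mod M = \<rho>}) * M \<le> int n - 1 + M"
  proof (rule card_separated_le)
    fix x y assume xy: "x \<in> {v \<in> {1..int n}. v mod M = \<rho>}" "y \<in> {v \<in> {1..int n}. v mod M = \<rho>}" "x < y"
    then have "y mod M = x mod M" by simp
    then have "M dvd y - x" by (simp only: mod_eq_dvd_iff)
    then have "M \<le> y - x" using xy by (intro zdvd_imp_le) auto
    then show "x + M \<le> y" by simp
  qed (use assms False in auto)
  then have "int (card {v \<in> {1..int n}. v mod M = \<rho>}) * M \<le> int n + M" by simp
  then have "real_of_int (int (card {v \<in> {1..int n}. v mod M = \<rho>}) * M) \<le> real_of_int (int n + M)" by (simp only: of_int_le_iff)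
  then have "real (card {v \<in> {1..int n}. v mod M = \<rho>}) * real_of_int M \<le> real n + real_of_int M" by simp
  then show ?thesis using assms by (simp add: field_simps)
qed (use assms in simp)

lemma convergent_if_approximable:
  fixes s :: "nat \<Rightarrow> real"
  assumes "\<And>\<epsilon>. \<epsilon> > 0 \<Longrightarrow> \<exists>a. eventually (\<lambda>n. \<bar>s n - a\<bar> \<le> \<epsilon>) sequentially"
  shows "convergent s"
  unfolding Cauchy_convergent_iff[symmetric]
proof (rule CauchyI)
  fix e :: real assume e: "e > 0"
  then obtain a where "eventually (\<lambda>n. \<bar>s n - a\<bar> \<le> e / 3) sequentially" using assms[of "e / 3"] by auto
  then obtain M where M: "\<And>n. n \<ge> M \<Longrightarrow> \<bar>s n - a\<bar> \<le> e / 3" unfolding eventually_sequentially by blast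
  have "norm (s m - s n) < e" if "m \<ge> M" "n \<ge> M" for m n
  proof -
    have "\<bar>s m - s n\<bar> \<le> \<bar>s m - a\<bar> + \<bar>s n - a\<bar>" by linarith
    then show ?thesis using M[OF that(1)] M[OF that(2)] e by simp
  qed
  then show "\<exists>M. \<forall>m\<ge>M. \<forall>n\<ge>M. norm (s m - s n) < e" by blast
qed

text \<open>The counting ratio is compared with the proportion of classes modulo M that contain
  values. The upper bound is trivial; for the lower one, all but a share \<epsilon> of the classes
  satisfy \<open>values_in_class_lower\<close> with density at least 1 - \<epsilon>. As M depends on
  \<epsilon>, the limit is obtained through the Cauchy property.\<close>

lemma positive_values_convergent:
  assumes fr: "orthogonal_frame f N a1 a2 a3" and a: "a1 > 0" "a2 \<noteq> 0" "a3 \<noteq> 0" and N: "N \<noteq> 0"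
  shows "convergent (\<lambda>n. real (card (nonzero_values f \<inter> {1..int n})) / real n)"
proof (rule convergent_if_approximable)
  fix \<epsilon>0 :: real assume \<epsilon>0: "\<epsilon>0 > 0"
  define \<epsilon> where "\<epsilon> = min (\<epsilon>0 / 2) (1 / 2)"
  have \<epsilon>: "0 < \<epsilon>" "\<epsilon> < 1" "2 * \<epsilon> \<le> \<epsilon>0" using \<epsilon>0 by (auto simp: \<epsilon>_def)
  \<comment> \<open>At least |a1 a2 a3|, so that all primes of the coefficients divide P!, and above
    768 / \<epsilon>, so that 1 / (1 + 768 / P) exceeds 1 - \<epsilon>.\<close>
  define P where "P = nat \<bar>a1 * a2 * a3\<bar> + nat \<lceil>768 / \<epsilon>\<rceil> + 2"
  have P: "P \<ge> 2" "\<bar>a1 * a2 * a3\<bar> \<le> int P" by (auto simp: P_def)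
  have P\<epsilon>: "real P > 768 / \<epsilon>" unfolding P_def using \<epsilon> by linarith
  have "768 / real P < \<epsilon>" using P\<epsilon> P \<epsilon> by (simp add: field_simps)
  moreover have "(1 - x) * (1 + x) \<le> 1" for x :: real by (simp add: algebra_simps)
  then have "1 - 768 / real P \<le> 1 / (1 + 768 / real P)" by (simp add: le_divide_eq add_pos_nonneg)
  ultimately have c: "1 - \<epsilon> < 1 / (1 + 768 / real P)" by linarith
  \<comment> \<open>\<open>card_deep_classes\<close> bounds the number of bad classes by 2 P M / e,
    which is to be at most \<epsilon> M.\<close>
  define e where "e = \<lceil>2 * real P / \<epsilon>\<rceil>"
  have e: "e > 0" "2 * real P / real_of_int e \<le> \<epsilon>"
  proof -
    have pos: "2 * real P / \<epsilon> > 0" using P \<epsilon> by simp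
    then show "e > 0" unfolding e_def by simp
    moreover have "2 * real P / \<epsilon> \<le> real_of_int e" unfolding e_def by simp
    ultimately show "2 * real P / real_of_int e \<le> \<epsilon>" using \<epsilon> by (simp add: field_simps)
  qed
  define k where "k = nat (e * \<bar>N\<bar>)"
  have ek: "e * \<bar>N\<bar> \<le> 2 ^ k"
  proof -
    have "int k < 2 ^ k" using less_exp[of k] by (metis of_nat_less_iff of_nat_power of_nat_numeral)
    then show ?thesis using e unfolding k_def by simp
  qed
  define B :: int where "B = fact P"
  define M where "M = B ^ (2 * k + 1)"
  have M: "M > 0" by (simp add: M_def B_def)
  let ?D = "\<lambda>n::nat. nonzero_values f \<inter> {1..int n}"
  let ?C = "\<lambda>n \<rho>. {v \<in> ?D n. v mod M = \<rho>}" and ?\<mu> = "\<lambda>n::nat. real n / real_of_int M"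
  define R where "R = {\<rho> \<in> {0..<M}. \<exists>x y z. form_eval f x y z mod M = \<rho>}"
  define G where "G = {\<rho> \<in> R. gcd M (2 * N * \<rho>) dvd B ^ k}"
  have finR: "finite R" unfolding R_def by (rule finite_subset[of _ "{0..<M}"]) auto
  have finG: "finite G" using finR by (simp add: G_def)
  define a where "a = real (card R) / real_of_int M"
  have cR: "real (card R) \<le> real_of_int M"
  proof -
    have "card R \<le> card {0..<M}" unfolding R_def by (intro card_mono) auto
    then have "int (card R) \<le> M" using M by simp
    then show ?thesis by (metis of_int_le_iff of_int_of_nat_eq)
  qed
  have a1': "a \<le> 1" unfolding a_def using cR M by (simp add: divide_le_eq)
  have cG: "real (card R) - \<epsilon> * real_of_int M \<le> real (card G)"
  proof -
    let ?Bad = "{\<rho> \<in> {0..<M}. \<not> gcd M (2 * N * \<rho>) dvd B ^ k}"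
    have finB: "finite ?Bad" by (rule finite_subset[of _ "{0..<M}"]) auto
    have "R \<subseteq> G \<union> ?Bad" unfolding G_def R_def by auto
    then have "card R \<le> card (G \<union> ?Bad)" using finG finB by (intro card_mono) auto
    also have "\<dots> \<le> card G + card ?Bad" by (rule card_Un_le)
    finally have 1: "real (card R) \<le> real (card G) + real (card ?Bad)" by (simp flip: of_nat_add)
    have "int (card ?Bad) * e \<le> 2 * int P * M"
      unfolding M_def B_def by (rule card_deep_classes[OF N P(1) e(1) ek])
    then have "real_of_int (int (card ?Bad) * e) \<le> real_of_int (2 * int P * M)" by (simp only: of_int_le_iff)
    then have "real (card ?Bad) \<le> (2 * real P / real_of_int e) * real_of_int M" using e(1) by (simp add: field_simps)
    also have "\<dots> \<le> \<epsilon> * real_of_int M" using e(2) M by (intro mult_right_mono) auto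
    finally show ?thesis using 1 by simp
  qed
  have lower1: "eventually (\<lambda>n. (1 - \<epsilon>) * (?\<mu> n) \<le> real (card (?C n \<rho>))) sequentially"
    if \<rho>: "\<rho> \<in> G" for \<rho>
  proof -
    obtain x y z where xyz: "form_eval f x y z mod M = \<rho>" using \<rho> unfolding G_def R_def by blast
    let ?v = "form_eval f x y z :: int"
    have "M dvd ?v - \<rho>" using xyz by (metis dvd_minus_mod)
    then obtain j where j: "?v = \<rho> + M * j" by (metis add.commute diff_add_cancel dvdE)
    have "2 * N * ?v = 2 * N * \<rho> + (2 * N * j) * M" by (simp add: j algebra_simps)
    then have "gcd M (2 * N * ?v) = gcd M (2 * N * \<rho>)" by (metis add.commute gcd_add_mult mult.commute)
    then have "gcd M (2 * N * ?v) dvd B ^ k" using \<rho> unfolding G_def by simp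
    then have "eventually (\<lambda>n. (1 - \<epsilon>) * (?\<mu> n) \<le>
        real (card {v \<in> ?D n. v mod M = ?v mod M})) sequentially"
      unfolding M_def B_def by (intro values_in_class_lower[OF fr a P refl _ c])
    then show ?thesis unfolding xyz .
  qed
  have "eventually (\<lambda>n. \<forall>\<rho>\<in>G. (1 - \<epsilon>) * (?\<mu> n) \<le> real (card (?C n \<rho>))) sequentially"
    using finG lower1 by (intro eventually_ball_finite) auto
  moreover have "eventually (\<lambda>n. real n \<ge> real (card R) / \<epsilon> + 1) sequentially"
    using filterlim_real_sequentially by (simp add: filterlim_at_top)
  ultimately have "eventually (\<lambda>n. \<bar>real (card (?D n)) / real n - a\<bar> \<le> \<epsilon>0) sequentially"
  proof eventually_elim
    case (elim n)
    have npos: "real n > 0" using elim(2) \<epsilon> by (smt (verit) divide_nonneg_pos of_nat_0_le_iff)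
    have split: "card {v \<in> ?D n. v mod M \<in> S} = (\<Sum>\<rho>\<in>S. card (?C n \<rho>))" if "finite S" for S
    proof -
      have eq: "{v \<in> ?D n. v mod M \<in> S} = (\<Union>\<rho>\<in>S. (?C n \<rho>))" by auto
      have "finite (?C n \<rho>)" for \<rho> by (rule finite_subset[of _ "{1..int n}"]) auto
      then show ?thesis unfolding eq using that by (intro card_UN_disjoint) auto
    qed
    have "?D n = {v \<in> ?D n. v mod M \<in> R}" unfolding R_def nonzero_values_def using M by auto
    then have "card (?D n) = (\<Sum>\<rho>\<in>R. card (?C n \<rho>))" using split[OF finR] by simp
    then have "real (card (?D n)) = (\<Sum>\<rho>\<in>R. real (card (?C n \<rho>)))" by simp
    also have "\<dots> \<le> (\<Sum>\<rho>\<in>R. ?\<mu> n + 1)"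
    proof (rule sum_mono)
      fix \<rho>
      have "card (?C n \<rho>) \<le> card {v \<in> {1..int n}. v mod M = \<rho>}"
        by (rule card_mono) (auto intro: finite_subset[of _ "{1..int n}"])
      then show "real (card (?C n \<rho>)) \<le> ?\<mu> n + 1"
        using card_residue_class_le[OF M, of n \<rho>] by linarith
    qed
    also have "\<dots> = real (card R) * (?\<mu> n + 1)" by simp
    also have "\<dots> = a * real n + real (card R)" by (simp add: a_def algebra_simps)
    also have "real (card R) \<le> \<epsilon> * real n"
    proof -
      have "real (card R) / \<epsilon> \<le> real n" using elim(2) by simp
      then show ?thesis using \<epsilon> by (simp add: divide_le_eq mult.commute)
    qed
    finally have up: "real (card (?D n)) \<le> (a + \<epsilon>) * real n" by (simp add: algebra_simps)
    have "(a - \<epsilon>) * ((1 - \<epsilon>) * real n) = (real (card R) - \<epsilon> * real_of_int M) * ((1 - \<epsilon>) * (?\<mu> n))"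
      using M by (simp add: a_def field_simps)
    also have "\<dots> \<le> real (card G) * ((1 - \<epsilon>) * (?\<mu> n))"
      using cG \<epsilon> M by (intro mult_right_mono) auto
    also have "\<dots> = (\<Sum>\<rho>\<in>G. (1 - \<epsilon>) * (?\<mu> n))" by simp
    also have "\<dots> \<le> (\<Sum>\<rho>\<in>G. real (card (?C n \<rho>)))" using elim(1) by (intro sum_mono) auto
    also have "\<dots> = real (card {v \<in> ?D n. v mod M \<in> G})" using split[OF finG] by simp
    also have "\<dots> \<le> real (card (?D n))" by (simp only: of_nat_le_iff, rule card_mono) auto
    finally have lo: "(a - \<epsilon>) * (1 - \<epsilon>) * real n \<le> real (card (?D n))" by (simp add: mult_ac)
    have "a * \<epsilon> \<le> 1 * \<epsilon>" using a1' \<epsilon> by (intro mult_right_mono) auto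
    moreover have "(a - \<epsilon>) * (1 - \<epsilon>) = a - a * \<epsilon> - \<epsilon> + \<epsilon> * \<epsilon>" by (simp add: algebra_simps)
    ultimately have "a - 2 * \<epsilon> \<le> (a - \<epsilon>) * (1 - \<epsilon>)" using \<epsilon> zero_le_square[of \<epsilon>] by linarith
    then have "(a - 2 * \<epsilon>) * real n \<le> (a - \<epsilon>) * (1 - \<epsilon>) * real n" by (rule mult_right_mono) simp
    then have "(a - 2 * \<epsilon>) * real n \<le> real (card (?D n))" using lo by linarith
    then have "a - 2 * \<epsilon> \<le> real (card (?D n)) / real n" "real (card (?D n)) / real n \<le> a + \<epsilon>"
      using up npos by (simp_all add: le_divide_eq divide_le_eq)
    then show ?case using \<epsilon> by linarith
  qed
  then show "\<exists>a. eventually (\<lambda>n. \<bar>real (card (?D n)) / real n - a\<bar> \<le> \<epsilon>0) sequentially" ..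
qed

lemma positive_density_less_one:
  assumes an: "anisotropic f"
  obtains L where "(\<lambda>n. real (card (nonzero_values f \<inter> {1..int n})) / real n) \<longlonglongrightarrow> L" "L < 1"
proof -
  let ?D = "\<lambda>n::nat. nonzero_values f \<inter> {1..int n}"
  obtain N a1 a2 a3 where fr: "N \<noteq> 0" "a1 \<noteq> 0" "a2 \<noteq> 0" "a3 \<noteq> 0" "orthogonal_frame f N a1 a2 a3"
    and an': "\<And>x y z. a1 * x^2 + a2 * y^2 + a3 * z^2 = 0 \<Longrightarrow> x = 0 \<and> y = 0 \<and> z = 0"
    using orthogonal_frame_exists[OF an] by blast
  have diag: "\<exists>u1 u2 u3. a1 * u1^2 + a2 * u2^2 + a3 * u3^2 = N^2 * v" if "v \<in> nonzero_values f" for v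
    using that fr(5) unfolding nonzero_values_def orthogonal_frame_def by fastforce
  have "convergent (\<lambda>n. real (card (?D n)) / real n)"
  proof (cases "a1 > 0 \<or> a2 > 0 \<or> a3 > 0")
    case True
    then consider "a1 > 0" | "a2 > 0" | "a3 > 0" by blast
    then show ?thesis
    proof cases
      case 1
      show ?thesis by (rule positive_values_convergent[OF fr(5) 1 fr(3,4,1)])
    next
      case 2
      show ?thesis by (rule positive_values_convergent[OF orthogonal_frame_rotate[OF fr(5)] 2 fr(4,2,1)])
    next
      case 3
      show ?thesis by (rule positive_values_convergent[OF orthogonal_frame_rotate[OF orthogonal_frame_rotate[OF fr(5)]] 3 fr(2,3,1)])
    qed
  next
    case False
    have "?D n = {}" for n
    proof (rule equals0I)
      fix v assume v: "v \<in> ?D n"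
      then obtain u1 u2 u3 where u: "a1 * u1^2 + a2 * u2^2 + a3 * u3^2 = N^2 * v" using diag by blast
      have "a1 * u1^2 \<le> 0" "a2 * u2^2 \<le> 0" "a3 * u3^2 \<le> 0" using False by (auto simp: mult_nonpos_nonneg)
      moreover have "N^2 * v > 0" using fr(1) v by auto
      ultimately show False using u by linarith
    qed
    then show ?thesis by (simp add: convergent_const)
  qed
  then obtain L where L: "(\<lambda>n. real (card (?D n)) / real n) \<longlonglongrightarrow> L" unfolding convergent_def by blast
  obtain p k where p: "prime p" "\<And>x y z. p ^ k dvd a1 * x^2 + a2 * y^2 + a3 * z^2 \<Longrightarrow> p dvd x \<and> p dvd y \<and> p dvd z"
    using anisotropic_at_some_prime[OF fr(2,3,4) an'] by blast
  have nz: "a1 * a2 * a3 * N \<noteq> 0" using fr by simp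
  \<comment> \<open>The diagonal form represents N^2 v for every value v of f, so the class of - a1
    a2 a3 modulo p^K contains no value.\<close>
  obtain K where K: "\<And>x y z n. a1 * x^2 + a2 * y^2 + a3 * z^2 = N^2 * n \<Longrightarrow> \<not> p ^ K dvd n + a1 * a2 * a3"
    using unrepresented_class[OF p(1) nz, of k] p(2) by blast
  define q where "q = p ^ K"
  have q: "q > 0" unfolding q_def using p(1) prime_gt_0_int by simp
  define s where "s = (a1 * a2 * a3) mod q"
  have s: "0 \<le> s" "s < q" using q by (auto simp: s_def)
  have miss: "v \<notin> nonzero_values f" if "q dvd v + a1 * a2 * a3" for v
    using diag K that unfolding q_def by blast
  have bound: "real (card (?D n)) / real n \<le> 1 - 1 / real_of_int q + 1 / real n" if n: "n \<ge> 1" for n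
  proof -
    \<comment> \<open>Members of the missed class in [1, n]; 0 <= s < q makes the first of them
      positive.\<close>
    let ?A = "(\<lambda>j. q * j - s) ` {1..int n div q}"
    have A: "?A \<subseteq> {1..int n}"
    proof (rule image_subsetI)
      fix j assume j: "j \<in> {1..int n div q}"
      have "q * 1 \<le> q * j" "q * j \<le> q * (int n div q)" using j q by (auto intro: mult_left_mono)
      moreover have "q * (int n div q) \<le> int n" 
        using q mult_div_mod_eq[of q "int n"] pos_mod_sign[of q "int n"] by linarith
      ultimately have "1 \<le> q * j - s" "q * j - s \<le> int n" using s by linarith+
      then show "q * j - s \<in> {1..int n}" by simp
    qed
    have disj: "?A \<inter> ?D n = {}"
    proof -
      have "q dvd (q * j - s) + a1 * a2 * a3" for j
      proof -
        have "q dvd a1 * a2 * a3 - s" unfolding s_def by (rule dvd_minus_mod)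
        then have "q dvd q * j + (a1 * a2 * a3 - s)" by (intro dvd_add) auto
        then show ?thesis by (simp add: algebra_simps)
      qed
      then show ?thesis using miss by blast
    qed
    have cA: "card ?A = nat (int n div q)"
      using q by (subst card_image) (auto simp: inj_on_def)
    have "card ?A + card (?D n) = card (?A \<union> ?D n)" using disj by (subst card_Un_disjoint) auto
    also have "\<dots> \<le> card {1..int n}" using A by (intro card_mono) auto
    finally have "real (nat (int n div q)) + real (card (?D n)) \<le> real n" unfolding cA by simp
    moreover have "real n / real_of_int q - 1 \<le> real (nat (int n div q))"
    proof -
      have "\<lfloor>real_of_int (int n) / real_of_int q\<rfloor> = int n div q" by (rule floor_divide_of_int_eq)
      then show ?thesis by simp linarith
    qed
    ultimately have "real (card (?D n)) \<le> real n * (1 - 1 / real_of_int q + 1 / real n)" using n by (simp add: algebra_simps)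
    then show ?thesis using n by (simp add: divide_le_eq mult.commute)
  qed
  have "(\<lambda>n. 1 - 1 / real_of_int q + 1 / real n) \<longlonglongrightarrow> 1 - 1 / real_of_int q + 0"
    by (intro tendsto_intros lim_1_over_n)
  then have "L \<le> 1 - 1 / real_of_int q + 0" by (rule LIMSEQ_le[OF L]) (use bound in blast)
  moreover have "1 / real_of_int q > 0" using q by simp
  ultimately have "L < 1" by linarith
  then show ?thesis using that L by blast
qed

section \<open>Negative values and the two-sided density\<close>

definition negated_form :: "ternary_form \<Rightarrow> ternary_form" where
  "negated_form f = Ternary_Form (- c11 f) (- c22 f) (- c33 f) (- c12 f) (- c13 f) (- c23 f)"

lemma form_eval_negated_form: "form_eval (negated_form f) x y z = - form_eval f x y z"
  by (simp add: form_eval_def negated_form_def algebra_simps)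

lemma anisotropic_negated_form: "anisotropic f \<Longrightarrow> anisotropic (negated_form f)"
  unfolding anisotropic_def form_eval_negated_form neg_equal_0_iff_equal .

lemma nonzero_values_negated_form: "nonzero_values (negated_form f) = uminus ` nonzero_values f"
proof -
  have eq: "{form_eval (negated_form f) x y z | x y z :: int. True} = uminus ` {form_eval f x y z | x y z. True}"
    unfolding form_eval_negated_form by blast
  show ?thesis unfolding nonzero_values_def eq by (simp add: image_set_diff)
qed

lemma card_negative_values:
  "card (nonzero_values f \<inter> {- int n..-1}) = card (nonzero_values (negated_form f) \<inter> {1..int n})"
proof -
  have "nonzero_values (negated_form f) \<inter> {1..int n} = uminus ` (nonzero_values f \<inter> {- int n..-1})"
    unfolding nonzero_values_negated_form by (auto simp: image_iff)
  then show ?thesis by (simp add: card_image)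
qed

theorem theorem1p8:
  fixes f :: ternary_form
  assumes "nondegenerate f"
    and "anisotropic f"
  shows "has_density (nonzero_values f) \<and> form_density f < 1"
proof -
  let ?S = "nonzero_values f"
  let ?p = "\<lambda>n. real (card (?S \<inter> {1..int n})) / real n"
  let ?m = "\<lambda>n. real (card (?S \<inter> {- int n..-1})) / real n"
  obtain L where L: "?p \<longlonglongrightarrow> L" "L < 1" using positive_density_less_one[OF assms(2)] by blast
  obtain L' where L': "?m \<longlonglongrightarrow> L'" "L' < 1"
    using positive_density_less_one[OF anisotropic_negated_form[OF assms(2)]]
    unfolding card_negative_values by blast
  have "\<exists>l<1. density_seq ?S \<longlonglongrightarrow> l"
  proof -
    consider "positive_set ?S" | "\<not> positive_set ?S" "negative_set ?S" | "\<not> positive_set ?S" "\<not> negative_set ?S" by blast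
    then show ?thesis
    proof cases
      case 1
      then have "density_seq ?S = ?p" by (auto simp: density_seq_def)
      then show ?thesis using L by auto
    next
      case 2
      then have "density_seq ?S = ?m" by (auto simp: density_seq_def)
      then show ?thesis using L' by auto
    next
      \<comment> \<open>Since 0 is excluded from the set, the two-sided count is the sum of the
        one-sided ones and the density is the mean of the two one-sided limits.\<close>
      case 3
      have "density_seq ?S n = (?p n + ?m n) / 2" for n
      proof -
        have "?S \<inter> {- int n..int n} = (?S \<inter> {1..int n}) \<union> (?S \<inter> {- int n..-1})"
          by (auto simp: nonzero_values_def)
        then have "card (?S \<inter> {- int n..int n}) = card (?S \<inter> {1..int n}) + card (?S \<inter> {- int n..-1})"
          by (simp only:) (rule card_Un_disjoint; auto)
        then show ?thesis using 3 by (simp add: density_seq_def add_divide_distrib)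
      qed
      then have "density_seq ?S = (\<lambda>n. (?p n + ?m n) / 2)" by blast
      moreover have "(\<lambda>n. (?p n + ?m n) / 2) \<longlonglongrightarrow> (L + L') / 2" by (intro tendsto_intros L L') simp
      moreover have "(L + L') / 2 < 1" using L L' by simp
      ultimately show ?thesis by (intro exI[of _ "(L + L') / 2"]) simp
    qed
  qed
  then obtain l where l: "l < 1" "density_seq ?S \<longlonglongrightarrow> l" by blast
  then show ?thesis
    unfolding has_density_def form_density_def density_def by (auto simp: convergentI limI)
qed

end
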